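(* Let $X$ be a compact Hausdorff space with covering dimension $d<\infty$. Let $n\in\mathbb N$. The following are true: (i) The $C^*$-algebra $C(X,M_n)$ has the uniform Dixmier property with constants $(m,\gamma)$ for $m=d+2$ and every $\gamma\in((d+1)/(d+2),1)$. It has the uniform singleton Dixmier property with constants $(M,\Upsilon)$ for $M=3d+4$ and every $\Upsilon\in((3d+2)/(3d+4),1)$. (ii) If $d\le2$ and in Čech cohomology $\check H^2(X)=0$, then $C(X,M_n)$ has the uniform Dixmier property with constants $(m,\gamma)$ for $m=2$ and every $\gamma\in(1/2,1)$, and the uniform singleton Dixmier property with constants $(M,\Upsilon)$ for $M=4$ and every $\Upsilon\in(1/2,1)$.
   Context: $M_n$ is the algebra of complex $n\times n$ matrices. Let $A$ be a unital $C^*$-algebra with centre $Z(A)$ and unitary group $\mathcal U(A)$. $A$ has the uniform Dixmier property with constants $(m,\gamma)$ ($m\in\mathbb N$, $0<\gamma<1$) if for every self-adjoint $a\in A$ there exist $z\in Z(A)$ and $u_1,\dots,u_m\in\mathcal U(A)$ with $\|\sum_{i=1}^m\frac1mu_iau_i^*-z\|\le\gamma\|a\|$. For $a\in A$, $D_A(a)$ is the norm-closed convex hull of $\{uau^*:u\in\mathcal U(A)\}$; $A$ has the singleton Dixmier property if $D_A(a)\cap Z(A)$ is a singleton for all $a\in A$, and then $R:A\to Z(A)$ denotes the map with $\{R(a)\}=D_A(a)\cap Z(A)$ (the unique centre-valued trace of $A$). $A$ has the uniform singleton Dixmier property with constants $(M,\Upsilon)$ ($M\in\mathbb N$, $0<\Upsilon<1$)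 if $A$ has the singleton Dixmier property and for every self-adjoint $a\in A$ there exist $u_1,\dots,u_M\in\mathcal U(A)$ with $\|\sum_{i=1}^M\frac1Mu_iau_i^*-R(a)\|\le\Upsilon\|a-R(a)\|$. Čech cohomology is taken with integer coefficients. *)

theory Defs
  imports "HOL-Analysis.Analysis" "HOL-Algebra.Ring"
begin

section \<open>Unital C*-algebras\<close>

text \<open>
  A complex *-algebra with a norm, as a structure with an explicit carrier extending the ring
  records of \<^theory>\<open>HOL-Algebra.Ring\<close>.
\<close>

record 'a star_algebra = "'a ring" +
  cscale :: "complex \<Rightarrow> 'a \<Rightarrow> 'a"
  star :: "'a \<Rightarrow> 'a"
  cnorm :: "'a \<Rightarrow> real"

locale unital_cstar_algebra = ring A for A :: "('a, 'b) star_algebra_scheme" (structure) +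
  assumes cscale_closed: "a \<in> carrier A \<Longrightarrow> cscale A c a \<in> carrier A"
    and cscale_add_right: "a \<in> carrier A \<Longrightarrow> b \<in> carrier A \<Longrightarrow>
          cscale A c (a \<oplus> b) = cscale A c a \<oplus> cscale A c b"
    and cscale_add_left: "a \<in> carrier A \<Longrightarrow>
          cscale A (c + d) a = cscale A c a \<oplus> cscale A d a"
    and cscale_cscale: "a \<in> carrier A \<Longrightarrow> cscale A c (cscale A d a) = cscale A (c * d) a"
    and cscale_one: "a \<in> carrier A \<Longrightarrow> cscale A 1 a = a"
    and cscale_mult_left: "a \<in> carrier A \<Longrightarrow> b \<in> carrier A \<Longrightarrow>
          cscale A c a \<otimes> b = cscale A c (a \<otimes> b)"
    and cscale_mult_right: "a \<in> carrier A \<Longrightarrow> b \<in> carrier A \<Longrightarrow>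
          a \<otimes> cscale A c b = cscale A c (a \<otimes> b)"
    and star_closed: "a \<in> carrier A \<Longrightarrow> star A a \<in> carrier A"
    and star_add: "a \<in> carrier A \<Longrightarrow> b \<in> carrier A \<Longrightarrow>
          star A (a \<oplus> b) = star A a \<oplus> star A b"
    and star_cscale: "a \<in> carrier A \<Longrightarrow> star A (cscale A c a) = cscale A (cnj c) (star A a)"
    and star_mult: "a \<in> carrier A \<Longrightarrow> b \<in> carrier A \<Longrightarrow>
          star A (a \<otimes> b) = star A b \<otimes> star A a"
    and star_star: "a \<in> carrier A \<Longrightarrow> star A (star A a) = a"
    and cnorm_eq_0: "a \<in> carrier A \<Longrightarrow> cnorm A a = 0 \<longleftrightarrow> a = \<zero>"
    and cnorm_triangle: "a \<in> carrier A \<Longrightarrow> b \<in> carrier A \<Longrightarrow>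
          cnorm A (a \<oplus> b) \<le> cnorm A a + cnorm A b"
    and cnorm_cscale: "a \<in> carrier A \<Longrightarrow> cnorm A (cscale A c a) = cmod c * cnorm A a"
    and cnorm_mult: "a \<in> carrier A \<Longrightarrow> b \<in> carrier A \<Longrightarrow>
          cnorm A (a \<otimes> b) \<le> cnorm A a * cnorm A b"
    and cstar_identity: "a \<in> carrier A \<Longrightarrow> cnorm A (star A a \<otimes> a) = (cnorm A a)\<^sup>2"
    and complete: "(\<And>k::nat. s k \<in> carrier A) \<Longrightarrow>
          (\<And>e. e > 0 \<Longrightarrow> \<exists>N. \<forall>i\<ge>N. \<forall>j\<ge>N. cnorm A (s i \<ominus> s j) < e) \<Longrightarrow>
          \<exists>l\<in>carrier A. (\<lambda>k. cnorm A (s k \<ominus> l)) \<longlonglongrightarrow> 0"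


section \<open>The Dixmier properties\<close>

text \<open>
  These are stated for arbitrary structures, but are meaningful only when
  \<^const>\<open>unital_cstar_algebra\<close> holds.
\<close>

definition cstar_center :: "('a, 'b) star_algebra_scheme \<Rightarrow> 'a set" where
  "cstar_center A = {z \<in> carrier A. \<forall>a\<in>carrier A. a \<otimes>\<^bsub>A\<^esub> z = z \<otimes>\<^bsub>A\<^esub> a}"

definition unitaries :: "('a, 'b) star_algebra_scheme \<Rightarrow> 'a set" where
  "unitaries A = {u \<in> carrier A. star A u \<otimes>\<^bsub>A\<^esub> u = \<one>\<^bsub>A\<^esub> \<and> u \<otimes>\<^bsub>A\<^esub> star A u = \<one>\<^bsub>A\<^esub>}"

definition self_adjoints :: "('a, 'b) star_algebra_scheme \<Rightarrow> 'a set" where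
  "self_adjoints A = {a \<in> carrier A. star A a = a}"

definition unitary_conj :: "('a, 'b) star_algebra_scheme \<Rightarrow> 'a \<Rightarrow> 'a \<Rightarrow> 'a" where
  "unitary_conj A u a = u \<otimes>\<^bsub>A\<^esub> a \<otimes>\<^bsub>A\<^esub> star A u"

definition unitary_average ::
    "('a, 'b) star_algebra_scheme \<Rightarrow> nat \<Rightarrow> (nat \<Rightarrow> 'a) \<Rightarrow> 'a \<Rightarrow> 'a" where
  "unitary_average A m u a =
     finsum A (\<lambda>i. cscale A (of_real (1 / real m)) (unitary_conj A (u i) a)) {1..m}"

definition cstar_convex_hull :: "('a, 'b) star_algebra_scheme \<Rightarrow> 'a set \<Rightarrow> 'a set" where
  "cstar_convex_hull A S =
     {finsum A (\<lambda>i. cscale A (of_real (t i)) (s i)) {1..k} | (k::nat) (t :: nat \<Rightarrow> real) s.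
        (\<forall>i\<in>{1..k}. 0 \<le> t i \<and> s i \<in> S) \<and> (\<Sum>i=1..k. t i) = 1}"

definition cstar_closure :: "('a, 'b) star_algebra_scheme \<Rightarrow> 'a set \<Rightarrow> 'a set" where
  "cstar_closure A S =
     {a \<in> carrier A. \<forall>e>0. \<exists>b\<in>S. cnorm A (a \<ominus>\<^bsub>A\<^esub> b) < e}"

definition dixmier_set :: "('a, 'b) star_algebra_scheme \<Rightarrow> 'a \<Rightarrow> 'a set" where
  "dixmier_set A a =
     cstar_closure A (cstar_convex_hull A ((\<lambda>u. unitary_conj A u a) ` unitaries A))"

definition uniform_dixmier_property ::
    "('a, 'b) star_algebra_scheme \<Rightarrow> nat \<Rightarrow> real \<Rightarrow> bool" where
  "uniform_dixmier_property A m \<gamma> \<longleftrightarrow>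
     0 < m \<and> 0 < \<gamma> \<and> \<gamma> < 1 \<and>
     (\<forall>a\<in>self_adjoints A. \<exists>z\<in>cstar_center A. \<exists>u. (\<forall>i\<in>{1..m}. u i \<in> unitaries A) \<and>
        cnorm A (unitary_average A m u a \<ominus>\<^bsub>A\<^esub> z) \<le> \<gamma> * cnorm A a)"

definition singleton_dixmier_property :: "('a, 'b) star_algebra_scheme \<Rightarrow> bool" where
  "singleton_dixmier_property A \<longleftrightarrow>
     (\<forall>a\<in>carrier A. \<exists>z. dixmier_set A a \<inter> cstar_center A = {z})"

definition center_valued_trace :: "('a, 'b) star_algebra_scheme \<Rightarrow> 'a \<Rightarrow> 'a" where
  "center_valued_trace A a = (THE z. dixmier_set A a \<inter> cstar_center A = {z})"

definition uniform_singleton_dixmier_property ::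
    "('a, 'b) star_algebra_scheme \<Rightarrow> nat \<Rightarrow> real \<Rightarrow> bool" where
  "uniform_singleton_dixmier_property A M \<Upsilon> \<longleftrightarrow>
     0 < M \<and> 0 < \<Upsilon> \<and> \<Upsilon> < 1 \<and> singleton_dixmier_property A \<and>
     (\<forall>a\<in>self_adjoints A. \<exists>u. (\<forall>i\<in>{1..M}. u i \<in> unitaries A) \<and>
        cnorm A (unitary_average A M u a \<ominus>\<^bsub>A\<^esub> center_valued_trace A a)
          \<le> \<Upsilon> * cnorm A (a \<ominus>\<^bsub>A\<^esub> center_valued_trace A a))"


section \<open>The algebra of continuous matrix-valued functions\<close>

definition cadjoint :: "complex^'n^'n \<Rightarrow> complex^'n^'n" where
  "cadjoint A = (\<chi> i j. cnj (A $ j $ i))"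

text \<open>
  The norm of the type \<^typ>\<open>complex^'n^'n\<close> is the Frobenius norm; the C*-norm is the operator norm
  for the Euclidean norm of \<^typ>\<open>complex^'n\<close>. The two induce the same topology, so continuity may
  be expressed by the library topology. Functions on the space are taken to be extensional outside
  it. Inserting 0 under the supremum only matters for the empty space.
\<close>

definition cmatrix_norm :: "complex^'n^'n \<Rightarrow> real" where
  "cmatrix_norm A = onorm ((*v) A)"

definition cont_matrix_algebra :: "'a topology \<Rightarrow> ('a \<Rightarrow> complex^'n^'n) star_algebra" where
  "cont_matrix_algebra X =
     \<lparr> carrier = {f. continuous_map X euclidean f} \<inter> extensional (topspace X),
       monoid.mult = (\<lambda>f g. \<lambda>x\<in>topspace X. f x ** g x),
       one = (\<lambda>x\<in>topspace X. mat 1),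
       zero = (\<lambda>x\<in>topspace X. 0),
       add = (\<lambda>f g. \<lambda>x\<in>topspace X. f x + g x),
       cscale = (\<lambda>c f. \<lambda>x\<in>topspace X. map_matrix ((*) c) (f x)),
       star = (\<lambda>f. \<lambda>x\<in>topspace X. cadjoint (f x)),
       cnorm = (\<lambda>f. Sup (insert 0 ((\<lambda>x. cmatrix_norm (f x)) ` topspace X))) \<rparr>"


section \<open>Covering dimension\<close>

definition open_cover :: "'a topology \<Rightarrow> 'a set set \<Rightarrow> bool" where
  "open_cover X \<U> \<longleftrightarrow> (\<forall>U\<in>\<U>. openin X U) \<and> \<Union>\<U> = topspace X"

definition refines :: "'a set set \<Rightarrow> 'a set set \<Rightarrow> bool" where
  "refines \<V> \<U> \<longleftrightarrow> (\<forall>V\<in>\<V>. \<exists>U\<in>\<U>. V \<subseteq> U)"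

text \<open>
  Every finite open cover has a finite open refinement each point of which lies in at most \<open>k\<close>
  members, that is, the covering dimension is at most \<open>k - 1\<close>.
\<close>

definition covering_multiplicity_le :: "'a topology \<Rightarrow> nat \<Rightarrow> bool" where
  "covering_multiplicity_le X k \<longleftrightarrow>
     (\<forall>\<U>. finite \<U> \<and> open_cover X \<U> \<longrightarrow>
        (\<exists>\<V>. finite \<V> \<and> open_cover X \<V> \<and> refines \<V> \<U> \<and>
              (\<forall>x\<in>topspace X. card {V\<in>\<V>. x \<in> V} \<le> k)))"

text \<open>
  Since \<open>covering_multiplicity_le X 0\<close> says that the space is empty, the empty space (of dimension
  -1) does not have covering dimension 0.
\<close>

definition has_covering_dimension :: "'a topology \<Rightarrow> nat \<Rightarrow> bool" where
  "has_covering_dimension X d \<longleftrightarrow>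
     covering_multiplicity_le X (d + 1) \<and> \<not> covering_multiplicity_le X d"


section \<open>Integral Cech cohomology\<close>

text \<open>
  Cech cohomology is the direct limit, over the open covers directed by refinement, of the integral
  cohomology of the nerve, computed here from the ordered cochain complex: the \<open>k\<close>-simplices are the
  \<open>(k+1)\<close>-tuples of members of the cover, with repetitions allowed, having a common point.
\<close>

definition nerve_simplices :: "'a set set \<Rightarrow> nat \<Rightarrow> 'a set list set" where
  "nerve_simplices \<U> k = {\<sigma>. length \<sigma> = k + 1 \<and> set \<sigma> \<subseteq> \<U> \<and> \<Inter>(set \<sigma>) \<noteq> {}}"

definition cochains :: "'a set set \<Rightarrow> nat \<Rightarrow> ('a set list \<Rightarrow> int) set" where
  "cochains \<U> k = extensional (nerve_simplices \<U> k)"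

definition coboundary ::
    "'a set set \<Rightarrow> nat \<Rightarrow> ('a set list \<Rightarrow> int) \<Rightarrow> 'a set list \<Rightarrow> int" where
  "coboundary \<U> k c =
     (\<lambda>\<sigma>\<in>nerve_simplices \<U> (k + 1). \<Sum>i\<le>k + 1. (- 1) ^ i * c (take i \<sigma> @ drop (Suc i) \<sigma>))"

definition zero_cochain :: "'a set set \<Rightarrow> nat \<Rightarrow> 'a set list \<Rightarrow> int" where
  "zero_cochain \<U> k = (\<lambda>\<sigma>\<in>nerve_simplices \<U> k. 0)"

definition cocycles :: "'a set set \<Rightarrow> nat \<Rightarrow> ('a set list \<Rightarrow> int) set" where
  "cocycles \<U> k = {c \<in> cochains \<U> k. coboundary \<U> k c = zero_cochain \<U> (k + 1)}"

definition coboundaries :: "'a set set \<Rightarrow> nat \<Rightarrow> ('a set list \<Rightarrow> int) set" where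
  "coboundaries \<U> k =
     (if k = 0 then {zero_cochain \<U> 0} else coboundary \<U> (k - 1) ` cochains \<U> (k - 1))"

definition refinement_map :: "'a set set \<Rightarrow> 'a set set \<Rightarrow> ('a set \<Rightarrow> 'a set) \<Rightarrow> bool" where
  "refinement_map \<W> \<U> r \<longleftrightarrow> (\<forall>W\<in>\<W>. r W \<in> \<U> \<and> W \<subseteq> r W)"

text \<open>
  Pairs of a cover and a cocycle of its nerve represent the elements of the direct limit. Two pairs
  represent the same element iff the cocycles become cohomologous on a common refinement; on
  cohomology the pullback does not depend on the choice of the refinement map.
\<close>

definition cech_cocycles :: "nat \<Rightarrow> 'a topology \<Rightarrow> ('a set set \<times> ('a set list \<Rightarrow> int)) set" where
  "cech_cocycles k X = {(\<U>, c). open_cover X \<U> \<and> c \<in> cocycles \<U> k}"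

definition cech_equiv :: "nat \<Rightarrow> 'a topology \<Rightarrow>
    (('a set set \<times> ('a set list \<Rightarrow> int)) \<times> ('a set set \<times> ('a set list \<Rightarrow> int))) set" where
  "cech_equiv k X =
     {((\<U>, c), (\<V>, e)). (\<U>, c) \<in> cech_cocycles k X \<and> (\<V>, e) \<in> cech_cocycles k X \<and>
        (\<exists>\<W> r s. open_cover X \<W> \<and> refinement_map \<W> \<U> r \<and> refinement_map \<W> \<V> s \<and>
           (\<lambda>\<sigma>\<in>nerve_simplices \<W> k. c (map r \<sigma>) - e (map s \<sigma>)) \<in> coboundaries \<W> k)}"

text \<open>Only the underlying set of the group and its zero are needed.\<close>

definition cech_cohomology ::
    "nat \<Rightarrow> 'a topology \<Rightarrow> ('a set set \<times> ('a set list \<Rightarrow> int)) set set" where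
  "cech_cohomology k X = cech_cocycles k X // cech_equiv k X"

definition cech_zero :: "nat \<Rightarrow> 'a topology \<Rightarrow> ('a set set \<times> ('a set list \<Rightarrow> int)) set" where
  "cech_zero k X = cech_equiv k X `` {({topspace X}, zero_cochain {topspace X} k)}"


section \<open>Continuous matrix-valued functions form a unital C*-algebra\<close>

lemma cmatrix_norm_nonneg: "0 \<le> cmatrix_norm A"
  unfolding cmatrix_norm_def by (rule onorm_pos_le) simp

lemma norm_mult_vec_le: "norm (A *v v) \<le> cmatrix_norm A * norm v"
  unfolding cmatrix_norm_def by (rule onorm) simp

lemma cmatrix_norm_le: "0 \<le> b \<Longrightarrow> (\<And>v. norm (A *v v) \<le> b * norm v) \<Longrightarrow> cmatrix_norm A \<le> b"
  unfolding cmatrix_norm_def by (rule onorm_bound)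

lemma matrix_entry_bound:
  fixes A :: "complex^'n^'n"
  shows "norm (A $ i $ j) \<le> cmatrix_norm A"
proof -
  have "norm (A $ i $ j) = norm ((A *v axis j 1) $ i)"
    by (simp add: matrix_vector_mult_def axis_def if_distrib cong: if_cong)
  also have "\<dots> \<le> norm (A *v axis j 1)"
    by (rule Finite_Cartesian_Product.norm_nth_le)
  also have "\<dots> \<le> cmatrix_norm A * norm (axis j 1 :: complex^'n)"
    by (rule norm_mult_vec_le)
  finally show ?thesis by (simp add: norm_axis_1)
qed

lemma frobenius_bound:
  fixes A :: "complex^'n^'n"
  shows "norm A \<le> real (CARD('n) * CARD('n)) * cmatrix_norm A"
proof -
  have "norm A \<le> (\<Sum>i\<in>UNIV. norm (A $ i))"
    unfolding norm_vec_def by (rule L2_set_le_sum) simp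
  also have "\<dots> \<le> (\<Sum>i\<in>UNIV. \<Sum>j\<in>UNIV. norm (A $ i $ j))"
    by (intro sum_mono) (subst norm_vec_def, rule L2_set_le_sum, simp)
  also have "\<dots> \<le> (\<Sum>i\<in>(UNIV::'n set). \<Sum>j\<in>(UNIV::'n set). cmatrix_norm A)"
    by (intro sum_mono matrix_entry_bound)
  finally show ?thesis by simp
qed

lemma cmatrix_norm_le_frobenius:
  fixes A :: "complex^'n^'n"
  shows "cmatrix_norm A \<le> real CARD('n) * norm A"
proof (rule cmatrix_norm_le)
  fix v :: "complex^'n"
  have comp: "norm ((A *v v) $ i) \<le> norm A * norm v" for i
  proof -
    have "norm ((A *v v) $ i) \<le> (\<Sum>j\<in>UNIV. \<bar>norm (A $ i $ j)\<bar> * \<bar>norm (v $ j)\<bar>)"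
      unfolding matrix_vector_mult_def by (simp, rule order_trans[OF norm_sum]) (simp add: norm_mult)
    also have "\<dots> \<le> L2_set (\<lambda>j. norm (A $ i $ j)) UNIV * L2_set (\<lambda>j. norm (v $ j)) UNIV"
      by (rule L2_set_mult_ineq)
    also have "\<dots> = norm (A $ i) * norm v" by (simp add: norm_vec_def)
    also have "\<dots> \<le> norm A * norm v"
      by (intro mult_right_mono Finite_Cartesian_Product.norm_nth_le) simp
    finally show ?thesis .
  qed
  have "norm (A *v v) \<le> (\<Sum>i\<in>UNIV. norm ((A *v v) $ i))"
    unfolding norm_vec_def[of "A *v v"] by (rule L2_set_le_sum) simp
  also have "\<dots> \<le> (\<Sum>i\<in>(UNIV::'n set). norm A * norm v)"
    by (intro sum_mono comp)
  finally show "norm (A *v v) \<le> real CARD('n) * norm A * norm v" by simp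
qed simp

lemma inner_cadjoint:
  fixes A :: "complex^'n^'n"
  shows "inner (cadjoint A *v w) v = inner w (A *v v)"
proof -
  have "inner (cadjoint A *v w) v = (\<Sum>i\<in>UNIV. \<Sum>j\<in>UNIV. inner (cnj (A $ j $ i) * w $ j) (v $ i))"
    by (simp add: inner_vec_def matrix_vector_mult_def cadjoint_def inner_sum_left)
  also have "\<dots> = (\<Sum>j\<in>UNIV. \<Sum>i\<in>UNIV. inner (w $ j) (A $ j $ i * v $ i))"
    by (subst sum.swap) (intro sum.cong refl, simp add: inner_complex_def algebra_simps)
  also have "\<dots> = inner w (A *v v)"
    by (simp add: inner_vec_def matrix_vector_mult_def inner_sum_right)
  finally show ?thesis .
qed

lemma cadjoint_cadjoint [simp]: "cadjoint (cadjoint A) = A"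
  by (simp add: cadjoint_def vec_eq_iff)

lemma cadjoint_mult: "cadjoint (A ** B) = cadjoint B ** cadjoint A"
  by (simp add: cadjoint_def matrix_matrix_mult_def vec_eq_iff mult.commute)

lemma cmatrix_norm_mult: "cmatrix_norm (A ** B) \<le> cmatrix_norm A * cmatrix_norm B"
proof (rule cmatrix_norm_le)
  fix v
  have "norm (A ** B *v v) \<le> cmatrix_norm A * norm (B *v v)"
    by (metis matrix_vector_mul_assoc norm_mult_vec_le)
  also have "\<dots> \<le> cmatrix_norm A * (cmatrix_norm B * norm v)"
    by (intro mult_left_mono norm_mult_vec_le cmatrix_norm_nonneg)
  finally show "norm (A ** B *v v) \<le> cmatrix_norm A * cmatrix_norm B * norm v"
    by (simp add: mult.assoc)
qed (simp add: cmatrix_norm_nonneg)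

lemma cmatrix_norm_triangle: "cmatrix_norm (A + B) \<le> cmatrix_norm A + cmatrix_norm B"
proof (rule cmatrix_norm_le)
  fix v
  have "norm ((A + B) *v v) \<le> norm (A *v v) + norm (B *v v)"
    by (simp add: matrix_vector_mult_add_rdistrib norm_triangle_ineq)
  also have "\<dots> \<le> (cmatrix_norm A + cmatrix_norm B) * norm v"
    by (simp add: distrib_right add_mono norm_mult_vec_le)
  finally show "norm ((A + B) *v v) \<le> (cmatrix_norm A + cmatrix_norm B) * norm v" .
qed (simp add: cmatrix_norm_nonneg)

lemma cmatrix_norm_eq_0: "cmatrix_norm A = 0 \<longleftrightarrow> A = 0"
proof
  assume "cmatrix_norm A = 0"
  then have "A $ i $ j = 0" for i j
    using matrix_entry_bound[of A i j] by simp
  then show "A = 0" by (simp add: vec_eq_iff)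
next
  assume "A = 0"
  then have "cmatrix_norm A \<le> 0" by (intro cmatrix_norm_le) auto
  then show "cmatrix_norm A = 0" using cmatrix_norm_nonneg[of A] by simp
qed

lemma cmatrix_norm_scale: "cmatrix_norm (map_matrix ((*) c) A) = cmod c * cmatrix_norm A"
proof -
  have *: "cmatrix_norm (map_matrix ((*) c) A) \<le> cmod c * cmatrix_norm A" for c and A :: "complex^'n^'n"
  proof (rule cmatrix_norm_le)
    fix v
    have eq: "map_matrix ((*) c) A *v v = (\<chi> i. c * (A *v v) $ i)"
      by (simp add: vec_eq_iff matrix_vector_mult_def sum_distrib_left mult.assoc)
    have "norm (map_matrix ((*) c) A *v v) = cmod c * norm (A *v v)"
      unfolding eq by (simp add: norm_vec_def norm_mult L2_set_right_distrib)
    also have "\<dots> \<le> cmod c * (cmatrix_norm A * norm v)"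
      by (intro mult_left_mono norm_mult_vec_le) simp
    finally show "norm (map_matrix ((*) c) A *v v) \<le> cmod c * cmatrix_norm A * norm v"
      by (simp add: mult.assoc)
  qed (simp add: cmatrix_norm_nonneg)
  show ?thesis
  proof (cases "c = 0")
    case True
    then have "map_matrix ((*) c) A = 0" by (simp add: vec_eq_iff)
    then show ?thesis using True cmatrix_norm_eq_0 by auto
  next
    case False
    have "map_matrix ((*) (inverse c)) (map_matrix ((*) c) A) = A"
      using False by (simp add: vec_eq_iff)
    then have "cmatrix_norm A \<le> inverse (cmod c) * cmatrix_norm (map_matrix ((*) c) A)"
      using *[of "inverse c" "map_matrix ((*) c) A"] by (simp add: norm_inverse)
    then have "cmod c * cmatrix_norm A \<le> cmatrix_norm (map_matrix ((*) c) A)"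
      using False by (simp add: field_simps)
    with *[of c A] show ?thesis by simp
  qed
qed

lemma cmatrix_norm_sq_le: "(cmatrix_norm A)\<^sup>2 \<le> cmatrix_norm (cadjoint A ** A)"
proof -
  have "norm (A *v v) \<le> sqrt (cmatrix_norm (cadjoint A ** A)) * norm v" for v
  proof -
    have "(norm (A *v v))\<^sup>2 = inner (cadjoint A ** A *v v) v"
      by (metis dot_square_norm inner_cadjoint matrix_vector_mul_assoc)
    also have "\<dots> \<le> norm (cadjoint A ** A *v v) * norm v"
      by (rule norm_cauchy_schwarz)
    also have "\<dots> \<le> (cmatrix_norm (cadjoint A ** A) * norm v) * norm v"
      by (intro mult_right_mono norm_mult_vec_le) simp
    finally have "norm (A *v v) \<le> sqrt (cmatrix_norm (cadjoint A ** A) * norm v * norm v)"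
      by (simp add: real_le_rsqrt)
    then show ?thesis by (simp add: real_sqrt_mult mult.assoc)
  qed
  then have "cmatrix_norm A \<le> sqrt (cmatrix_norm (cadjoint A ** A))"
    by (intro cmatrix_norm_le) (auto simp: cmatrix_norm_nonneg)
  then have "(cmatrix_norm A)\<^sup>2 \<le> (sqrt (cmatrix_norm (cadjoint A ** A)))\<^sup>2"
    by (rule power_mono) (rule cmatrix_norm_nonneg)
  then show ?thesis by (simp add: cmatrix_norm_nonneg)
qed

lemma cmatrix_norm_cadjoint: "cmatrix_norm (cadjoint A) = cmatrix_norm A"
proof -
  have *: "cmatrix_norm A \<le> cmatrix_norm (cadjoint A)" for A :: "complex^'n^'n"
  proof (cases "cmatrix_norm A = 0")
    case False
    have "cmatrix_norm A * cmatrix_norm A \<le> cmatrix_norm (cadjoint A) * cmatrix_norm A"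
      using cmatrix_norm_sq_le[of A] cmatrix_norm_mult[of "cadjoint A" A]
      by (simp add: power2_eq_square)
    with False show ?thesis
      using cmatrix_norm_nonneg[of A] by (simp add: mult_le_cancel_right)
  qed (simp add: cmatrix_norm_nonneg)
  show ?thesis using *[of A] *[of "cadjoint A"] by simp
qed

lemma cmatrix_cstar_identity: "cmatrix_norm (cadjoint A ** A) = (cmatrix_norm A)\<^sup>2"
  using cmatrix_norm_sq_le[of A] cmatrix_norm_mult[of "cadjoint A" A]
  by (simp add: cmatrix_norm_cadjoint power2_eq_square)

lemma continuous_map_matrix:
  fixes f :: "'a \<Rightarrow> complex^'n^'n"
  shows "continuous_map X euclidean f \<longleftrightarrow> (\<forall>i j. continuous_map X euclidean (\<lambda>x. f x $ i $ j))"
  (is "?L \<longleftrightarrow> ?R")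
proof
  show "?L \<Longrightarrow> ?R"
    unfolding continuous_map_atin by (auto intro!: tendsto_vec_nth)
  show "?R \<Longrightarrow> ?L"
    unfolding continuous_map_atin by (auto intro!: vec_tendstoI)
qed

lemma continuous_map_cnj:
  "continuous_map X euclidean f \<Longrightarrow> continuous_map X euclidean (\<lambda>x. cnj (f x))"
  unfolding continuous_map_atin by (auto intro: tendsto_cnj)

lemma continuous_map_cmult:
  fixes f g :: "'a \<Rightarrow> complex"
  shows "continuous_map X euclidean f \<Longrightarrow> continuous_map X euclidean g \<Longrightarrow>
    continuous_map X euclidean (\<lambda>x. f x * g x)"
  unfolding continuous_map_atin by (auto intro: tendsto_mult)

context
  fixes X :: "'a topology" and A :: "('a \<Rightarrow> complex^'n^'n) star_algebra"
  defines "A \<equiv> cont_matrix_algebra X"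
begin

lemma cont_matrix_carrier:
  "f \<in> carrier A \<longleftrightarrow> continuous_map X euclidean f \<and> f \<in> extensional (topspace X)"
  by (simp add: A_def cont_matrix_algebra_def)

lemma cont_matrix_restrict_closed:
  "continuous_map X euclidean f \<Longrightarrow> (\<lambda>x\<in>topspace X. f x) \<in> carrier A"
  unfolding cont_matrix_carrier by (auto intro: continuous_map_eq)

lemma cont_matrix_eqI:
  "f \<in> carrier A \<Longrightarrow> g \<in> carrier A \<Longrightarrow> (\<And>x. x \<in> topspace X \<Longrightarrow> f x = g x) \<Longrightarrow> f = g"
  unfolding cont_matrix_carrier by (auto intro: extensionalityI)

lemma cont_matrix_apply:
  assumes "x \<in> topspace X"
  shows "(f \<otimes>\<^bsub>A\<^esub> g) x = f x ** g x" "(f \<oplus>\<^bsub>A\<^esub> g) x = f x + g x" "\<one>\<^bsub>A\<^esub> x = mat 1" "\<zero>\<^bsub>A\<^esub> x = 0"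
    "cscale A c f x = map_matrix ((*) c) (f x)" "star A f x = cadjoint (f x)"
  using assms by (simp_all add: A_def cont_matrix_algebra_def)

lemma cont_matrix_closed:
  "f \<in> carrier A \<Longrightarrow> g \<in> carrier A \<Longrightarrow> f \<otimes>\<^bsub>A\<^esub> g \<in> carrier A"
  "f \<in> carrier A \<Longrightarrow> g \<in> carrier A \<Longrightarrow> f \<oplus>\<^bsub>A\<^esub> g \<in> carrier A"
  "\<one>\<^bsub>A\<^esub> \<in> carrier A" "\<zero>\<^bsub>A\<^esub> \<in> carrier A"
  "f \<in> carrier A \<Longrightarrow> cscale A c f \<in> carrier A"
  "f \<in> carrier A \<Longrightarrow> star A f \<in> carrier A"
proof -
  show "f \<in> carrier A \<Longrightarrow> g \<in> carrier A \<Longrightarrow> f \<otimes>\<^bsub>A\<^esub> g \<in> carrier A"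
    using cont_matrix_restrict_closed[of "\<lambda>x. f x ** g x"]
    by (simp add: cont_matrix_carrier continuous_map_matrix matrix_matrix_mult_def
        continuous_map_sum continuous_map_cmult A_def cont_matrix_algebra_def)
  show "f \<in> carrier A \<Longrightarrow> g \<in> carrier A \<Longrightarrow> f \<oplus>\<^bsub>A\<^esub> g \<in> carrier A"
    using cont_matrix_restrict_closed[of "\<lambda>x. f x + g x"]
    by (simp add: cont_matrix_carrier continuous_map_add A_def cont_matrix_algebra_def)
  show "\<one>\<^bsub>A\<^esub> \<in> carrier A" "\<zero>\<^bsub>A\<^esub> \<in> carrier A"
    using cont_matrix_restrict_closed[of "\<lambda>x. mat 1"] cont_matrix_restrict_closed[of "\<lambda>x. 0"]
    by (simp_all add: A_def cont_matrix_algebra_def)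
  show "f \<in> carrier A \<Longrightarrow> cscale A c f \<in> carrier A"
    using cont_matrix_restrict_closed[of "\<lambda>x. map_matrix ((*) c) (f x)"]
    by (simp add: cont_matrix_carrier continuous_map_matrix continuous_map_cmult
        A_def cont_matrix_algebra_def)
  show "f \<in> carrier A \<Longrightarrow> star A f \<in> carrier A"
    using cont_matrix_restrict_closed[of "\<lambda>x. cadjoint (f x)"]
    by (simp add: cont_matrix_carrier continuous_map_matrix continuous_map_cnj cadjoint_def
        A_def cont_matrix_algebra_def)
qed

lemma cont_matrix_ring: "ring A"
proof (rule ringI)
  show "abelian_group A"
  proof (rule abelian_groupI)
    fix f assume f: "f \<in> carrier A"
    have "(\<lambda>x\<in>topspace X. - f x) \<in> carrier A"
      using f by (intro cont_matrix_restrict_closed continuous_map_minus) (simp add: cont_matrix_carrier)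
    moreover from this have "(\<lambda>x\<in>topspace X. - f x) \<oplus>\<^bsub>A\<^esub> f = \<zero>\<^bsub>A\<^esub>"
      using f by (intro cont_matrix_eqI) (auto simp: cont_matrix_closed cont_matrix_apply)
    ultimately show "\<exists>g\<in>carrier A. g \<oplus>\<^bsub>A\<^esub> f = \<zero>\<^bsub>A\<^esub>" by blast
  qed (auto intro!: cont_matrix_eqI simp: cont_matrix_closed cont_matrix_apply add_ac)
  show "monoid A"
    by (rule monoidI)
      (auto intro!: cont_matrix_eqI simp: cont_matrix_closed cont_matrix_apply matrix_mul_assoc)
qed (auto intro!: cont_matrix_eqI simp: cont_matrix_closed cont_matrix_apply
      vec_eq_iff matrix_matrix_mult_def distrib_left distrib_right sum.distrib)

lemma cont_matrix_minus_apply: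
  assumes f: "f \<in> carrier A" and g: "g \<in> carrier A" and x: "x \<in> topspace X"
  shows "(f \<ominus>\<^bsub>A\<^esub> g) x = f x - g x"
proof -
  interpret ring A by (rule cont_matrix_ring)
  have "(f \<ominus>\<^bsub>A\<^esub> g) \<oplus>\<^bsub>A\<^esub> g = f"
    using f g by (simp add: minus_eq a_assoc l_neg)
  then have "(f \<ominus>\<^bsub>A\<^esub> g) x + g x = f x"
    using cont_matrix_apply(2)[OF x] by metis
  then show ?thesis by (simp add: eq_diff_eq)
qed

context
  assumes compact: "compact_space X"
begin

lemma cont_matrix_bdd_above:
  assumes "f \<in> carrier A"
  shows "bdd_above (insert 0 ((\<lambda>x. cmatrix_norm (f x)) ` topspace X))"
proof -
  have "compactin euclidean (f ` topspace X)"
    using assms compact unfolding cont_matrix_carrier compact_space_def by (blast intro: image_compactin)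
  then obtain B where B: "\<And>x. x \<in> topspace X \<Longrightarrow> norm (f x) \<le> B"
    by (fastforce dest: compact_imp_bounded simp: bounded_iff)
  have "cmatrix_norm (f x) \<le> real CARD('n) * B" if "x \<in> topspace X" for x
    by (rule order_trans[OF cmatrix_norm_le_frobenius]) (simp add: B that)
  then show ?thesis unfolding bdd_above_insert by (rule bdd_aboveI2)
qed

lemma cont_matrix_cnorm_le_iff:
  assumes "f \<in> carrier A"
  shows "cnorm A f \<le> r \<longleftrightarrow> 0 \<le> r \<and> (\<forall>x\<in>topspace X. cmatrix_norm (f x) \<le> r)"
  using cSup_le_iff[OF _ cont_matrix_bdd_above[OF assms], of r]
  by (simp add: A_def cont_matrix_algebra_def)

lemma cont_matrix_cnorm_bound:
  assumes "f \<in> carrier A"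
  shows "0 \<le> cnorm A f" "x \<in> topspace X \<Longrightarrow> cmatrix_norm (f x) \<le> cnorm A f"
  using cont_matrix_cnorm_le_iff[OF assms, of "cnorm A f"] by auto

lemma cont_matrix_complete:
  assumes s: "\<And>k::nat. s k \<in> carrier A"
    and cauchy: "\<And>e. e > 0 \<Longrightarrow> \<exists>N. \<forall>i\<ge>N. \<forall>j\<ge>N. cnorm A (s i \<ominus>\<^bsub>A\<^esub> s j) < e"
  shows "\<exists>l\<in>carrier A. (\<lambda>k. cnorm A (s k \<ominus>\<^bsub>A\<^esub> l)) \<longlonglongrightarrow> 0"
proof -
  interpret ring A by (rule cont_matrix_ring)
  define C where "C = real (CARD('n) * CARD('n))"
  have C: "C > 0" by (simp add: C_def)
  have diff: "norm (s i x - s j x) \<le> C * cnorm A (s i \<ominus>\<^bsub>A\<^esub> s j)" if "x \<in> topspace X" for i j x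
  proof -
    have "norm (s i x - s j x) \<le> C * cmatrix_norm (s i x - s j x)"
      unfolding C_def by (rule frobenius_bound)
    also have "\<dots> \<le> C * cnorm A (s i \<ominus>\<^bsub>A\<^esub> s j)"
      using cont_matrix_cnorm_bound(2)[of "s i \<ominus>\<^bsub>A\<^esub> s j" x] s that C
      by (simp add: cont_matrix_minus_apply)
    finally show ?thesis .
  qed
  have "uniformly_Cauchy_on (topspace X) s"
  proof (rule uniformly_Cauchy_onI)
    fix e :: real assume "e > 0"
    then obtain N where N: "\<And>i j. i \<ge> N \<Longrightarrow> j \<ge> N \<Longrightarrow> cnorm A (s i \<ominus>\<^bsub>A\<^esub> s j) < e / C"
      using cauchy[of "e / C"] C by auto
    show "\<exists>M. \<forall>x\<in>topspace X. \<forall>m\<ge>M. \<forall>n\<ge>M. dist (s m x) (s n x) < e"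
    proof (intro exI ballI allI impI)
      fix x i j assume "x \<in> topspace X" "i \<ge> N" "j \<ge> N"
      have "C * cnorm A (s i \<ominus>\<^bsub>A\<^esub> s j) < e"
        using N[OF \<open>i \<ge> N\<close> \<open>j \<ge> N\<close>] C by (simp add: field_simps)
      then show "dist (s i x) (s j x) < e"
        using diff[OF \<open>x \<in> topspace X\<close>, of i j] by (simp add: dist_norm)
    qed
  qed
  then obtain l' where l': "uniform_limit (topspace X) s l' sequentially"
    by (metis Cauchy_uniformly_convergent uniformly_convergent_on_def)
  define l where "l = (\<lambda>x\<in>topspace X. l' x)"
  have unif: "\<exists>N. \<forall>k\<ge>N. \<forall>x\<in>topspace X. dist (s k x) (l' x) < e" if "e > 0" for e
    using uniform_limitD[OF l' that] by (simp add: eventually_sequentially)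
  have "continuous_map X Met_TC.mtopology l'"
  proof (rule Met_TC.continuous_map_uniform_limit[where F = sequentially and f = s])
    show "\<forall>\<^sub>F k in sequentially. continuous_map X Met_TC.mtopology (s k)"
      using s by (auto simp: cont_matrix_carrier)
    show "\<forall>\<^sub>F k in sequentially. \<forall>x\<in>topspace X. l' x \<in> UNIV \<and> dist (s k x) (l' x) < e"
      if "e > 0" for e
      using uniform_limitD[OF l' that] by simp
  qed auto
  then have l: "l \<in> carrier A"
    unfolding l_def by (intro cont_matrix_restrict_closed) simp
  have "(\<lambda>k. cnorm A (s k \<ominus>\<^bsub>A\<^esub> l)) \<longlonglongrightarrow> 0"
  proof (rule LIMSEQ_I)
    fix e :: real assume e: "e > 0"
    define D where "D = real CARD('n)"
    have D: "D > 0" by (simp add: D_def)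
    obtain N where N: "\<And>k x. k \<ge> N \<Longrightarrow> x \<in> topspace X \<Longrightarrow> dist (s k x) (l' x) < e / 2 / D"
      using unif[of "e / 2 / D"] e D by auto
    have "cnorm A (s k \<ominus>\<^bsub>A\<^esub> l) \<le> e / 2" if "k \<ge> N" for k
    proof -
      have "cmatrix_norm ((s k \<ominus>\<^bsub>A\<^esub> l) x) \<le> e / 2" if x: "x \<in> topspace X" for x
      proof -
        have "cmatrix_norm (s k x - l' x) \<le> D * norm (s k x - l' x)"
          unfolding D_def by (rule cmatrix_norm_le_frobenius)
        also have "\<dots> \<le> e / 2"
          using N[OF \<open>k \<ge> N\<close> x] D by (simp add: dist_norm field_simps)
        finally show ?thesis
          using x s l by (simp add: cont_matrix_minus_apply) (simp add: l_def x)
      qed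
      then show ?thesis using e s l by (subst cont_matrix_cnorm_le_iff) auto
    qed
    then have "norm (cnorm A (s k \<ominus>\<^bsub>A\<^esub> l) - 0) < e" if "k \<ge> N" for k
      using cont_matrix_cnorm_bound(1)[of "s k \<ominus>\<^bsub>A\<^esub> l"] that s l e by force
    then show "\<exists>N. \<forall>k\<ge>N. norm (cnorm A (s k \<ominus>\<^bsub>A\<^esub> l) - 0) < e" by blast
  qed
  with l show ?thesis by blast
qed

theorem cont_matrix_algebra_cstar: "unital_cstar_algebra A"
proof -
  interpret ring A by (rule cont_matrix_ring)
  note [simp] = cont_matrix_closed cont_matrix_apply
  have scale_le: "cnorm A (cscale A c f) \<le> cmod c * cnorm A f" if "f \<in> carrier A" for c f
    using that cont_matrix_cnorm_bound[OF that]
    by (simp add: cont_matrix_cnorm_le_iff cmatrix_norm_scale mult_left_mono)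
  have scale_scale: "cscale A c (cscale A d f) = cscale A (c * d) f" if "f \<in> carrier A" for c d f
    using that by (intro cont_matrix_eqI) (auto simp: vec_eq_iff mult.assoc)
  have scale_one: "cscale A 1 f = f" if "f \<in> carrier A" for f
    using that by (intro cont_matrix_eqI) (auto simp: vec_eq_iff)
  show ?thesis
  proof
    fix f g c d assume f: "f \<in> carrier A"
    show "cscale A c f \<in> carrier A" "star A f \<in> carrier A" using f by simp_all
    show "cscale A (c + d) f = cscale A c f \<oplus>\<^bsub>A\<^esub> cscale A d f"
      using f by (intro cont_matrix_eqI) (auto simp: vec_eq_iff distrib_right)
    show "cscale A c (cscale A d f) = cscale A (c * d) f" "cscale A 1 f = f"
      using f by (fact scale_scale scale_one)+
    show "star A (cscale A c f) = cscale A (cnj c) (star A f)"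
      using f by (intro cont_matrix_eqI) (auto simp: vec_eq_iff cadjoint_def)
    show "star A (star A f) = f"
      using f by (intro cont_matrix_eqI) auto
    show "cnorm A f = 0 \<longleftrightarrow> f = \<zero>\<^bsub>A\<^esub>"
    proof
      assume "cnorm A f = 0"
      then show "f = \<zero>\<^bsub>A\<^esub>"
        using f cont_matrix_cnorm_bound(2)[OF f] cmatrix_norm_nonneg
        by (intro cont_matrix_eqI) (auto simp flip: cmatrix_norm_eq_0 intro: antisym)
    next
      assume "f = \<zero>\<^bsub>A\<^esub>"
      then have "cnorm A f \<le> 0"
        by (simp add: cont_matrix_cnorm_le_iff cmatrix_norm_eq_0[THEN iffD2])
      then show "cnorm A f = 0" using cont_matrix_cnorm_bound(1)[OF f] by simp
    qed
    show "cnorm A (cscale A c f) = cmod c * cnorm A f"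
    proof (cases "c = 0")
      case True
      then show ?thesis
        using scale_le[OF f, of c] cont_matrix_cnorm_bound(1)[of "cscale A c f"] f by simp
    next
      case False
      have "cnorm A f \<le> inverse (cmod c) * cnorm A (cscale A c f)"
        using scale_le[of "cscale A c f" "inverse c"] f False
        by (simp add: scale_scale scale_one norm_inverse)
      then have "cmod c * cnorm A f \<le> cnorm A (cscale A c f)"
        using False by (simp add: field_simps)
      then show ?thesis using scale_le[OF f, of c] by simp
    qed
    show "cnorm A (star A f \<otimes>\<^bsub>A\<^esub> f) = (cnorm A f)\<^sup>2"
    proof (rule antisym)
      show "cnorm A (star A f \<otimes>\<^bsub>A\<^esub> f) \<le> (cnorm A f)\<^sup>2"
        using f cont_matrix_cnorm_bound[OF f]
        by (simp add: cont_matrix_cnorm_le_iff cmatrix_cstar_identity power_mono cmatrix_norm_nonneg)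
      have "cmatrix_norm (f x) \<le> sqrt (cnorm A (star A f \<otimes>\<^bsub>A\<^esub> f))" if "x \<in> topspace X" for x
        using cont_matrix_cnorm_bound(2)[of "star A f \<otimes>\<^bsub>A\<^esub> f" x] f that
        by (simp add: cmatrix_cstar_identity real_le_rsqrt)
      then have "cnorm A f \<le> sqrt (cnorm A (star A f \<otimes>\<^bsub>A\<^esub> f))"
        using f by (simp add: cont_matrix_cnorm_le_iff cont_matrix_cnorm_bound(1))
      then have "(cnorm A f)\<^sup>2 \<le> (sqrt (cnorm A (star A f \<otimes>\<^bsub>A\<^esub> f)))\<^sup>2"
        by (rule power_mono) (rule cont_matrix_cnorm_bound(1)[OF f])
      then show "(cnorm A f)\<^sup>2 \<le> cnorm A (star A f \<otimes>\<^bsub>A\<^esub> f)"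
        using f by (simp add: cont_matrix_cnorm_bound(1))
    qed
    assume g: "g \<in> carrier A"
    show "cscale A c (f \<oplus>\<^bsub>A\<^esub> g) = cscale A c f \<oplus>\<^bsub>A\<^esub> cscale A c g"
      using f g by (intro cont_matrix_eqI) (auto simp: vec_eq_iff distrib_left)
    show "cscale A c f \<otimes>\<^bsub>A\<^esub> g = cscale A c (f \<otimes>\<^bsub>A\<^esub> g)"
      using f g by (intro cont_matrix_eqI)
        (auto simp: vec_eq_iff matrix_matrix_mult_def sum_distrib_left mult_ac)
    show "f \<otimes>\<^bsub>A\<^esub> cscale A c g = cscale A c (f \<otimes>\<^bsub>A\<^esub> g)"
      using f g by (intro cont_matrix_eqI)
        (auto simp: vec_eq_iff matrix_matrix_mult_def sum_distrib_left mult_ac)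
    show "star A (f \<oplus>\<^bsub>A\<^esub> g) = star A f \<oplus>\<^bsub>A\<^esub> star A g"
      using f g by (intro cont_matrix_eqI) (auto simp: vec_eq_iff cadjoint_def)
    show "star A (f \<otimes>\<^bsub>A\<^esub> g) = star A g \<otimes>\<^bsub>A\<^esub> star A f"
      using f g by (intro cont_matrix_eqI) (auto simp: cadjoint_mult)
    show "cnorm A (f \<oplus>\<^bsub>A\<^esub> g) \<le> cnorm A f + cnorm A g"
      using f g cont_matrix_cnorm_bound[OF f] cont_matrix_cnorm_bound[OF g]
      by (auto simp: cont_matrix_cnorm_le_iff intro!: order_trans[OF cmatrix_norm_triangle] add_mono)
    show "cnorm A (f \<otimes>\<^bsub>A\<^esub> g) \<le> cnorm A f * cnorm A g"
      using f g cont_matrix_cnorm_bound[OF f] cont_matrix_cnorm_bound[OF g]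
      by (auto simp: cont_matrix_cnorm_le_iff
          intro!: order_trans[OF cmatrix_norm_mult] mult_mono cmatrix_norm_nonneg)
  next
    fix s :: "nat \<Rightarrow> 'a \<Rightarrow> complex^'n^'n"
    assume "\<And>k. s k \<in> carrier A"
      "\<And>e. e > 0 \<Longrightarrow> \<exists>N. \<forall>i\<ge>N. \<forall>j\<ge>N. cnorm A (s i \<ominus>\<^bsub>A\<^esub> s j) < e"
    then show "\<exists>l\<in>carrier A. (\<lambda>k. cnorm A (s k \<ominus>\<^bsub>A\<^esub> l)) \<longlonglongrightarrow> 0"
      by (rule cont_matrix_complete)
  qed
qed

end

end

end

theory Submission
  imports Defs
begin

text \<open>
  Write spread a for the difference of the largest and the smallest eigenvalue of a Hermitian matrix
  a; the distance of a to the scalars is half of it. Reversing an ordered eigenbasis is a unitary u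
  with spread (a + u a u*) at most spread a, so that averaging two conjugates halves the spread.
  Doing this twice gives four conjugates of a traceless matrix whose average has at most half the norm.

  For fields of matrices on a space of dimension d such unitaries exist near each point, and d + 1
  colours of disjoint open sets suffice to patch them to global unitary fields, by a path from 1 to
  each of them. At every point one of the colours does its work, while the others do no harm.

  If d is at most 2 and the second cohomology vanishes, one unitary field serves all points, since
  there is a continuous approximate eigenframe. Its vectors are found successively as approximate
  maximizers of the quadratic form. Such a maximizer results from improving a given unit field by
  each of the finitely many vectors of a net of the sphere: the form on two vectors v, w is a 2 by 2
  Hermitian matrix, whose traceless part is a map to a 3-dimensional space. It can be perturbed to
  avoid 0 as d is at most 2, and its direction lifts from the 2-sphere to the 3-sphere as the Chern
  class of the line bundle of top eigenvectors vanishes.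
\<close>

section \<open>Continuity of vector and matrix valued maps\<close>

text \<open>Eigenvectors need not vary continuously where eigenvalues cross, so every construction
  carries an error \<open>e\<close>. It is absorbed by the strict inequalities required of the two
  constants. The constants come from counting. Let \<open>k\<close> be the number of colours:
  \<open>d + 1\<close> in part (i), 1 in part (ii). Of the \<open>k + 1\<close> terms consisting of
  \<open>a\<close> and one conjugate per colour, \<open>a\<close> and the conjugate of the good
  colour have joint spread at most \<open>spread a\<close> instead of twice that, and each other
  term costs \<open>spread a\<close>. This gives \<open>k / (k + 1)\<close>. For the distance to the
  trace, rather than to the midpoint of the spectrum, one halving is too little: a traceless matrix
  is bounded in norm by its whole spread, and the spread of \<open>a\<close> may be twice the norm
  of \<open>a\<close>. Hence the second unitary \<open>w\<close>. Each colour contributes the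
  conjugates by \<open>u\<close>, \<open>w\<close> and \<open>w u\<close>; together with
  \<open>a\<close> itself, those of the good colour have norm at most 2 norm(a) instead of 4
  norm(a), and every other colour costs 3 norm(a). The quotient is
  \<open>(2 + 3 (k - 1)) / (3 k + 1) = (3 k - 1) / (3 k + 1)\<close>.\<close>

lemma continuous_map_iff_tendsto:
  "continuous_map X euclidean f \<longleftrightarrow> (\<forall>x\<in>topspace X. (f \<longlongrightarrow> f x) (atin X x))"
  by (simp add: continuous_map_atin)

lemma tendsto_matrix_mult [tendsto_intros]:
  fixes f :: "'b \<Rightarrow> complex^'n^'m" and g :: "'b \<Rightarrow> complex^'k^'n"
  assumes "(f \<longlongrightarrow> a) F" "(g \<longlongrightarrow> b) F"
  shows "((\<lambda>x. f x ** g x) \<longlongrightarrow> a ** b) F"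
  unfolding matrix_matrix_mult_def using assms
  by (intro vec_tendstoI) (auto intro!: tendsto_intros)

lemma tendsto_matrix_vector_mult [tendsto_intros]:
  fixes f :: "'b \<Rightarrow> complex^'n^'m" and g :: "'b \<Rightarrow> complex^'n"
  assumes "(f \<longlongrightarrow> a) F" "(g \<longlongrightarrow> b) F"
  shows "((\<lambda>x. f x *v g x) \<longlongrightarrow> a *v b) F"
  unfolding matrix_vector_mult_def using assms
  by (intro vec_tendstoI) (auto intro!: tendsto_intros)

lemma tendsto_vector_smult [tendsto_intros]:
  fixes f :: "'b \<Rightarrow> complex" and g :: "'b \<Rightarrow> complex^'n"
  assumes "(f \<longlongrightarrow> a) F" "(g \<longlongrightarrow> b) F"
  shows "((\<lambda>x. f x *s g x) \<longlongrightarrow> a *s b) F"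
  unfolding vector_scalar_mult_def using assms
  by (intro vec_tendstoI) (auto intro!: tendsto_intros)

lemma tendsto_cadjoint [tendsto_intros]:
  assumes "(f \<longlongrightarrow> a) F"
  shows "((\<lambda>x. cadjoint (f x)) \<longlongrightarrow> cadjoint a) F"
  unfolding cadjoint_def using assms
  by (intro vec_tendstoI) (auto intro!: tendsto_intros)

lemma tendsto_mat [tendsto_intros]:
  assumes "(f \<longlongrightarrow> a) F"
  shows "((\<lambda>x. mat (f x) :: complex^'n^'n) \<longlongrightarrow> mat a) F"
  unfolding mat_def using assms by (intro vec_tendstoI) auto


section \<open>The Hermitian inner product\<close>

text \<open>The library's \<open>inner\<close> on \<open>complex^'n\<close> is only the real part of
  this form. Orthogonality over the complex numbers and phases of vectors need the full
  value.\<close>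

definition cdot :: "complex^'n \<Rightarrow> complex^'n \<Rightarrow> complex" where
  "cdot v w = (\<Sum>i\<in>UNIV. v $ i * cnj (w $ i))"

lemma tendsto_cdot [tendsto_intros]:
  assumes "(f \<longlongrightarrow> a) F" "(g \<longlongrightarrow> b) F"
  shows "((\<lambda>x. cdot (f x) (g x)) \<longlongrightarrow> cdot a b) F"
  unfolding cdot_def using assms by (auto intro!: tendsto_intros)

lemma Re_cdot: "Re (cdot v w) = inner v w"
  by (simp add: cdot_def inner_vec_def inner_complex_def)

lemma cdot_commute: "cnj (cdot v w) = cdot w v"
  by (simp add: cdot_def mult.commute)

lemma cdot_simps [simp]:
  "cdot (c *s v) w = c * cdot v w" "cdot v (c *s w) = cnj c * cdot v w"
  "cdot (v + v') w = cdot v w + cdot v' w" "cdot v (w + w') = cdot v w + cdot v w'"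
  "cdot (v - v') w = cdot v w - cdot v' w" "cdot v (w - w') = cdot v w - cdot v w'"
  "cdot 0 w = 0" "cdot v 0 = 0" "cdot (- v) w = - cdot v w" "cdot v (- w) = - cdot v w"
  by (simp_all add: cdot_def sum_distrib_left algebra_simps sum.distrib sum_subtractf sum_negf)

lemma cdot_sum_left: "cdot (sum f I) w = (\<Sum>i\<in>I. cdot (f i) w)"
  by (induction I rule: infinite_finite_induct) auto

lemma scaleR_eq_smult: "r *\<^sub>R v = complex_of_real r *s v" for v :: "complex^'n"
  by (simp add: vec_eq_iff scaleR_conv_of_real[of _ "_ :: complex"])

lemma cdot_scaleR [simp]:
  "cdot (r *\<^sub>R v) w = r *\<^sub>R cdot v w" "cdot v (r *\<^sub>R w) = r *\<^sub>R cdot v w"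
  by (simp_all add: scaleR_eq_smult scaleR_conv_of_real)

lemma cdot_self: "cdot v v = complex_of_real ((norm v)\<^sup>2)"
proof (rule complex_eqI)
  show "Re (cdot v v) = Re (complex_of_real ((norm v)\<^sup>2))"
    by (simp only: Re_cdot dot_square_norm Re_complex_of_real)
  show "Im (cdot v v) = Im (complex_of_real ((norm v)\<^sup>2))"
    by (simp add: cdot_def algebra_simps)
qed

lemma cdot_adjoint: "cdot (a *v v) w = cdot v (cadjoint a *v w)"
proof -
  have "cdot (a *v v) w = (\<Sum>i\<in>UNIV. \<Sum>j\<in>UNIV. a $ i $ j * v $ j * cnj (w $ i))"
    by (simp add: cdot_def matrix_vector_mult_def sum_distrib_right)
  also have "\<dots> = (\<Sum>j\<in>UNIV. \<Sum>i\<in>UNIV. a $ i $ j * v $ j * cnj (w $ i))"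
    by (rule sum.swap)
  also have "\<dots> = cdot v (cadjoint a *v w)"
    by (simp add: cdot_def matrix_vector_mult_def cadjoint_def sum_distrib_left mult_ac)
  finally show ?thesis .
qed

lemma cmod_cdot_le: "cmod (cdot v w) \<le> norm v * norm w"
proof -
  \<comment> \<open>A phase \<open>c\<close> that makes \<open>c * cdot v w\<close> real and
    nonnegative reduces the claim to the real Cauchy-Schwarz inequality.\<close>
  have "\<exists>c. cmod c = 1 \<and> cmod (cdot v w) = Re (c * cdot v w)"
  proof (cases "cdot v w = 0")
    case True
    then show ?thesis by (intro exI[of _ 1]) simp
  next
    case False
    then have "cnj (sgn (cdot v w)) * cdot v w = complex_of_real (cmod (cdot v w))"
      by (simp add: sgn_div_norm scaleR_conv_of_real field_simps complex_norm_square[symmetric]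
          power2_eq_square)
    then show ?thesis using False by (intro exI[of _ "cnj (sgn (cdot v w))"]) (simp add: norm_sgn)
  qed
  then obtain c where c: "cmod c = 1" "cmod (cdot v w) = Re (c * cdot v w)" by blast
  have "Re (c * cdot v w) = inner (c *s v) w" by (simp flip: Re_cdot)
  also have "\<dots> \<le> norm (c *s v) * norm w" by (rule norm_cauchy_schwarz)
  also have "norm (c *s v) = norm v"
    using c(1) by (simp add: norm_vec_def norm_mult)
  finally show ?thesis using c by simp
qed

lemma norm_smult: "norm (c *s v) = cmod c * norm v" for v :: "complex^'n"
  by (simp add: norm_vec_def norm_mult L2_set_right_distrib)


section \<open>Rayleigh quotients\<close>

lemma cadjoint_simps [simp]:
  "cadjoint (a + b) = cadjoint a + cadjoint b" "cadjoint (a - b) = cadjoint a - cadjoint b"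
  "cadjoint (- a) = - cadjoint a" "cadjoint (r *\<^sub>R a) = r *\<^sub>R cadjoint a"
  "cadjoint (mat c) = mat (cnj c)" "cadjoint 0 = 0"
  by (auto simp: cadjoint_def vec_eq_iff mat_def)

lemma cmatrix_norm_minus [simp]: "cmatrix_norm (- a) = cmatrix_norm a"
proof -
  have "- a = map_matrix ((*) (-1)) a" by (simp add: vec_eq_iff)
  then show ?thesis by (simp add: cmatrix_norm_scale)
qed

lemma cmatrix_norm_scaleR: "cmatrix_norm (r *\<^sub>R a) = \<bar>r\<bar> * cmatrix_norm a"
proof -
  have "r *\<^sub>R a = map_matrix ((*) (complex_of_real r)) a"
    by (simp add: vec_eq_iff scaleR_conv_of_real[of _ "_ :: complex"])
  then show ?thesis by (simp add: cmatrix_norm_scale)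
qed

lemma scaleR_matrix_mult: "(r *\<^sub>R a) ** b = r *\<^sub>R (a ** b)" "a ** (r *\<^sub>R b) = r *\<^sub>R (a ** b)"
  for a :: "complex^'n^'m"
  by (simp_all add: vec_eq_iff matrix_matrix_mult_def scaleR_sum_right)

lemma scaleR_matrix_vector_mult: "(r *\<^sub>R a) *v v = r *\<^sub>R (a *v v)" for a :: "complex^'n^'m"
  by (simp add: vec_eq_iff matrix_vector_mult_def scaleR_sum_right)

lemma minus_matrix_vector_mult: "(- a) *v v = - (a *v v)" for a :: "complex^'n^'m"
  by (simp add: vec_eq_iff matrix_vector_mult_def sum_negf)

lemma mat_vector_mult: "mat c *v v = c *s v" for v :: "complex^'n"
  by (simp add: vec_eq_iff matrix_vector_mult_def mat_def if_distrib[of "\<lambda>z. z * _"] cong: if_cong)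

text \<open>For Hermitian \<open>a\<close> this is the largest eigenvalue, and
  \<open>- rayleigh_max (- a)\<close> is the smallest. In the variational form subadditivity and
  continuity are immediate, without a spectral theorem.\<close>

definition rayleigh_max :: "complex^'n^'n \<Rightarrow> real" where
  "rayleigh_max a = (SUP v\<in>sphere 0 1. inner (a *v v) v)"

definition spread :: "complex^'n^'n \<Rightarrow> real" where
  "spread a = rayleigh_max a + rayleigh_max (- a)"

lemma unit_vector_exists: "\<exists>v::complex^'n. norm v = 1"
  by (rule exI[of _ "axis undefined 1"]) (simp add: norm_axis_1)

lemma sphere_nonempty: "sphere (0::complex^'n) 1 \<noteq> {}"
  using unit_vector_exists by auto

lemma rayleigh_le_norm: "\<bar>inner (a *v v) w\<bar> \<le> cmatrix_norm a * norm v * norm w"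
  for a :: "complex^'n^'n"
  by (meson Cauchy_Schwarz_ineq2 mult_right_mono norm_ge_zero norm_mult_vec_le order_trans)

lemma rayleigh_le_cmatrix_norm: "norm v = 1 \<Longrightarrow> inner (a *v v) v \<le> cmatrix_norm a"
  for a :: "complex^'n^'n"
  using rayleigh_le_norm[of a v v] by (simp add: abs_le_iff)

lemma bdd_above_rayleigh: "bdd_above ((\<lambda>v. inner (a *v v) v) ` sphere 0 1)"
  for a :: "complex^'n^'n"
  by (rule bdd_aboveI2[of _ _ "cmatrix_norm a"]) (simp add: rayleigh_le_cmatrix_norm)

lemma rayleigh_max_leI: "(\<And>v. norm v = 1 \<Longrightarrow> inner (a *v v) v \<le> r) \<Longrightarrow> rayleigh_max a \<le> r"
  unfolding rayleigh_max_def by (rule cSUP_least[OF sphere_nonempty]) simp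

lemma rayleigh_le_max_unit: "norm v = 1 \<Longrightarrow> inner (a *v v) v \<le> rayleigh_max a"
  unfolding rayleigh_max_def by (rule cSUP_upper[OF _ bdd_above_rayleigh]) simp

lemma rayleigh_le_max: "inner (a *v v) v \<le> rayleigh_max a * (norm v)\<^sup>2"
  for a :: "complex^'n^'n"
proof (cases "v = 0")
  case False
  define w where "w = v /\<^sub>R norm v"
  have "v = norm v *\<^sub>R w" "norm w = 1" using False by (simp_all add: w_def)
  then have "inner (a *v v) v = (norm v)\<^sup>2 * inner (a *v w) w"
    by (metis (no_types, lifting) inner_scaleR_left inner_scaleR_right mult.assoc
        power2_eq_square scaleR_eq_smult vector_scalar_commute)
  also have "\<dots> \<le> (norm v)\<^sup>2 * rayleigh_max a"
    using rayleigh_le_max_unit[OF \<open>norm w = 1\<close>] by (intro mult_left_mono) auto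
  finally show ?thesis by (simp add: mult.commute)
qed simp

lemma rayleigh_max_attained: "\<exists>v. norm v = 1 \<and> inner (a *v v) v = rayleigh_max a"
  for a :: "complex^'n^'n"
proof -
  have "continuous_on (sphere 0 1) (\<lambda>v. inner (a *v v) v)"
    by (intro continuous_intros linear_continuous_on matrix_vector_mul_bounded_linear)
  then obtain v where v: "v \<in> sphere 0 1" "\<And>w. w \<in> sphere 0 1 \<Longrightarrow> inner (a *v w) w \<le> inner (a *v v) v"
    using continuous_attains_sup[OF compact_sphere sphere_nonempty] by blast
  then have "rayleigh_max a \<le> inner (a *v v) v" by (intro rayleigh_max_leI) auto
  with v rayleigh_le_max_unit[of v a] show ?thesis by (intro exI[of _ v]) auto
qed

lemma rayleigh_max_le_norm: "rayleigh_max a \<le> cmatrix_norm a"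
  by (rule rayleigh_max_leI) (rule rayleigh_le_cmatrix_norm)

lemma rayleigh_max_add: "rayleigh_max (a + b) \<le> rayleigh_max a + rayleigh_max b"
  by (rule rayleigh_max_leI)
    (simp add: matrix_vector_mult_add_rdistrib inner_add_left add_mono rayleigh_le_max_unit)

lemma rayleigh_max_scaleR:
  assumes "r \<ge> 0" shows "rayleigh_max (r *\<^sub>R a) = r * rayleigh_max a"
proof (rule antisym)
  show "rayleigh_max (r *\<^sub>R a) \<le> r * rayleigh_max a"
    using assms by (intro rayleigh_max_leI)
      (simp add: scaleR_matrix_vector_mult rayleigh_le_max_unit mult_left_mono)
  obtain v where v: "norm v = 1" "inner (a *v v) v = rayleigh_max a"
    using rayleigh_max_attained by blast
  then show "r * rayleigh_max a \<le> rayleigh_max (r *\<^sub>R a)"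
    using rayleigh_le_max_unit[of v "r *\<^sub>R a"] by (simp add: scaleR_matrix_vector_mult)
qed

text \<open>Subadditivity for the shift by \<open>r\<close> gives one inequality, for the shift back
  by \<open>- r\<close> the other.\<close>

lemma rayleigh_max_add_mat: "rayleigh_max (a + mat (complex_of_real r)) = rayleigh_max a + r"
  for a :: "complex^'n^'n"
proof -
  have mat: "rayleigh_max (mat (complex_of_real r) :: complex^'n^'n) \<le> r" for r
    by (rule rayleigh_max_leI) (simp add: mat_vector_mult dot_square_norm flip: scaleR_eq_smult)
  have "a = (a + mat (complex_of_real r)) + mat (complex_of_real (- r))"
    by (simp add: vec_eq_iff mat_def)
  then have "rayleigh_max a \<le> rayleigh_max (a + mat (complex_of_real r))
      + rayleigh_max (mat (complex_of_real (- r)) :: complex^'n^'n)"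
    using rayleigh_max_add[of "a + mat (complex_of_real r)" "mat (complex_of_real (- r))"] by metis
  then have "rayleigh_max a \<le> rayleigh_max (a + mat (complex_of_real r)) - r"
    using mat[of "- r"] by linarith
  moreover have "rayleigh_max (a + mat (complex_of_real r)) \<le> rayleigh_max a + r"
    using rayleigh_max_add[of a "mat (complex_of_real r)"] mat[of r] by simp
  ultimately show ?thesis by simp
qed

lemma rayleigh_max_conj_le:
  fixes u a :: "complex^'n^'n"
  assumes "u ** cadjoint u = mat 1"
  shows "rayleigh_max (u ** a ** cadjoint u) \<le> rayleigh_max a"
proof (rule rayleigh_max_leI)
  fix v :: "complex^'n" assume v: "norm v = 1"
  define w where "w = cadjoint u *v v"
  have "(norm w)\<^sup>2 = inner (u *v w) v"
    unfolding w_def using inner_cadjoint[of u v "cadjoint u *v v"]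
    by (metis dot_square_norm inner_commute)
  also have "u *v w = v" by (simp add: w_def matrix_vector_mul_assoc assms)
  finally have "(norm w)\<^sup>2 = 1\<^sup>2" using v by (simp add: dot_square_norm)
  then have w: "norm w = 1" by (rule power2_eq_imp_eq) auto
  have "inner ((u ** a ** cadjoint u) *v v) v = inner (u *v (a *v w)) v"
    by (simp add: w_def matrix_vector_mul_assoc matrix_mul_assoc)
  also have "\<dots> = inner (a *v w) w"
    unfolding w_def using inner_cadjoint[of u v "a *v (cadjoint u *v v)"]
    by (simp add: inner_commute)
  finally show "inner ((u ** a ** cadjoint u) *v v) v \<le> rayleigh_max a"
    using rayleigh_le_max_unit[OF w] by simp
qed

lemma unitary_conj_cancel:
  assumes "cadjoint u ** u = mat 1"
  shows "cadjoint u ** (u ** a ** cadjoint u) ** u = a"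
proof -
  have "cadjoint u ** (u ** a ** cadjoint u) ** u = (cadjoint u ** u) ** a ** (cadjoint u ** u)"
    by (simp add: matrix_mul_assoc)
  then show ?thesis by (simp add: assms)
qed

lemma unitary_other_side: "cadjoint u ** u = mat 1 \<longleftrightarrow> u ** cadjoint u = mat 1"
  for u :: "complex^'n^'n"
  by (rule matrix_left_right_inverse)

lemma rayleigh_max_conj:
  assumes "u ** cadjoint u = mat 1"
  shows "rayleigh_max (u ** a ** cadjoint u) = rayleigh_max a"
proof (rule antisym[OF rayleigh_max_conj_le[OF assms]])
  have *: "cadjoint u ** u = mat 1" using assms unitary_other_side by blast
  then show "rayleigh_max a \<le> rayleigh_max (u ** a ** cadjoint u)"
    using rayleigh_max_conj_le[of "cadjoint u" "u ** a ** cadjoint u"] unitary_conj_cancel[OF *,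
      of a]
    by simp
qed

lemma matrix_mult_minus: "u ** (- a) = - (u ** a)" "(- a) ** u = - (a ** u)"
  for a :: "complex^'n^'n"
  by (simp_all add: vec_eq_iff matrix_matrix_mult_def sum_negf)

section \<open>Invariance, subadditivity and continuity of the spread\<close>

lemma spread_conj: "u ** cadjoint u = mat 1 \<Longrightarrow> spread (u ** a ** cadjoint u) = spread a"
  unfolding spread_def using rayleigh_max_conj[of u a] rayleigh_max_conj[of u "- a"]
  by (simp add: matrix_mult_minus)

lemma spread_add: "spread (a + b) \<le> spread a + spread b"
  unfolding spread_def using rayleigh_max_add[of a b] rayleigh_max_add[of "- a" "- b"] by simp

lemma spread_scaleR: "r \<ge> 0 \<Longrightarrow> spread (r *\<^sub>R a) = r * spread a"
  unfolding spread_def using rayleigh_max_scaleR[of r a] rayleigh_max_scaleR[of r "- a"]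
  by (simp add: distrib_left)

lemma spread_add_mat: "spread (a + mat (complex_of_real r)) = spread a"
proof -
  have "- (a + mat (complex_of_real r)) = - a + mat (complex_of_real (- r))"
    by (simp add: vec_eq_iff mat_def)
  then show ?thesis
    unfolding spread_def using rayleigh_max_add_mat[of a r] rayleigh_max_add_mat[of "- a" "- r"]
    by simp
qed

lemma spread_le_norm: "spread a \<le> 2 * cmatrix_norm a"
  unfolding spread_def using rayleigh_max_le_norm[of a] rayleigh_max_le_norm[of "- a"] by simp

lemma rayleigh_max_lipschitz:
  "\<bar>rayleigh_max a - rayleigh_max b\<bar> \<le> real CARD('n) * norm (a - b)" for a b :: "complex^'n^'n"
proof -
  have "rayleigh_max a \<le> rayleigh_max b + real CARD('n) * norm (a - b)" for a b :: "complex^'n^'n"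
    using rayleigh_max_add[of b "a - b"] rayleigh_max_le_norm[of "a - b"]
      cmatrix_norm_le_frobenius[of "a - b"] by simp
  from this[of a b] this[of b a] show ?thesis by (simp add: norm_minus_commute abs_le_iff)
qed

lemma tendsto_rayleigh_max [tendsto_intros]:
  fixes a :: "complex^'n^'n"
  assumes "(f \<longlongrightarrow> a) F"
  shows "((\<lambda>x. rayleigh_max (f x)) \<longlongrightarrow> rayleigh_max a) F"
proof (rule metric_tendsto_imp_tendsto)
  show "((\<lambda>x. real CARD('n) *\<^sub>R f x) \<longlongrightarrow> real CARD('n) *\<^sub>R a) F"
    by (intro tendsto_intros assms)
  show "\<forall>\<^sub>F x in F. dist (rayleigh_max (f x)) (rayleigh_max a)
      \<le> dist (real CARD('n) *\<^sub>R f x) (real CARD('n) *\<^sub>R a)"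
    using rayleigh_max_lipschitz[of "f _" a]
    by (intro always_eventually) (simp add: dist_norm flip: scaleR_diff_right)
qed

lemma tendsto_spread [tendsto_intros]:
  "(f \<longlongrightarrow> a) F \<Longrightarrow> ((\<lambda>x. spread (f x)) \<longlongrightarrow> spread a) F"
  unfolding spread_def by (intro tendsto_intros)

text \<open>Polarization: for a Hermitian matrix the quadratic form controls the sesquilinear form,
  and the parallelogram law keeps the constant equal to \<open>r\<close>. This turns Rayleigh bounds
  into bounds of the C*-norm.\<close>

lemma hermitian_norm_le:
  fixes a :: "complex^'n^'n"
  assumes herm: "cadjoint a = a" and "rayleigh_max a \<le> r" "rayleigh_max (- a) \<le> r"
  shows "cmatrix_norm a \<le> r"
proof -
  have q: "\<bar>inner (a *v v) v\<bar> \<le> r * (norm v)\<^sup>2" for v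
    using rayleigh_le_max[of a v] rayleigh_le_max[of "- a" v] assms(2,3)
      mult_right_mono[of _ r "(norm v)\<^sup>2"]
    by (smt (verit) minus_matrix_vector_mult inner_minus_left zero_le_power2)
  have r: "r \<ge> 0"
    using q unit_vector_exists[where 'n='n] by (metis abs_ge_zero mult.right_neutral one_power2
      order_trans)
  show ?thesis
  proof (rule cmatrix_norm_le[OF r])
    fix v
    show "norm (a *v v) \<le> r * norm v"
    proof (cases "v = 0 \<or> a *v v = 0")
      case True
      then show ?thesis using r by auto
    next
      case False
      \<comment> \<open>\<open>w\<close> points along \<open>a *v v\<close> and has the length of
        \<open>v\<close>, so \<open>inner (a *v v) w\<close> is the product of the norms of
        \<open>v\<close> and \<open>a *v v\<close>.\<close>
      define s where "s = norm v / norm (a *v v)"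
      define w where "w = s *\<^sub>R (a *v v)"
      have s: "s > 0" "norm w = norm v" using False by (auto simp: s_def w_def)
      have sym: "inner (a *v w) v = inner (a *v v) w"
        using inner_cadjoint[of a w v] herm by (simp add: inner_commute)
      have "4 * inner (a *v v) w = inner (a *v (v + w)) (v + w) - inner (a *v (v - w)) (v - w)"
        using sym by (simp add: matrix_vector_right_distrib matrix_vector_mult_diff_distrib
            inner_add_left inner_add_right inner_diff_left inner_diff_right)
      also have "\<dots> \<le> r * (norm (v + w))\<^sup>2 + r * (norm (v - w))\<^sup>2"
        using q[of "v + w"] q[of "v - w"] by (simp add: abs_le_iff)
      also have "\<dots> = 2 * r * ((norm v)\<^sup>2 + (norm w)\<^sup>2)"
        by (simp only: power2_norm_eq_inner inner_add_left inner_add_right inner_diff_left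
            inner_diff_right inner_commute[of w v]) (simp add: algebra_simps)
      finally have "inner (a *v v) w \<le> r * (norm v)\<^sup>2" by (simp add: s)
      moreover have "inner (a *v v) w = norm v * norm (a *v v)"
        using False by (simp add: w_def s_def dot_square_norm power2_eq_square)
      ultimately have "norm v * norm (a *v v) \<le> norm v * (r * norm v)"
        by (simp add: power2_eq_square mult_ac)
      then show ?thesis using False by simp
    qed
  qed
qed

text \<open>Subtracting the midpoint of the spectrum makes both extreme Rayleigh values equal to
  half the spread. This scalar becomes the central element in the uniform Dixmier property.\<close>

lemma hermitian_norm_midpoint:
  fixes a :: "complex^'n^'n"
  assumes "cadjoint a = a"
  shows "cmatrix_norm (a - mat (complex_of_real ((rayleigh_max a - rayleigh_max (- a)) / 2)))
    \<le> spread a / 2"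
proof (rule hermitian_norm_le)
  define m where "m = (rayleigh_max a - rayleigh_max (- a)) / 2"
  have *: "a - mat (complex_of_real m) = a + mat (complex_of_real (- m))"
    "- (a + mat (complex_of_real (- m))) = - a + mat (complex_of_real m)"
    by (simp_all add: vec_eq_iff mat_def)
  show "rayleigh_max (a - mat (complex_of_real ((rayleigh_max a - rayleigh_max (- a)) / 2)))
      \<le> spread a / 2"
    "rayleigh_max (- (a - mat (complex_of_real ((rayleigh_max a - rayleigh_max (- a)) / 2))))
      \<le> spread a / 2"
    unfolding m_def[symmetric] * rayleigh_max_add_mat
    by (simp_all add: m_def spread_def field_simps)
qed (simp add: assms)

lemma rayleigh_max_trace: "Re (trace a) \<le> real CARD('n) * rayleigh_max a" for a :: "complex^'n^'n"
proof -
  have entry: "(a *v axis i 1) $ i = a $ i $ i" for i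
    by (simp add: matrix_vector_mult_def axis_def if_distrib cong: if_cong)
  have "Re (trace a) = (\<Sum>i\<in>UNIV. inner (a *v axis i 1) (axis i 1))"
    by (simp add: trace_def inner_axis entry inner_complex_def)
  also have "\<dots> \<le> (\<Sum>i\<in>(UNIV::'n set). rayleigh_max a)"
    by (intro sum_mono rayleigh_le_max_unit) (simp add: norm_axis_1)
  finally show ?thesis by simp
qed

text \<open>Zero trace puts 0 between the smallest and the largest eigenvalue, so neither exceeds
  the spread in modulus. In contrast to the midpoint, 0 may lie near an end of the spectrum, hence
  no factor 1/2.\<close>

lemma trace_zero_norm_le_spread:
  assumes "cadjoint a = a" "trace a = 0"
  shows "cmatrix_norm a \<le> spread a"
proof -
  have "trace (- a) = 0" using assms(2) by (simp add: trace_def sum_negf)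
  then have "rayleigh_max a \<ge> 0" "rayleigh_max (- a) \<ge> 0"
    using rayleigh_max_trace[of a] rayleigh_max_trace[of "- a"] assms(2)
    by (simp_all add: zero_le_mult_iff)
  then show ?thesis using assms(1) by (intro hermitian_norm_le) (auto simp: spread_def)
qed

lemma cmatrix_norm_conj_le:
  fixes u a :: "complex^'n^'n"
  assumes "u ** cadjoint u = mat 1"
  shows "cmatrix_norm (u ** a ** cadjoint u) \<le> cmatrix_norm a"
proof -
  have "(cmatrix_norm (cadjoint u))\<^sup>2 = cmatrix_norm (mat 1 :: complex^'n^'n)"
    using cmatrix_cstar_identity[of "cadjoint u"] assms
    by (simp del: cmatrix_cstar_identity)
  moreover have "cmatrix_norm (mat 1 :: complex^'n^'n) \<le> 1" by (intro cmatrix_norm_le) auto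
  ultimately have u: "cmatrix_norm u \<le> 1"
    by (metis cmatrix_norm_cadjoint one_power2 power2_le_imp_le zero_le_one)
  have "cmatrix_norm (u ** a ** cadjoint u) \<le> cmatrix_norm (u ** a) * cmatrix_norm u"
    using cmatrix_norm_mult[of "u ** a" "cadjoint u"] by (simp add: cmatrix_norm_cadjoint)
  also have "\<dots> \<le> cmatrix_norm (u ** a) * 1" by (intro mult_left_mono u cmatrix_norm_nonneg)
  also have "\<dots> \<le> cmatrix_norm u * cmatrix_norm a" using cmatrix_norm_mult[of u a] by simp
  also have "\<dots> \<le> 1 * cmatrix_norm a" by (intro mult_right_mono u cmatrix_norm_nonneg)
  finally show ?thesis by simp
qed

section \<open>Partitions of unity and general position\<close>

lemma eventually_atin_openin: "openin X U \<Longrightarrow> x \<in> U \<Longrightarrow> (\<And>y. y \<in> U \<Longrightarrow> P y) \<Longrightarrow> eventually P (atin X x)"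
  unfolding eventually_atin by blast

lemma compact_Hausdorff_bump:
  assumes "compact_space X" "Hausdorff_space X" "openin X U" "x \<in> U"
  obtains f :: "'a \<Rightarrow> real" where "continuous_map X euclideanreal f" "f x = 1"
    "\<And>y. y \<in> topspace X \<Longrightarrow> 0 \<le> f y" "\<And>y. y \<in> topspace X \<Longrightarrow> y \<notin> U \<Longrightarrow> f y = 0"
proof -
  have "completely_regular_space X"
    using assms by (simp add: compact_Hausdorff_or_regular_imp_normal_space
        normal_imp_completely_regular_space_gen)
  moreover have "closedin X (topspace X - U)" "x \<in> topspace X - (topspace X - U)"
    using assms openin_subset by fastforce+
  ultimately obtain g where g: "continuous_map X (top_of_set {0..1}) g" "g x = (0::real)"
      "g ` (topspace X - U) \<subseteq> {1}"
    unfolding completely_regular_space_def by meson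
  then have cont: "continuous_map X euclideanreal g" and le: "\<And>y. y \<in> topspace X \<Longrightarrow> g y \<le> 1"
    by (auto simp: continuous_map_in_subtopology)
  show ?thesis
  proof (rule that[of "\<lambda>y. 1 - g y"])
    show "continuous_map X euclideanreal (\<lambda>y. 1 - g y)"
      using cont by (intro continuous_map_diff) auto
  qed (use g le in auto)
qed

lemma compact_space_finite_subcover:
  assumes "compact_space X" "\<And>i. i \<in> I \<Longrightarrow> openin X (U i)" "topspace X \<subseteq> (\<Union>i\<in>I. U i)"
  obtains J where "finite J" "J \<subseteq> I" "topspace X \<subseteq> (\<Union>i\<in>J. U i)"
proof -
  obtain \<F> where "finite \<F>" "\<F> \<subseteq> U ` I" "topspace X \<subseteq> \<Union>\<F>"
    using assms(1)[unfolded compact_space_alt, rule_format, of "U ` I"] assms(2,3) by blast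
  then show ?thesis by (metis finite_subset_image that)
qed

text \<open>\<open>f V\<close> vanishes off \<open>V\<close>, but its closed support may leave
  \<open>V\<close>. A local object multiplied by \<open>f V\<close> is therefore extended by means
  of \<open>tendsto_cutoff_scaleR\<close>, which asks for boundedness.\<close>

lemma partition_of_unity:
  assumes X: "compact_space X" "Hausdorff_space X" and cover: "open_cover X \<V>"
  obtains \<V>' and f :: "'a set \<Rightarrow> 'a \<Rightarrow> real" where "finite \<V>'" "\<V>' \<subseteq> \<V>"
    "\<And>V. continuous_map X euclideanreal (f V)"
    "\<And>V x. x \<in> topspace X \<Longrightarrow> 0 \<le> f V x"
    "\<And>V x. x \<in> topspace X \<Longrightarrow> x \<notin> V \<Longrightarrow> f V x = 0"
    "\<And>x. x \<in> topspace X \<Longrightarrow> (\<Sum>V\<in>\<V>'. f V x) = 1"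
proof -
  have "\<exists>p. fst p \<in> \<V> \<and> continuous_map X euclideanreal (snd p) \<and> snd p x = (1::real) \<and>
      (\<forall>y\<in>topspace X. 0 \<le> snd p y \<and> (y \<notin> fst p \<longrightarrow> snd p y = 0))" if "x \<in> topspace X" for x
  proof -
    from that cover obtain V where V: "V \<in> \<V>" "x \<in> V" "openin X V"
      unfolding open_cover_def by blast
    obtain g :: "'a \<Rightarrow> real" where "continuous_map X euclideanreal g" "g x = 1"
      "\<And>y. y \<in> topspace X \<Longrightarrow> 0 \<le> g y" "\<And>y. y \<in> topspace X \<Longrightarrow> y \<notin> V \<Longrightarrow> g y = 0"
      using compact_Hausdorff_bump[OF X V(3,2)] by blast
    with V show ?thesis by (intro exI[of _ "(V, g)"]) simp
  qed
  then obtain p where p: "\<forall>x\<in>topspace X. fst (p x) \<in> \<V> \<and>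
    continuous_map X euclideanreal (snd (p x)) \<and>
      snd (p x) x = (1::real) \<and>
      (\<forall>y\<in>topspace X. 0 \<le> snd (p x) y \<and> (y \<notin> fst (p x) \<longrightarrow> snd (p x) y = 0))"
    by metis
  define V g where "V = (\<lambda>x. fst (p x))" and "g = (\<lambda>x. snd (p x))"
  have V: "\<And>x. x \<in> topspace X \<Longrightarrow> V x \<in> \<V>"
    and g: "\<And>x. x \<in> topspace X \<Longrightarrow> continuous_map X euclideanreal (g x)"
      "\<And>x. x \<in> topspace X \<Longrightarrow> g x x = (1::real)"
      "\<And>x y. x \<in> topspace X \<Longrightarrow> y \<in> topspace X \<Longrightarrow> 0 \<le> g x y"
      "\<And>x y. x \<in> topspace X \<Longrightarrow> y \<in> topspace X \<Longrightarrow> y \<notin> V x \<Longrightarrow> g x y = 0"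
    using p by (auto simp: V_def g_def)
  have op: "openin X {y \<in> topspace X. g x y \<in> {0<..}}" if "x \<in> topspace X" for x
    using g(1)[OF that] by (rule openin_continuous_map_preimage) simp
  have cov0: "topspace X \<subseteq> (\<Union>x\<in>topspace X. {y \<in> topspace X. g x y \<in> {0<..}})"
    using g(2) by force
  obtain T where T: "finite T" "T \<subseteq> topspace X"
    and cov: "topspace X \<subseteq> (\<Union>x\<in>T. {y \<in> topspace X. g x y \<in> {0<..}})"
    using compact_space_finite_subcover[OF X(1) op cov0] by blast
  define s where "s y = (\<Sum>x\<in>T. g x y)" for y
  have s_pos: "s y > 0" if y: "y \<in> topspace X" for y
  proof -
    obtain x where "x \<in> T" "g x y > 0" using cov y by auto
    then show ?thesis unfolding s_def using T y g(3) by (intro sum_pos2[of _ x]) auto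
  qed
  \<comment> \<open>Several points may have chosen the same member of the cover; their bumps are
    added up, so that the result is indexed by the members.\<close>
  define f where "f W y = (\<Sum>x | x \<in> T \<and> V x = W. g x y) / s y" for W y
  show ?thesis
  proof (rule that[of "V ` T" f])
    show "finite (V ` T)" "V ` T \<subseteq> \<V>" using T V by auto
    show "continuous_map X euclideanreal (f W)" for W
    proof -
      have "\<And>y. y \<in> topspace X \<Longrightarrow> s y \<noteq> 0" using s_pos by fastforce
      then show ?thesis
        unfolding f_def s_def using T g(1)
        by (intro continuous_map_real_divide continuous_map_sum) (auto simp: subset_iff)
    qed
    show "0 \<le> f W x" if "x \<in> topspace X" for W x
      unfolding f_def using T g(3) that s_pos[OF that]
        by (auto intro!: divide_nonneg_pos sum_nonneg)
    show "f W x = 0" if "x \<in> topspace X" "x \<notin> W" for W x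
      unfolding f_def using T g(4) that by (subst sum.neutral) auto
    show "(\<Sum>W\<in>V ` T. f W x) = 1" if "x \<in> topspace X" for x
    proof -
      have "(\<Sum>W\<in>V ` T. \<Sum>y | y \<in> T \<and> V y = W. g y x) = s x"
        unfolding s_def using sum.image_gen[OF T(1), of "\<lambda>y. g y x" V] by simp
      then show ?thesis
        unfolding f_def sum_divide_distrib[symmetric] using s_pos[OF that] by simp
    qed
  qed
qed

text \<open>Where \<open>x\<close> lies in \<open>W\<close>, both factors converge. Otherwise
  \<open>f\<close> tends to 0 at \<open>x\<close> and boundedness of \<open>g\<close> suffices,
  whatever values \<open>g\<close> takes outside \<open>W\<close>.\<close>

lemma tendsto_cutoff_scaleR:
  fixes g :: "'a \<Rightarrow> 'b::real_normed_vector"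
  assumes N: "openin X N" "x \<in> N" and f: "continuous_map X euclideanreal f"
    and zero: "\<And>y. y \<in> topspace X \<Longrightarrow> y \<notin> W \<Longrightarrow> f y = 0"
    and g: "x \<in> W \<Longrightarrow> (g \<longlongrightarrow> g x) (atin X x)"
    and bound: "\<And>y. y \<in> N \<Longrightarrow> y \<in> W \<Longrightarrow> norm (g y) \<le> B"
  shows "((\<lambda>y. f y *\<^sub>R g y) \<longlongrightarrow> f x *\<^sub>R g x) (atin X x)"
proof -
  have x: "x \<in> topspace X" using N openin_subset by blast
  have fx: "(f \<longlongrightarrow> f x) (atin X x)" using f x unfolding continuous_map_iff_tendsto by blast
  show ?thesis
  proof (cases "x \<in> W")
    case True
    with g fx show ?thesis by (intro tendsto_intros)
  next
    case False
    then have f0: "f x = 0" using zero x by blast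
    have "((\<lambda>y. f y *\<^sub>R g y) \<longlongrightarrow> 0) (atin X x)"
    proof (rule Lim_null_comparison)
      have "((\<lambda>y. \<bar>f y\<bar> * \<bar>B\<bar>) \<longlongrightarrow> \<bar>f x\<bar> * \<bar>B\<bar>) (atin X x)" by (intro tendsto_intros fx)
      then show "((\<lambda>y. \<bar>f y\<bar> * \<bar>B\<bar>) \<longlongrightarrow> 0) (atin X x)" by (simp add: f0)
      show "\<forall>\<^sub>F y in atin X x. norm (f y *\<^sub>R g y) \<le> \<bar>f y\<bar> * \<bar>B\<bar>"
      proof (rule eventually_atin_openin[OF N])
        fix y assume "y \<in> N"
        then have "y \<in> topspace X" using N openin_subset by blast
        then show "norm (f y *\<^sub>R g y) \<le> \<bar>f y\<bar> * \<bar>B\<bar>"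
          using bound[OF \<open>y \<in> N\<close>] zero[of y] by (cases "y \<in> W") (auto intro!: mult_left_mono)
      qed
    qed
    then show ?thesis by (simp add: f0)
  qed
qed

text \<open>The points are moved one at a time. A new point has to avoid finitely many spans of
  fewer than \<open>DIM('e)\<close> earlier points; these are null sets and cannot fill a ball.
  Stating independence by coefficients over indices also excludes coinciding points.\<close>

lemma general_position:
  fixes p :: "'i \<Rightarrow> 'e::euclidean_space"
  assumes "finite I" "e > 0"
  shows "\<exists>q. (\<forall>i\<in>I. dist (q i) (p i) < e) \<and>
    (\<forall>F\<subseteq>I. card F \<le> DIM('e) \<longrightarrow> (\<forall>c. (\<Sum>i\<in>F. c i *\<^sub>R q i) = 0 \<longrightarrow> (\<forall>i\<in>F. c i = 0)))"
  using assms(1)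
proof induction
  case empty
  then show ?case by auto
next
  case (insert a I)
  then obtain q where q: "\<forall>i\<in>I. dist (q i) (p i) < e"
    and q_indep: "\<forall>F\<subseteq>I. card F \<le> DIM('e) \<longrightarrow>
      (\<forall>c. (\<Sum>i\<in>F. c i *\<^sub>R q i) = 0 \<longrightarrow> (\<forall>i\<in>F. c i = 0))"
    by blast
  have indep: "c i = 0" if "F \<subseteq> I" "card F \<le> DIM('e)" "(\<Sum>i\<in>F. c i *\<^sub>R q i) = 0" "i \<in> F" for F c i
    using q_indep that by blast
  \<comment> \<open>The inequality is strict because the new point \<open>a\<close> joins
    \<open>G\<close> to form a set of at most \<open>DIM('e)\<close> indices.\<close>
  define B where "B = (\<Union>G\<in>{G. G \<subseteq> I \<and> card G < DIM('e)}. span (q ` G))"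
  have "negligible B"
    unfolding B_def
  proof (rule negligible_Union)
    show "finite ((\<lambda>G. span (q ` G)) ` {G. G \<subseteq> I \<and> card G < DIM('e)})"
      using insert.hyps by simp
    fix T assume "T \<in> (\<lambda>G. span (q ` G)) ` {G. G \<subseteq> I \<and> card G < DIM('e)}"
    then obtain G where G: "G \<subseteq> I" "card G < DIM('e)" "T = span (q ` G)" by blast
    have "finite G" using G insert.hyps finite_subset by blast
    then have "dim (q ` G) \<le> card G"
      by (meson card_image_le dim_le_card' finite_imageI le_trans)
    then show "negligible T"
      using G by (intro negligible_lowdim) (simp add: dim_span)
  qed
  then have "\<not> ball (p a) e \<subseteq> B"
    using open_not_negligible[OF open_ball, of "p a" e] assms(2) negligible_subset[of B "ball (p
      a) e"]
    by (metis centre_in_ball empty_iff)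
  then obtain z where "z \<in> ball (p a) e" "z \<notin> B" by blast
  then have z: "dist z (p a) < e" "z \<notin> B" by (simp_all add: dist_commute)
  define q' where "q' = q(a := z)"
  have indep': "c i = 0" if F: "F \<subseteq> insert a I" "card F \<le> DIM('e)" "(\<Sum>i\<in>F. c i *\<^sub>R q' i) = 0"
    "i \<in> F" for F c i
  proof (cases "a \<in> F")
    case False
    then have "(\<Sum>i\<in>F. c i *\<^sub>R q i) = (\<Sum>i\<in>F. c i *\<^sub>R q' i)"
      by (intro sum.cong) (auto simp: q'_def)
    then show ?thesis using indep[of F c i] F False by force
  next
    case True
    define G where "G = F - {a}"
    have fin: "finite F" using F insert.hyps finite_subset by blast
    have G: "G \<subseteq> I" "card G < DIM('e)"
      using F True fin insert.hyps card_gt_0_iff[of F] by (auto simp: G_def)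
    have "(\<Sum>i\<in>G. c i *\<^sub>R q' i) = (\<Sum>i\<in>G. c i *\<^sub>R q i)"
      by (intro sum.cong) (auto simp: q'_def G_def)
    then have sum0: "c a *\<^sub>R z + (\<Sum>i\<in>G. c i *\<^sub>R q i) = 0"
      using F(3) sum.remove[OF fin True, of "\<lambda>i. c i *\<^sub>R q' i"] by (simp add: q'_def G_def)
    have ca: "c a = 0"
    proof (rule ccontr)
      assume "c a \<noteq> 0"
      have "z = inverse (c a) *\<^sub>R (c a *\<^sub>R z)" using \<open>c a \<noteq> 0\<close> by simp
      also have "c a *\<^sub>R z = - (\<Sum>i\<in>G. c i *\<^sub>R q i)"
        using sum0 by (simp add: eq_neg_iff_add_eq_0)
      finally have "z = - inverse (c a) *\<^sub>R (\<Sum>i\<in>G. c i *\<^sub>R q i)" by simp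
      moreover have "(\<Sum>i\<in>G. c i *\<^sub>R q i) \<in> span (q ` G)"
        by (intro span_sum span_scale span_base) auto
      ultimately have "z \<in> span (q ` G)" by (metis span_scale)
      then show False using z(2) G by (auto simp: B_def)
    qed
    show ?thesis
    proof (cases "i = a")
      case False
      then show ?thesis using indep[of G c i] G sum0 ca F(4) by (simp add: G_def)
    qed (simp add: ca)
  qed
  have "dist (q' i) (p i) < e" if "i \<in> insert a I" for i
    using that q z by (auto simp: q'_def)
  moreover have "\<forall>F\<subseteq>insert a I. card F \<le> DIM('e) \<longrightarrow>
      (\<forall>c. (\<Sum>i\<in>F. c i *\<^sub>R q' i) = 0 \<longrightarrow> (\<forall>i\<in>F. c i = 0))"
    by (intro allI impI ballI) (rule indep')
  ultimately show ?case by blast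
qed

section \<open>Moving maps off the origin when the dimension is small\<close>

lemma covering_multiplicity_mono:
  "covering_multiplicity_le X k \<Longrightarrow> k \<le> k' \<Longrightarrow> covering_multiplicity_le X k'"
  unfolding covering_multiplicity_le_def by (fast intro: le_trans)

lemma covering_multiplicity_refine:
  assumes "compact_space X" "covering_multiplicity_le X k" "\<And>i. i \<in> I \<Longrightarrow> openin X (U i)"
    and "topspace X \<subseteq> (\<Union>i\<in>I. U i)"
  obtains \<V> where "finite \<V>" "open_cover X \<V>" "\<And>V. V \<in> \<V> \<Longrightarrow> \<exists>i\<in>I. V \<subseteq> U i"
    "\<And>x. x \<in> topspace X \<Longrightarrow> card {V\<in>\<V>. x \<in> V} \<le> k"
proof -
  obtain J where J: "finite J" "J \<subseteq> I" "topspace X \<subseteq> (\<Union>i\<in>J. U i)"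
    using compact_space_finite_subcover[OF assms(1,3,4)] by blast
  have "finite (U ` J) \<and> open_cover X (U ` J)"
    using J assms(3) openin_subset[OF assms(3)] unfolding open_cover_def by (auto; blast)
  with assms(2) obtain \<V> where "finite \<V>" "open_cover X \<V>" "refines \<V> (U ` J)"
      "\<And>x. x \<in> topspace X \<Longrightarrow> card {V\<in>\<V>. x \<in> V} \<le> k"
    unfolding covering_multiplicity_le_def by meson
  then show ?thesis using J(2) by (intro that[of \<V>]) (auto simp: refines_def subset_iff, metis)
qed

text \<open>\<open>h\<close> is replaced by a combination of points in general position, weighted by
  a partition of unity. At each point at most \<open>DIM('e)\<close> weights are nonzero, so the
  points involved are linearly independent, and weights of sum 1 cannot produce 0.\<close>

lemma perturb_nonvanishing:
  fixes h :: "'a \<Rightarrow> 'e::euclidean_space"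
  assumes X: "compact_space X" "Hausdorff_space X" and dim: "covering_multiplicity_le X DIM('e)"
    and h: "continuous_map X euclidean h" and e: "e > 0"
  shows "\<exists>h'. continuous_map X euclidean h' \<and> (\<forall>x\<in>topspace X. h' x \<noteq> 0 \<and> dist (h' x) (h x) < e)"
proof -
  \<comment> \<open>One third of \<open>e\<close> bounds the distance from \<open>h x\<close> to the
    centre \<open>p V\<close>, another the distance from \<open>p V\<close> to its perturbation
    \<open>q V\<close>; the last third makes the final inequality strict.\<close>
  define U where "U q = {x \<in> topspace X. h x \<in> ball q (e/3)}" for q
  have op: "openin X (U q)" for q
    unfolding U_def using h by (rule openin_continuous_map_preimage) simp
  have cov: "topspace X \<subseteq> (\<Union>q\<in>UNIV. U q)"
  proof
    fix x assume "x \<in> topspace X"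
    then have "x \<in> U (h x)" using e by (simp add: U_def)
    then show "x \<in> (\<Union>q\<in>UNIV. U q)" by blast
  qed
  obtain \<V> where \<V>: "finite \<V>" "open_cover X \<V>" "\<And>V. V \<in> \<V> \<Longrightarrow> \<exists>q. V \<subseteq> U q"
    and mult: "\<And>x. x \<in> topspace X \<Longrightarrow> card {V\<in>\<V>. x \<in> V} \<le> DIM('e)"
    by (rule covering_multiplicity_refine[OF X(1) dim op cov]) blast
  then obtain p where p: "\<And>V. V \<in> \<V> \<Longrightarrow> V \<subseteq> U (p V)" by metis
  obtain \<V>' f where f: "finite \<V>'" "\<V>' \<subseteq> \<V>" "\<And>V. continuous_map X euclideanreal (f V)"
      "\<And>V x. x \<in> topspace X \<Longrightarrow> 0 \<le> f V x"
      "\<And>V x. x \<in> topspace X \<Longrightarrow> x \<notin> V \<Longrightarrow> f V x = 0"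
      "\<And>x. x \<in> topspace X \<Longrightarrow> (\<Sum>V\<in>\<V>'. f V x) = 1"
    using partition_of_unity[OF X \<V>(2)] by metis
  have "e/3 > 0" using e by simp
  from general_position[OF f(1) this, of p] obtain q where q: "\<forall>V\<in>\<V>'. dist (q V) (p V) < e/3"
    and q_indep: "\<forall>F\<subseteq>\<V>'. card F \<le> DIM('e) \<longrightarrow>
      (\<forall>c. (\<Sum>V\<in>F. c V *\<^sub>R q V) = 0 \<longrightarrow> (\<forall>V\<in>F. c V = 0))"
    by blast
  define h' where "h' x = (\<Sum>V\<in>\<V>'. f V x *\<^sub>R q V)" for x
  have "continuous_map X euclidean h'"
    using f(3) unfolding h'_def continuous_map_iff_tendsto by (auto intro!: tendsto_intros)
  moreover have "h' x \<noteq> 0" if x: "x \<in> topspace X" for x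
  proof
    assume "h' x = 0"
    define F where "F = {V \<in> \<V>'. f V x \<noteq> 0}"
    have "F \<subseteq> {V\<in>\<V>. x \<in> V}" using f(2,5) x by (auto simp: F_def)
    then have "card F \<le> DIM('e)"
      using mult[OF x] card_mono[of "{V\<in>\<V>. x \<in> V}" F] \<V>(1) by simp
    moreover have "(\<Sum>V\<in>F. f V x *\<^sub>R q V) = h' x"
      unfolding h'_def F_def using f(1) by (intro sum.mono_neutral_left) auto
    ultimately have "f V x = 0" if "V \<in> F" for V
      using q_indep[rule_format, of F "\<lambda>V. f V x" V] that \<open>h' x = 0\<close> by (auto simp: F_def)
    then have "f V x = 0" if "V \<in> \<V>'" for V using that by (auto simp: F_def)
    then show False using f(6)[OF x] by simp
  qed
  moreover have "dist (h' x) (h x) < e" if x: "x \<in> topspace X" for x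
  proof -
    have "norm (f V x *\<^sub>R (q V - h x)) \<le> f V x * (2*e/3)" if "V \<in> \<V>'" for V
    proof (cases "x \<in> V")
      case True
      then have "dist (p V) (h x) < e/3" using p[of V] that f(2) by (auto simp: U_def)
      then have "norm (q V - h x) \<le> 2*e/3"
        using bspec[OF q that] dist_triangle[of "q V" "h x" "p V"] by (simp add: dist_norm)
      then have "f V x * norm (q V - h x) \<le> f V x * (2*e/3)"
        using f(4)[OF x] by (rule mult_left_mono)
      then show ?thesis using f(4)[OF x, of V] by simp
    qed (use f(5) x in auto)
    then have "norm (\<Sum>V\<in>\<V>'. f V x *\<^sub>R (q V - h x)) \<le> (\<Sum>V\<in>\<V>'. f V x * (2*e/3))"
      by (intro sum_norm_le) auto
    also have "\<dots> = 2*e/3" unfolding sum_distrib_right[symmetric] f(6)[OF x] by simp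
    also have "(\<Sum>V\<in>\<V>'. f V x *\<^sub>R (q V - h x)) = h' x - h x"
      unfolding h'_def scaleR_diff_right sum_subtractf scaleR_left.sum[symmetric] f(6)[OF x] by simp
    finally show ?thesis using e by (simp add: dist_norm)
  qed
  ultimately show ?thesis by blast
qed

section \<open>Circle-valued cocycles\<close>

lemma nerve_simplices_map:
  assumes "refinement_map \<W> \<U> r" "\<sigma> \<in> nerve_simplices \<W> k"
  shows "map r \<sigma> \<in> nerve_simplices \<U> k"
proof -
  have "\<Inter>(set \<sigma>) \<subseteq> \<Inter>(set (map r \<sigma>))"
    using assms unfolding refinement_map_def nerve_simplices_def by fastforce
  then show ?thesis using assms unfolding refinement_map_def nerve_simplices_def by auto
qed

lemma nerve_simplices_face:
  assumes "\<sigma> \<in> nerve_simplices \<U> (Suc k)" "i \<le> Suc k"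
  shows "take i \<sigma> @ drop (Suc i) \<sigma> \<in> nerve_simplices \<U> k"
proof -
  have "set (take i \<sigma> @ drop (Suc i) \<sigma>) \<subseteq> set \<sigma>"
    using set_take_subset set_drop_subset by fastforce
  moreover from this have "\<Inter>(set \<sigma>) \<subseteq> \<Inter>(set (take i \<sigma> @ drop (Suc i) \<sigma>))" by blast
  ultimately show ?thesis using assms unfolding nerve_simplices_def by auto
qed

lemma coboundary_zero: "coboundary \<U> k (zero_cochain \<U> k) = zero_cochain \<U> (k + 1)"
  unfolding coboundary_def zero_cochain_def
  by (intro restrict_ext sum.neutral) (auto simp: nerve_simplices_face)

text \<open>Unpacks the vanishing of the second cohomology: every integral 2-cocycle becomes the
  coboundary of a 1-cochain \<open>e\<close> after a refinement of its cover.\<close>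

lemma cech_trivial_cocycle:
  assumes H: "cech_cohomology 2 X = {cech_zero 2 X}" and "open_cover X \<U>" "c \<in> cocycles \<U> 2"
  obtains \<W> r e where "open_cover X \<W>" "refinement_map \<W> \<U> r"
    "\<And>\<sigma>. \<sigma> \<in> nerve_simplices \<W> 2 \<Longrightarrow> c (map r \<sigma>) = coboundary \<W> 1 e \<sigma>"
proof -
  define z where "z = ({topspace X}, zero_cochain {topspace X} 2)"
  have z: "z \<in> cech_cocycles 2 X"
    by (auto simp: z_def cech_cocycles_def open_cover_def cocycles_def cochains_def coboundary_zero)
      (simp add: zero_cochain_def)
  \<comment> \<open>The images of \<open>(\<U>, c)\<close> and of \<open>z\<close> under the
    relation coincide by the hypothesis, so once \<open>z\<close> is related to itself,
    \<open>(\<U>, c)\<close> is related to \<open>z\<close>.\<close>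
  have "(z, z) \<in> cech_equiv 2 X"
    unfolding cech_equiv_def
  proof (safe intro!: case_prodI2 exI[of _ "{topspace X}"] exI[of _ id])
    have "(\<lambda>\<sigma>\<in>nerve_simplices {topspace X} 2. (0::int))
      = coboundary {topspace X} 1 (zero_cochain {topspace X} 1)"
      using coboundary_zero[of "{topspace X}" 1] by (simp add: zero_cochain_def numeral_2_eq_2)
    moreover have "zero_cochain {topspace X} 1 \<in> cochains {topspace X} 1"
      by (simp add: zero_cochain_def cochains_def)
    ultimately show "(\<lambda>\<sigma>\<in>nerve_simplices {topspace X} 2. c (map id \<sigma>) - c (map id \<sigma>)) \<in>
      coboundaries {topspace X} 2" for c
      by (auto simp: coboundaries_def)
  qed (use z in \<open>auto simp: refinement_map_def z_def open_cover_def\<close>)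
  moreover have "cech_equiv 2 X `` {(\<U>, c)} = cech_equiv 2 X `` {z}"
  proof -
    have "cech_equiv 2 X `` {(\<U>, c)} \<in> cech_cohomology 2 X"
      unfolding cech_cohomology_def using assms by (intro quotientI) (simp add: cech_cocycles_def)
    then show ?thesis by (simp add: H cech_zero_def z_def)
  qed
  ultimately have "((\<U>, c), z) \<in> cech_equiv 2 X" by blast
  then obtain \<W> r s where W: "open_cover X \<W>" "refinement_map \<W> \<U> r"
    "refinement_map \<W> {topspace X} s"
    and cob: "(\<lambda>\<sigma>\<in>nerve_simplices \<W> 2. c (map r \<sigma>) - zero_cochain {topspace X} 2 (map s \<sigma>)) \<in>
      coboundaries \<W> 2"
    by (auto simp: cech_equiv_def z_def)
  from cob obtain e where e:
    "(\<lambda>\<sigma>\<in>nerve_simplices \<W> 2. c (map r \<sigma>) - zero_cochain {topspace X} 2 (map s \<sigma>))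
      = coboundary \<W> 1 e"
    unfolding coboundaries_def by auto
  show ?thesis
  proof (rule that[OF W(1,2)])
    fix \<sigma> assume \<sigma>: "\<sigma> \<in> nerve_simplices \<W> 2"
    then have "zero_cochain {topspace X} 2 (map s \<sigma>) = 0"
      using nerve_simplices_map[OF W(3)] by (simp add: zero_cochain_def)
    then show "c (map r \<sigma>) = coboundary \<W> 1 e \<sigma>"
      using fun_cong[OF e, of \<sigma>] \<sigma> by simp
  qed
qed

lemma nerve_simplices_2_iff:
  "[U, V, W] \<in> nerve_simplices \<U> 2 \<longleftrightarrow> U \<in> \<U> \<and> V \<in> \<U> \<and> W \<in> \<U> \<and> U \<inter> V \<inter> W \<noteq> {}"
  by (auto simp: nerve_simplices_def)

lemma coboundary_1:
  "[U, V, W] \<in> nerve_simplices \<U> 2 \<Longrightarrow> coboundary \<U> 1 e [U, V, W] = e [V, W] - e [U, W] + e [U, V]"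
  by (simp add: coboundary_def numeral_2_eq_2 atMost_Suc)

text \<open>A point of the circle at distance less than 1 from 1 has real part above
  \<open>1/2\<close>, which is \<open>cos (pi / 3)\<close>. This keeps it away from the branch cut,
  so \<open>Arg\<close> is continuous there.\<close>

lemma abs_Arg_less:
  assumes "cmod \<zeta> = 1" "cmod (\<zeta> - 1) < 1"
  shows "\<bar>Arg \<zeta>\<bar> < pi / 3" "\<zeta> \<notin> \<real>\<^sub>\<le>\<^sub>0"
proof -
  have "(cmod (\<zeta> - 1))\<^sup>2 < 1"
    using assms(2) by (simp add: power_less_one_iff)
  moreover have "(cmod (\<zeta> - 1))\<^sup>2 = (cmod \<zeta>)\<^sup>2 - 2 * Re \<zeta> + 1"
    unfolding cmod_power2 by (simp add: power2_eq_square algebra_simps)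
  ultimately have Re: "Re \<zeta> > 1/2" using assms(1) by simp
  then show "\<zeta> \<notin> \<real>\<^sub>\<le>\<^sub>0" by (auto simp: complex_nonpos_Reals_iff)
  have "\<zeta> \<noteq> 0" using assms(1) by auto
  then have "cis (Arg \<zeta>) = \<zeta>" using assms(1) by (simp add: cis_Arg sgn_div_norm)
  then have "Re \<zeta> = cos \<bar>Arg \<zeta>\<bar>" by (metis cis.sel(1) cos_abs_real)
  then have "cos (pi / 3) < cos \<bar>Arg \<zeta>\<bar>" using Re by (simp add: cos_60)
  moreover have "\<bar>Arg \<zeta>\<bar> \<le> pi" using Arg_bounded[of \<zeta>] by auto
  ultimately show "\<bar>Arg \<zeta>\<bar> < pi / 3"
    by (metis abs_ge_zero cos_monotone_0_pi_le linorder_not_le pi_ge_zero divide_nonneg_nonneg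
      zero_le_numeral)
qed

lemma cis_2pi_int: "cis (2 * pi * t) = 1 \<Longrightarrow> t \<in> \<int>"
proof -
  assume "cis (2 * pi * t) = 1"
  then have "cos (2 * pi * t) = 1" by (simp add: complex_eq_iff)
  then obtain n :: int where "2 * pi * t = real_of_int n * 2 * pi"
    using cos_one_2pi_int by blast
  then have "t = real_of_int n" by simp
  then show "t \<in> \<int>" by simp
qed

text \<open>
  The small oscillation of the transition functions gives them continuous logarithms on the
  overlaps, even though these need not be connected, and makes the resulting integral 2-cochain a
  constant on each triple overlap.
\<close>

lemma circle_cocycle_trivial:
  fixes g :: "'a set \<Rightarrow> 'a set \<Rightarrow> 'a \<Rightarrow> complex"
  assumes X: "compact_space X" "Hausdorff_space X" and H: "cech_cohomology 2 X = {cech_zero 2 X}"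
    and cover: "open_cover X \<U>"
    and norm: "\<And>U V x. U \<in> \<U> \<Longrightarrow> V \<in> \<U> \<Longrightarrow> x \<in> U \<inter> V \<Longrightarrow> cmod (g U V x) = 1"
    and cont: "\<And>U V x. U \<in> \<U> \<Longrightarrow> V \<in> \<U> \<Longrightarrow> x \<in> U \<inter> V \<Longrightarrow> (g U V \<longlongrightarrow> g U V x) (atin X x)"
    and coc: "\<And>U V W x. U \<in> \<U> \<Longrightarrow> V \<in> \<U> \<Longrightarrow> W \<in> \<U> \<Longrightarrow> x \<in> U \<inter> V \<inter> W \<Longrightarrow> g U V x * g V W x = g U W x"
    and osc: "\<And>U V x y. U \<in> \<U> \<Longrightarrow> V \<in> \<U> \<Longrightarrow> x \<in> U \<inter> V \<Longrightarrow> y \<in> U \<inter> V \<Longrightarrow> cmod (g U V x - g U V y) < 1"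
  obtains \<W> r \<phi> where "open_cover X \<W>" "refinement_map \<W> \<U> r"
    "\<And>W x. W \<in> \<W> \<Longrightarrow> x \<in> W \<Longrightarrow> cmod (\<phi> W x) = 1"
    "\<And>W x. W \<in> \<W> \<Longrightarrow> x \<in> W \<Longrightarrow> (\<phi> W \<longlongrightarrow> \<phi> W x) (atin X x)"
    "\<And>W V x. W \<in> \<W> \<Longrightarrow> V \<in> \<W> \<Longrightarrow> x \<in> W \<inter> V \<Longrightarrow> g (r W) (r V) x = \<phi> W x / \<phi> V x"
proof -
  define b where "b U V = (SOME y. y \<in> U \<inter> V)" for U V :: "'a set"
  have b: "b U V \<in> U \<inter> V" if "x \<in> U \<inter> V" for U V x
    unfolding b_def using that by (rule someI)
  \<comment> \<open>A logarithm of \<open>g U V\<close> divided by \<open>2 pi\<close>: a fixed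
    argument at the base point of the overlap plus the argument of the quotient by the value there,
    which is close to 1.\<close>
  define h where "h U V x = (Arg (g U V (b U V))
    + Arg (g U V x / g U V (b U V))) / (2 * pi)" for U V x
  have \<zeta>: "cmod (g U V x / g U V (b U V)) = 1" "cmod (g U V x / g U V (b U V) - 1) < 1"
    if UV: "U \<in> \<U>" "V \<in> \<U>" "x \<in> U \<inter> V" for U V x
  proof -
    have nb: "cmod (g U V (b U V)) = 1" using norm[OF UV(1,2) b[OF UV(3)]] .
    then have "g U V (b U V) \<noteq> 0" by auto
    show "cmod (g U V x / g U V (b U V)) = 1" using nb norm[OF UV] by (simp add: norm_divide)
    have "g U V x / g U V (b U V) - 1 = (g U V x - g U V (b U V)) / g U V (b U V)"
      using \<open>g U V (b U V) \<noteq> 0\<close> by (simp add: field_simps)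
    then show "cmod (g U V x / g U V (b U V) - 1) < 1"
      using osc[OF UV b[OF UV(3)]] nb by (simp add: norm_divide)
  qed
  have cis_h: "cis (2 * pi * h U V x) = g U V x" if UV: "U \<in> \<U>" "V \<in> \<U>" "x \<in> U \<inter> V" for U V x
  proof -
    have nb: "cmod (g U V (b U V)) = 1" using norm[OF UV(1,2) b[OF UV(3)]] .
    have cA: "cis (Arg z) = z" if "cmod z = 1" for z
    proof -
      have "z \<noteq> 0" using that by auto
      then show ?thesis using that by (simp add: cis_Arg sgn_div_norm)
    qed
    have "cis (2 * pi * h U V x) = cis (Arg (g U V (b U V))) * cis (Arg (g U V x / g U V (b U V)))"
      by (simp add: h_def cis_mult)
    also have "\<dots> = g U V x" using nb \<zeta>(1)[OF UV] by (simp add: cA) auto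
    finally show ?thesis .
  qed
  have h_cont: "(h U V \<longlongrightarrow> h U V x) (atin X x)" if UV: "U \<in> \<U>" "V \<in> \<U>" "x \<in> U \<inter> V" for U V x
  proof -
    have nb: "g U V (b U V) \<noteq> 0" using norm[OF UV(1,2) b[OF UV(3)]] by auto
    have "((\<lambda>y. Arg (g U V y / g U V (b U V))) \<longlongrightarrow> Arg (g U V x / g U V (b U V))) (atin X x)"
      using nb by (intro isCont_tendsto_compose[OF continuous_at_Arg] abs_Arg_less(2) \<zeta> UV
          tendsto_divide cont tendsto_const)
    then show ?thesis unfolding h_def
      by (intro tendsto_divide tendsto_add tendsto_const) simp_all
  qed
  \<comment> \<open>The bound 1/3 is chosen for \<open>t_const\<close>: the cochain \<open>t\<close>
    has three such terms, so it varies by less than 1 on a triple overlap.\<close>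
  have h_osc: "\<bar>h U V x - h U V y\<bar> < 1/3"
    if UV: "U \<in> \<U>" "V \<in> \<U>" "x \<in> U \<inter> V" "y \<in> U \<inter> V" for U V x y
  proof -
    have "\<bar>h U V x - h U V y\<bar> = \<bar>Arg (g U V x / g U V (b U V)) - Arg (g U V y / g U V (b U V))\<bar> /
      (2 * pi)"
      by (simp add: h_def abs_divide flip: diff_divide_distrib)
    also have "\<dots> < (pi / 3 + pi / 3) / (2 * pi)"
      using abs_Arg_less(1)[OF \<zeta>[OF UV(1-3)]] abs_Arg_less(1)[OF \<zeta>[OF UV(1,2,4)]]
      by (intro divide_strict_right_mono order_le_less_trans[OF abs_triangle_ineq4]
        add_strict_mono) auto
    finally show ?thesis by simp
  qed
  have h_bound: "\<bar>h U V x\<bar> \<le> 1" if UV: "U \<in> \<U>" "V \<in> \<U>" "x \<in> U \<inter> V" for U V x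
    using Arg_bounded[of "g U V (b U V)"] Arg_bounded[of "g U V x / g U V (b U V)"] pi_gt_zero
    by (auto simp: h_def abs_le_iff field_simps)
  \<comment> \<open>The defect of additivity of the logarithms. As \<open>g\<close> is
    multiplicative, it is an integer: the Bockstein image of the cocycle \<open>g\<close>.\<close>
  define t where "t U V W x = h V W x - h U W x + h U V x" for U V W x
  have t_int: "t U V W x \<in> \<int>" if "U \<in> \<U>" "V \<in> \<U>" "W \<in> \<U>" "x \<in> U \<inter> V \<inter> W" for U V W x
  proof (rule cis_2pi_int)
    have "cis (2 * pi * t U V W x) = cis (2 * pi * h V W x) / cis (2 * pi * h U W x) * cis (2 * pi
      * h U V x)"
      by (simp add: t_def cis_mult cis_divide algebra_simps)
    also have "\<dots> = g V W x / g U W x * g U V x"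
      using that by (simp add: cis_h)
    also have "\<dots> = 1"
      using coc[OF that] norm[of U W x] that by (simp add: mult.commute) auto
    finally show "cis (2 * pi * t U V W x) = 1" .
  qed
  have t_const: "t U V W x = t U V W y"
    if U: "U \<in> \<U>" "V \<in> \<U>" "W \<in> \<U>" "x \<in> U \<inter> V \<inter> W" "y \<in> U \<inter> V \<inter> W" for U V W x y
  proof -
    have "t U V W x - t U V W y \<in> \<int>" using t_int U by (intro Ints_diff) auto
    moreover have "\<bar>t U V W x - t U V W y\<bar> < 1"
    proof -
      have "\<bar>h V W x - h V W y\<bar> < 1/3" "\<bar>h U W x - h U W y\<bar> < 1/3" "\<bar>h U V x - h U V y\<bar> < 1/3"
        by (rule h_osc; use U in blast)+
      then show ?thesis unfolding t_def by linarith
    qed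
    ultimately have "t U V W x - t U V W y = 0" by (rule Ints_nonzero_abs_less1)
    then show ?thesis by simp
  qed
  \<comment> \<open>The value may be read off at an arbitrary common point since \<open>t\<close> is
    constant on a triple overlap. The floor only converts the type.\<close>
  define c where "c = (\<lambda>\<sigma>\<in>nerve_simplices \<U> 2. \<lfloor>t (\<sigma>!0) (\<sigma>!1) (\<sigma>!2) (SOME y. y \<in> \<Inter>(set \<sigma>))\<rfloor>)"
  have c: "real_of_int (c [U, V, W]) = t U V W x"
    if U: "U \<in> \<U>" "V \<in> \<U>" "W \<in> \<U>" "x \<in> U \<inter> V \<inter> W" for U V W x
  proof -
    define y where "y = (SOME y. y \<in> \<Inter>(set [U, V, W]))"
    have y: "y \<in> U \<inter> V \<inter> W"
      using someI[of "\<lambda>y. y \<in> \<Inter>(set [U, V, W])" x] U(4) unfolding y_def by simp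
    have "[U, V, W] \<in> nerve_simplices \<U> 2" using U by (auto simp: nerve_simplices_2_iff)
    then have "c [U, V, W] = \<lfloor>t U V W y\<rfloor>" by (simp add: c_def y_def)
    then show ?thesis using t_const[OF U(1-3) y U(4)] t_int[OF U(1-3) y]
      by (metis Ints_cases floor_of_int)
  qed
  have "c \<in> cocycles \<U> 2"
    unfolding cocycles_def
  proof (safe, goal_cases)
    case 1
    show ?case by (simp add: cochains_def c_def)
  next
    case 2
    show ?case
      unfolding coboundary_def zero_cochain_def
    proof (rule restrict_ext)
      fix \<sigma> assume \<sigma>: "\<sigma> \<in> nerve_simplices \<U> (2 + 1)"
      then have "length \<sigma> = 4" by (simp add: nerve_simplices_def)
      then obtain U V W Z where UVWZ: "\<sigma> = [U, V, W, Z]"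
        by (auto simp: numeral_eq_Suc length_Suc_conv)
      then obtain x where x: "x \<in> U" "x \<in> V" "x \<in> W" "x \<in> Z" and
        U: "U \<in> \<U>" "V \<in> \<U>" "W \<in> \<U>" "Z \<in> \<U>"
        using \<sigma> by (auto simp: nerve_simplices_def)
      have "real_of_int (c [V, W, Z] - c [U, W, Z] + c [U, V, Z] - c [U, V, W]) = 0"
        using c[of V W Z x] c[of U W Z x] c[of U V Z x] c[of U V W x] x U by (simp add: t_def)
      then have "c [V, W, Z] - c [U, W, Z] + c [U, V, Z] - c [U, V, W] = 0"
        by (simp only: of_int_eq_0_iff)
      then show "(\<Sum>i\<le>2 + 1. (- 1) ^ i * c (take i \<sigma> @ drop (Suc i) \<sigma>)) = 0"
        by (simp add: UVWZ eval_nat_numeral atMost_Suc)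
    qed
  qed
  from cech_trivial_cocycle[OF H cover this] obtain \<W> r e
    where W: "open_cover X \<W>" "refinement_map \<W> \<U> r"
      and e: "\<And>\<sigma>. \<sigma> \<in> nerve_simplices \<W> 2 \<Longrightarrow> c (map r \<sigma>) = coboundary \<W> 1 e \<sigma>"
    by blast
  have r: "r W \<in> \<U>" "x \<in> W \<Longrightarrow> x \<in> r W" if "W \<in> \<W>" for W x
    using W(2) that unfolding refinement_map_def by auto
  have opW: "openin X W" if "W \<in> \<W>" for W using W(1) that unfolding open_cover_def by blast
  \<comment> \<open>Subtracting the integers \<open>e\<close> leaves the exponential unchanged and
    makes the logarithms exactly additive.\<close>
  define h' where "h' W V x = h (r W) (r V) x - real_of_int (e [W, V])" for W V x
  have h': "h' W W' x - h' V W' x = h' W V x"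
    if WV: "W \<in> \<W>" "V \<in> \<W>" "W' \<in> \<W>" "x \<in> W" "x \<in> V" "x \<in> W'" for W V W' x
  proof -
    have \<sigma>: "[W, V, W'] \<in> nerve_simplices \<W> 2" using WV by (auto simp: nerve_simplices_2_iff)
    have "t (r W) (r V) (r W') x = real_of_int (e [V, W'] - e [W, W'] + e [W, V])"
      using c[of "r W" "r V" "r W'" x] e[OF \<sigma>] coboundary_1[OF \<sigma>, of e] r WV by simp
    then show ?thesis by (simp add: t_def h'_def)
  qed
  obtain \<W>' f where f: "finite \<W>'" "\<W>' \<subseteq> \<W>" "\<And>V. continuous_map X euclideanreal (f V)"
      "\<And>V x. x \<in> topspace X \<Longrightarrow> 0 \<le> f V x"
      "\<And>V x. x \<in> topspace X \<Longrightarrow> x \<notin> V \<Longrightarrow> f V x = 0"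
      "\<And>x. x \<in> topspace X \<Longrightarrow> (\<Sum>V\<in>\<W>'. f V x) = 1"
    using partition_of_unity[OF X W(1)] by metis
  \<comment> \<open>The usual splitting of an additive real cocycle by a partition of unity:
    averaging \<open>h' W V\<close> over the second index writes it as a difference
    \<open>k W - k V\<close>.\<close>
  define k where "k W x = (\<Sum>V\<in>\<W>'. f V x *\<^sub>R h' W V x)" for W x
  have k_cont: "(k W \<longlongrightarrow> k W x) (atin X x)" if Wx: "W \<in> \<W>" "x \<in> W" for W x
    unfolding k_def
  proof (intro tendsto_sum tendsto_cutoff_scaleR[where W = "V" for V])
    fix V assume "V \<in> \<W>'"
    then have V: "V \<in> \<W>" using f(2) by blast
    show "openin X W" "x \<in> W" using Wx opW by auto
    show "continuous_map X euclideanreal (f V)" by (rule f)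
    show "f V y = 0" if "y \<in> topspace X" "y \<notin> V" for y using f(5) that .
    show "(h' W V \<longlongrightarrow> h' W V x) (atin X x)" if "x \<in> V"
      unfolding h'_def using that V Wx r by (intro tendsto_intros h_cont) auto
    \<comment> \<open>This bound holds up to the boundary of \<open>V\<close>, where
      \<open>h' W V\<close> may fail to have a limit while the weight \<open>f V\<close> tends to
      0.\<close>
    show "norm (h' W V y) \<le> 1 + \<bar>real_of_int (e [W, V])\<bar>" if "y \<in> W" "y \<in> V" for y
      using h_bound[of "r W" "r V" y] that V Wx r unfolding h'_def by auto
  qed
  have k_diff: "k W x - k V x = h' W V x" if WV: "W \<in> \<W>" "V \<in> \<W>" "x \<in> W" "x \<in> V" for W V x
  proof -
    have x: "x \<in> topspace X" using opW WV openin_subset by blast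
    have "k W x - k V x = (\<Sum>W'\<in>\<W>'. f W' x *\<^sub>R (h' W W' x - h' V W' x))"
      by (simp add: k_def sum_subtractf right_diff_distrib)
    also have "\<dots> = (\<Sum>W'\<in>\<W>'. f W' x *\<^sub>R h' W V x)"
    proof (rule sum.cong[OF refl])
      fix W' assume "W' \<in> \<W>'"
      then show "f W' x *\<^sub>R (h' W W' x - h' V W' x) = f W' x *\<^sub>R h' W V x"
        using h'[OF WV(1,2) _ WV(3,4), of W'] f(2) f(5)[OF x, of W'] by (cases "x \<in> W'") auto
    qed
    also have "\<dots> = h' W V x"
      unfolding scaleR_left.sum[symmetric] f(6)[OF x] by simp
    finally show ?thesis .
  qed
  show ?thesis
  proof (rule that[OF W, of "\<lambda>W x. cis (2 * pi * k W x)"])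
    show "cmod (cis (2 * pi * k W x)) = 1" for W x by simp
    show "((\<lambda>x. cis (2 * pi * k W x)) \<longlongrightarrow> cis (2 * pi * k W x)) (atin X x)"
      if "W \<in> \<W>" "x \<in> W" for W x
      unfolding cis_conv_exp using k_cont[OF that] by (intro tendsto_intros)
    show "g (r W) (r V) x = cis (2 * pi * k W x) / cis (2 * pi * k V x)"
      if WV: "W \<in> \<W>" "V \<in> \<W>" "x \<in> W \<inter> V" for W V x
    proof -
      have "cis (2 * pi * k W x) / cis (2 * pi * k V x) = cis (2 * pi * h' W V x)"
        using k_diff[of W V x] WV by (simp add: cis_divide flip: right_diff_distrib)
      also have "\<dots> = cis (2 * pi * h (r W) (r V) x) / cis (2 * pi * real_of_int (e [W, V]))"
        by (simp only: h'_def cis_divide right_diff_distrib)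
      also have "cis (2 * pi * real_of_int (e [W, V])) = 1" by (simp add: cis_multiple_2pi)
      also have "cis (2 * pi * h (r W) (r V) x) = g (r W) (r V) x"
        using WV r by (intro cis_h) auto
      finally show ?thesis by simp
    qed
  qed
qed

section \<open>Trivial line bundles\<close>

definition rank_one :: "complex^'n \<Rightarrow> complex^'n^'n" where
  "rank_one v = (\<chi> i j. v $ i * cnj (v $ j))"

lemma rank_one_mult_vector: "rank_one v *v w = cdot w v *s v"
  by (simp add: rank_one_def matrix_vector_mult_def cdot_def vec_eq_iff sum_distrib_left mult_ac)

lemma tendsto_rank_one [tendsto_intros]:
  "(f \<longlongrightarrow> v) F \<Longrightarrow> ((\<lambda>x. rank_one (f x)) \<longlongrightarrow> rank_one v) F"
  unfolding rank_one_def by (intro vec_tendstoI) (auto intro!: tendsto_intros)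

lemma rank_one_smult: "rank_one (c *s v) = ((cmod c)\<^sup>2) *\<^sub>R rank_one v"
proof -
  have "c * cnj c = complex_of_real ((cmod c)\<^sup>2)" by (rule complex_norm_square[symmetric])
  then have "c * x * (cnj c * y) = (cmod c)\<^sup>2 *\<^sub>R (x * y)" for x y
    by (simp add: scaleR_conv_of_real mult_ac)
  then show ?thesis by (simp add: rank_one_def vec_eq_iff)
qed

lemma rank_one_eq_imp_smult:
  assumes "rank_one v = rank_one w" "norm v = 1"
  shows "v = cdot v w *s w"
proof -
  have "v = rank_one v *v v" by (simp add: rank_one_mult_vector cdot_self assms(2))
  then show ?thesis by (metis assms(1) rank_one_mult_vector)
qed

text \<open>The projection of a fixed vector \<open>w\<close>, normalized, is a section where it is
  not too small. Two local sections differ by a circle-valued function, and these functions form a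
  cocycle. Writing the cocycle as a quotient of phases allows correcting the sections so that they
  agree.\<close>

lemma line_bundle_section:
  fixes P :: "'a \<Rightarrow> complex^'n^'n"
  assumes X: "compact_space X" "Hausdorff_space X" and H: "cech_cohomology 2 X = {cech_zero 2 X}"
    and P: "continuous_map X euclidean P"
    and rank: "\<And>x. x \<in> topspace X \<Longrightarrow> \<exists>v. norm v = 1 \<and> P x = rank_one v"
  obtains v where "continuous_map X euclidean v"
    "\<And>x. x \<in> topspace X \<Longrightarrow> norm (v x) = 1" "\<And>x. x \<in> topspace X \<Longrightarrow> P x = rank_one (v x)"
proof -
  define Q where "Q w x = inner (P x *v w) w" for w x
  define s where "s w x = (1 / sqrt (Q w x)) *\<^sub>R (P x *v w)" for w x
  \<comment> \<open>With \<open>Q w x > 63/64\<close> also the overlap \<open>cmod c\<close> exceeds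
    63/64, so the squared distance \<open>2 - 2 * cmod c\<close> of the section to \<open>w\<close>
    is below 1/32. Hence a section oscillates by less than 1/2 and a transition function by less
    than 1, as \<open>circle_cocycle_trivial\<close> demands.\<close>
  define U where "U w = {x \<in> topspace X. Q w x \<in> {63/64<..}}" for w
  have P_lim: "(P \<longlongrightarrow> P x) (atin X x)" if "x \<in> topspace X" for x
    using P that unfolding continuous_map_iff_tendsto by blast
  have "continuous_map X euclideanreal (Q w)" for w
    unfolding continuous_map_iff_tendsto Q_def using P_lim by (auto intro!: tendsto_intros)
  then have opU: "openin X (U w)" for w
    unfolding U_def by (rule openin_continuous_map_preimage) simp
  have s: "norm (s w x) = 1" "rank_one (s w x) = P x" "norm (s w x - w) \<le> sqrt (1/32)"
    if w: "norm w = 1" and x: "x \<in> U w" for w x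
  proof -
    from x rank obtain v where v: "norm v = 1" "P x = rank_one v" by (auto simp: U_def)
    define c where "c = cdot w v"
    have Pw: "P x *v w = c *s v" by (simp add: v rank_one_mult_vector c_def)
    have "Q w x = Re (c * cdot v w)" unfolding Q_def Pw by (simp flip: Re_cdot)
    also have "c * cdot v w = complex_of_real ((cmod c)\<^sup>2)"
      unfolding c_def complex_norm_square cdot_commute ..
    finally have Q: "Q w x = (cmod c)\<^sup>2" by simp
    have c_le: "cmod c \<le> 1" using cmod_cdot_le[of w v] v w by (simp add: c_def)
    have c_gt: "(cmod c)\<^sup>2 > 63/64" using x Q by (simp add: U_def)
    then have c0: "cmod c > 0" by (cases "c = 0") auto
    have s_eq: "s w x = (c / cmod c) *s v"
      unfolding s_def Q Pw by (simp add: scaleR_eq_smult vector_smult_assoc)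
    show "norm (s w x) = 1" using c0 v by (simp add: s_eq norm_smult norm_divide)
    show "rank_one (s w x) = P x" using c0 v by (simp add: s_eq rank_one_smult norm_divide)
    have "inner (s w x) w = Re ((c / cmod c) * cdot v w)"
      by (simp add: s_eq flip: Re_cdot)
    also have "(c / cmod c) * cdot v w = complex_of_real (cmod c)"
      using \<open>c * cdot v w = complex_of_real ((cmod c)\<^sup>2)\<close> c0 by (simp add: power2_eq_square)
    finally have "inner (s w x) w = cmod c" by simp
    moreover have "cmod c > 63/64"
    proof -
      have "(cmod c)\<^sup>2 \<le> cmod c" using c_le c0 by (simp add: power2_eq_square mult_left_le)
      then show ?thesis using c_gt by simp
    qed
    ultimately have "(norm (s w x - w))\<^sup>2 \<le> 1/32"
      using \<open>norm (s w x) = 1\<close> w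
      by (simp add: power2_norm_eq_inner inner_diff_left inner_diff_right inner_commute
          norm_eq_1)
    then show "norm (s w x - w) \<le> sqrt (1/32)" by (rule real_le_rsqrt)
  qed
  have s_lim: "(s w \<longlongrightarrow> s w x) (atin X x)" if "x \<in> U w" for w x
  proof -
    have x: "x \<in> topspace X" and "Q w x > 0" using that by (auto simp: U_def)
    then have "sqrt (inner (P x *v w) w) \<noteq> 0" by (simp add: Q_def)
    then show ?thesis unfolding s_def Q_def using P_lim[OF x] by (intro tendsto_intros)
  qed
  define \<U> where "\<U> = U ` {w. norm w = 1}"
  have "open_cover X \<U>"
    unfolding open_cover_def
  proof (intro conjI ballI)
    show "\<Union>\<U> = topspace X"
    proof
      show "\<Union>\<U> \<subseteq> topspace X" by (auto simp: \<U>_def U_def)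
      show "topspace X \<subseteq> \<Union>\<U>"
      proof
        fix x assume x: "x \<in> topspace X"
        then obtain v where v: "norm v = 1" "P x = rank_one v" using rank by blast
        have "Q v x = 1" by (simp add: Q_def v rank_one_mult_vector cdot_self norm_eq_1[THEN iffD1])
        then have "x \<in> U v" using x by (simp add: U_def)
        then show "x \<in> \<Union>\<U>" using v by (auto simp: \<U>_def)
      qed
    qed
  qed (auto simp: \<U>_def opU)
  \<comment> \<open>The cover is a family of sets, and different vectors may give the same set; one
    vector is fixed for each.\<close>
  define \<omega> where "\<omega> V = (SOME w. norm w = 1 \<and> U w = V)" for V
  have \<omega>: "norm (\<omega> V) = 1" "U (\<omega> V) = V" if "V \<in> \<U>" for V
    using someI_ex[of "\<lambda>w. norm w = 1 \<and> U w = V"] that by (auto simp: \<U>_def \<omega>_def)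
  define \<sigma> where "\<sigma> V = s (\<omega> V)" for V
  have \<sigma>: "norm (\<sigma> V x) = 1" "rank_one (\<sigma> V x) = P x" "(\<sigma> V \<longlongrightarrow> \<sigma> V x) (atin X x)"
      "norm (\<sigma> V x - \<omega> V) \<le> sqrt (1/32)"
    if "V \<in> \<U>" "x \<in> V" for V x
    using s[of "\<omega> V" x] s_lim[of x "\<omega> V"] \<omega>[OF that(1)] that(2) by (simp_all add: \<sigma>_def)
  define g where "g V W x = cdot (\<sigma> V x) (\<sigma> W x)" for V W x
  have g: "\<sigma> V x = g V W x *s \<sigma> W x" if "V \<in> \<U>" "W \<in> \<U>" "x \<in> V \<inter> W" for V W x
    unfolding g_def using \<sigma>(1,2)[of V x] \<sigma>(2)[of W x] that by (intro rank_one_eq_imp_smult) auto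
  have g_norm: "cmod (g V W x) = 1" if VW: "V \<in> \<U>" "W \<in> \<U>" "x \<in> V \<inter> W" for V W x
    using arg_cong[OF g[OF VW], of norm] \<sigma>(1)[of V x] \<sigma>(1)[of W x] VW by (simp add: norm_smult)
  have g_cont: "(g V W \<longlongrightarrow> g V W x) (atin X x)" if VW: "V \<in> \<U>" "W \<in> \<U>" "x \<in> V \<inter> W" for V W x
    unfolding g_def using VW by (intro tendsto_intros \<sigma>) auto
  have g_coc: "g T V x * g V W x = g T W x"
    if T: "T \<in> \<U>" "V \<in> \<U>" "W \<in> \<U>" "x \<in> T \<inter> V \<inter> W" for T V W x
    using arg_cong[OF g[of T V x], of "\<lambda>u. cdot u (\<sigma> W x)"] T by (simp add: g_def)
  have \<sigma>_osc: "norm (\<sigma> T x - \<sigma> T y) < 1/2" if T: "T \<in> \<U>" "x \<in> T" "y \<in> T" for T x y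
  proof -
    have "norm (\<sigma> T x - \<sigma> T y) \<le> norm (\<sigma> T x - \<omega> T) + norm (\<sigma> T y - \<omega> T)"
      using norm_triangle_ineq4[of "\<sigma> T x - \<omega> T" "\<sigma> T y - \<omega> T"] by simp
    also have "\<dots> \<le> 2 * sqrt (1/32)" using \<sigma>(4)[of T x] \<sigma>(4)[of T y] T by simp
    finally have "norm (\<sigma> T x - \<sigma> T y) \<le> 2 * sqrt (1/32)" .
    moreover have "sqrt (1/32) < (1/4 :: real)"
      by (rule real_less_lsqrt) (simp_all add: power2_eq_square)
    ultimately show ?thesis by simp
  qed
  have g_osc: "cmod (g V W x - g V W y) < 1"
    if VW: "V \<in> \<U>" "W \<in> \<U>" "x \<in> V \<inter> W" "y \<in> V \<inter> W" for V W x y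
  proof -
    have d: "norm (\<sigma> V x - \<sigma> V y) < 1/2" "norm (\<sigma> W x - \<sigma> W y) < 1/2"
      using VW by (auto intro!: \<sigma>_osc simp del: less_divide_eq_numeral1)
    have "g V W x - g V W y = cdot (\<sigma> V x - \<sigma> V y) (\<sigma> W x) + cdot (\<sigma> V y) (\<sigma> W x - \<sigma> W y)"
      by (simp add: g_def)
    then have "cmod (g V W x - g V W y)
        \<le> cmod (cdot (\<sigma> V x - \<sigma> V y) (\<sigma> W x)) + cmod (cdot (\<sigma> V y) (\<sigma> W x - \<sigma> W y))"
      by (metis norm_triangle_ineq)
    also have "\<dots> \<le> norm (\<sigma> V x - \<sigma> V y) * 1 + 1 * norm (\<sigma> W x - \<sigma> W y)"
      using cmod_cdot_le[of "\<sigma> V x - \<sigma> V y" "\<sigma> W x"] cmod_cdot_le[of "\<sigma> V y" "\<sigma> W x - \<sigma> W y"]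
        \<sigma>(1)[of W x] \<sigma>(1)[of V y] VW by (intro add_mono) auto
    finally show ?thesis using d by simp
  qed
  show ?thesis
  proof (rule circle_cocycle_trivial[OF X H \<open>open_cover X \<U>\<close> g_norm g_cont g_coc g_osc])
    fix \<W> r \<phi>
    assume W: "open_cover X \<W>" "refinement_map \<W> \<U> r"
      and \<phi>: "\<And>W x. W \<in> \<W> \<Longrightarrow> x \<in> W \<Longrightarrow> cmod (\<phi> W x) = 1"
        "\<And>W x. W \<in> \<W> \<Longrightarrow> x \<in> W \<Longrightarrow> (\<phi> W \<longlongrightarrow> \<phi> W x) (atin X x)"
        "\<And>W V x. W \<in> \<W> \<Longrightarrow> V \<in> \<W> \<Longrightarrow> x \<in> W \<inter> V \<Longrightarrow> g (r W) (r V) x = \<phi> W x / \<phi> V x"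
    have r: "r W \<in> \<U>" "x \<in> W \<Longrightarrow> x \<in> r W" if "W \<in> \<W>" for W x
      using W(2) that unfolding refinement_map_def by auto
    define c where "c x = (SOME W. W \<in> \<W> \<and> x \<in> W)" for x
    have c: "c x \<in> \<W>" "x \<in> c x" if "x \<in> topspace X" for x
      using someI_ex[of "\<lambda>W. W \<in> \<W> \<and> x \<in> W"] that W(1) by (auto simp: c_def open_cover_def)
    \<comment> \<open>Dividing by the phase \<open>\<phi> W\<close> removes the transition
      functions, so the value at \<open>x\<close> is the same for all members of the cover
      containing \<open>x\<close>.\<close>
    define u where "u W x = (1 / \<phi> W x) *s \<sigma> (r W) x" for W x
    have u: "u W x = u V x" if WV: "W \<in> \<W>" "V \<in> \<W>" "x \<in> W" "x \<in> V" for W V x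
    proof -
      have "\<sigma> (r W) x = (\<phi> W x / \<phi> V x) *s \<sigma> (r V) x"
        using g[of "r W" "r V" x] \<phi>(3)[of W V x] WV r by simp
      moreover have "\<phi> W x \<noteq> 0" using \<phi>(1)[of W x] WV by auto
      ultimately show ?thesis by (simp add: u_def vector_smult_assoc)
    qed
    show ?thesis
    proof (rule that[of "\<lambda>x. u (c x) x"])
      fix x assume x: "x \<in> topspace X"
      show "norm (u (c x) x) = 1"
        using c[OF x] r[OF c(1)[OF x]] \<sigma>(1)[of "r (c x)" x] \<phi>(1)[of "c x" x]
        by (simp add: u_def norm_smult norm_divide)
      show "P x = rank_one (u (c x) x)"
        using c[OF x] r[OF c(1)[OF x]] \<sigma>(2)[of "r (c x)" x] \<phi>(1)[of "c x" x]
        by (simp add: u_def rank_one_smult norm_divide)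
    next
      show "continuous_map X euclidean (\<lambda>x. u (c x) x)"
        unfolding continuous_map_iff_tendsto
      proof
        fix x assume x: "x \<in> topspace X"
        note cx = c[OF x]
        have "\<phi> (c x) x \<noteq> 0" using \<phi>(1)[OF cx] by auto
        then have "(u (c x) \<longlongrightarrow> u (c x) x) (atin X x)"
          unfolding u_def using cx r[OF cx(1)] by (intro tendsto_intros \<phi> \<sigma>) auto
        \<comment> \<open>The choice of \<open>c y\<close> jumps with \<open>y\<close>, but near
          \<open>x\<close> it may be replaced by the fixed member \<open>c x\<close>.\<close>
        moreover have "\<forall>\<^sub>F y in atin X x. u (c x) y = u (c y) y"
        proof (rule eventually_atin_openin[of X "c x"])
          show op: "openin X (c x)" using W(1) cx unfolding open_cover_def by blast
          fix y assume y: "y \<in> c x"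
          then have "y \<in> topspace X" using openin_subset[OF op] by blast
          then show "u (c x) y = u (c y) y" using u[OF cx(1) c(1) y c(2)] by blast
        qed (use cx in auto)
        ultimately show "((\<lambda>x. u (c x) x) \<longlongrightarrow> u (c x) x) (atin X x)"
          by (rule Lim_transform_eventually)
      qed
    qed
  qed
qed

text \<open>Lifting along the Hopf map, which sends \<open>(\<alpha>, \<beta>)\<close> to the pair
  of \<open>|\<alpha>|^2 - |\<beta>|^2\<close> and \<open>2 \<alpha> cnj \<beta>\<close>. A point of
  the 2-sphere determines a rank one projection \<open>P\<close>, and the coordinates of a global
  unit section of its range are the lift.\<close>

lemma hopf_lift:
  fixes t :: "'a \<Rightarrow> real" and z :: "'a \<Rightarrow> complex"
  assumes X: "compact_space X" "Hausdorff_space X" and H: "cech_cohomology 2 X = {cech_zero 2 X}"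
    and t: "continuous_map X euclideanreal t" and z: "continuous_map X euclidean z"
    and sphere: "\<And>x. x \<in> topspace X \<Longrightarrow> (t x)\<^sup>2 + (cmod (z x))\<^sup>2 = 1"
  obtains \<alpha> \<beta> :: "'a \<Rightarrow> complex"
  where "continuous_map X euclidean \<alpha>" "continuous_map X euclidean \<beta>"
    "\<And>x. x \<in> topspace X \<Longrightarrow> (cmod (\<alpha> x))\<^sup>2 = (1 + t x) / 2"
    "\<And>x. x \<in> topspace X \<Longrightarrow> (cmod (\<beta> x))\<^sup>2 = (1 - t x) / 2"
    "\<And>x. x \<in> topspace X \<Longrightarrow> 2 * \<alpha> x * cnj (\<beta> x) = z x"
proof -
  define P :: "'a \<Rightarrow> complex^2^2" where
    "P x = vector [vector [of_real ((1 + t x) / 2), z x / 2], vector [cnj (z x) / 2, of_real ((1 -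
      t x) / 2)]]" for x
  have P_nth: "P x $ 1 $ 1 = of_real ((1 + t x) / 2)" "P x $ 1 $ 2 = z x / 2"
    "P x $ 2 $ 1 = cnj (z x) / 2" "P x $ 2 $ 2 = of_real ((1 - t x) / 2)" for x
    by (simp_all add: P_def)
  have "continuous_map X euclidean P"
    unfolding continuous_map_iff_tendsto
  proof
    fix x assume "x \<in> topspace X"
    then have lim: "(t \<longlongrightarrow> t x) (atin X x)" "(z \<longlongrightarrow> z x) (atin X x)"
      using t z unfolding continuous_map_iff_tendsto by blast+
    have "((\<lambda>x. P x $ 1 $ 1) \<longlongrightarrow> P x $ 1 $ 1) (atin X x)"
      "((\<lambda>x. P x $ 1 $ 2) \<longlongrightarrow> P x $ 1 $ 2) (atin X x)"
      "((\<lambda>x. P x $ 2 $ 1) \<longlongrightarrow> P x $ 2 $ 1) (atin X x)" "((\<lambda>x. P x $ 2 $ 2) \<longlongrightarrow> P x $ 2 $ 2) (atin X x)"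
      unfolding P_nth by (intro tendsto_intros lim; simp)+
    then have "((\<lambda>x. P x $ i $ j) \<longlongrightarrow> P x $ i $ j) (atin X x)" for i j
      using exhaust_2[of i] exhaust_2[of j] by (elim disjE; simp only:)
    then show "(P \<longlongrightarrow> P x) (atin X x)" by (intro vec_tendstoI)
  qed
  moreover have "\<exists>v. norm v = 1 \<and> P x = rank_one v" if x: "x \<in> topspace X" for x
  proof -
    have t_le: "\<bar>t x\<bar> \<le> 1"
      using sphere[OF x] by (metis abs_square_le_1 le_add_same_cancel1 zero_le_power2)
    show ?thesis
    proof (cases "t x = -1")
      case True
      then have "z x = 0" using sphere[OF x] by simp
      then have "P x = rank_one (axis 2 1)"
        using True by (simp add: vec_eq_iff forall_2 P_nth rank_one_def axis_def)
      moreover have "norm (axis 2 1 :: complex^2) = 1" by (simp add: norm_axis_1)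
      ultimately show ?thesis by blast
    next
      case False
      \<comment> \<open>\<open>v\<close> is the first column of \<open>P x\<close> divided by its
        length \<open>s\<close>. That column vanishes exactly in the case \<open>t x = -1\<close>
        treated before.\<close>
      define s where "s = sqrt ((1 + t x) / 2)"
      have s: "s > 0" "s\<^sup>2 = (1 + t x) / 2" using False t_le by (auto simp: s_def)
      define v :: "complex^2" where "v = vector [of_real s, cnj (z x) / (2 * of_real s)]"
      have v_nth: "v $ 1 = of_real s" "v $ 2 = cnj (z x) / (2 * of_real s)" by (simp_all add: v_def)
      have "(cmod (z x))\<^sup>2 = (1 - t x) * (1 + t x)"
        using sphere[OF x] by (simp add: algebra_simps power2_eq_square)
      then have zz: "cnj (z x) * z x = complex_of_real ((1 - t x) * (1 + t x))"
        by (metis complex_norm_square mult.commute)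
      have "v $ 2 * cnj (v $ 2) = cnj (z x) * z x / (4 * (of_real (s\<^sup>2)))"
        by (simp add: v_nth power2_eq_square)
      also have "\<dots> = complex_of_real ((1 - t x) * (1 + t x) / (4 * ((1 + t x) / 2)))"
        unfolding zz s(2) by (simp only: of_real_divide of_real_mult of_real_numeral)
      also have "(1 - t x) * (1 + t x) / (4 * ((1 + t x) / 2)) = (1 - t x) / 2"
      proof -
        have *: "a * q / (4 * (q / 2)) = a / 2" if "q \<noteq> 0" for a q :: real using that by simp
        show ?thesis by (rule *) (use False in linarith)
      qed
      finally have v22: "v $ 2 * cnj (v $ 2) = complex_of_real ((1 - t x) / 2)" .
      have v11: "v $ 1 * cnj (v $ 1) = complex_of_real ((1 + t x) / 2)"
      proof -
        have "s * s = (1 + t x) / 2" using s(2) by (simp add: power2_eq_square)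
        then show ?thesis unfolding v_nth complex_cnj_complex_of_real by (metis of_real_mult)
      qed
      have "P x = rank_one v"
        using v11 v22 s(1) by (simp add: vec_eq_iff forall_2 P_nth rank_one_def) (simp add: v_nth)
      moreover have "norm v = 1"
      proof -
        have "complex_of_real ((norm v)\<^sup>2) = complex_of_real ((1 + t x) / 2)
          + complex_of_real ((1 - t x) / 2)"
          by (simp only: cdot_self[symmetric] cdot_def sum_2 v11 v22)
        then have "(norm v)\<^sup>2 = (1 + t x) / 2 + (1 - t x) / 2"
          by (simp only: of_real_add[symmetric] of_real_eq_iff)
        then have "(norm v)\<^sup>2 = 1\<^sup>2" by (simp add: field_simps)
        then show ?thesis by (rule power2_eq_imp_eq) auto
      qed
      ultimately show ?thesis by blast
    qed
  qed
  ultimately obtain v where v: "continuous_map X euclidean v"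
    "\<And>x. x \<in> topspace X \<Longrightarrow> norm (v x) = 1" "\<And>x. x \<in> topspace X \<Longrightarrow> P x = rank_one (v x)"
    using line_bundle_section[OF X H] by blast
  have entry: "P x $ i $ j = v x $ i * cnj (v x $ j)" if "x \<in> topspace X" for x i j
    using v(3)[OF that] by (simp add: rank_one_def)
  show ?thesis
  proof (rule that[of "\<lambda>x. v x $ 1" "\<lambda>x. v x $ 2"])
    show "continuous_map X euclidean (\<lambda>x. v x $ 1)" "continuous_map X euclidean (\<lambda>x. v x $ 2)"
      using v(1) unfolding continuous_map_iff_tendsto by (auto intro!: tendsto_intros)
    fix x assume x: "x \<in> topspace X"
    have "complex_of_real ((cmod (v x $ 1))\<^sup>2) = complex_of_real ((1 + t x) / 2)"
      using entry[OF x, of 1 1] by (simp only: P_nth complex_norm_square)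
    then show "(cmod (v x $ 1))\<^sup>2 = (1 + t x) / 2" by (simp only: of_real_eq_iff)
    have "complex_of_real ((cmod (v x $ 2))\<^sup>2) = complex_of_real ((1 - t x) / 2)"
      using entry[OF x, of 2 2] by (simp only: P_nth complex_norm_square)
    then show "(cmod (v x $ 2))\<^sup>2 = (1 - t x) / 2" by (simp only: of_real_eq_iff)
    show "2 * v x $ 1 * cnj (v x $ 2) = z x"
      using entry[OF x, of 1 2] by (simp add: P_nth)
  qed
qed

section \<open>Approximate top eigenvectors\<close>

definition hermitian_field :: "'a topology \<Rightarrow> ('a \<Rightarrow> complex^'n^'n) \<Rightarrow> bool" where
  "hermitian_field X a \<longleftrightarrow> continuous_map X euclidean a \<and> (\<forall>x\<in>topspace X. cadjoint (a x) = a x)"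

definition unit_field :: "'a topology \<Rightarrow> ('a \<Rightarrow> complex^'n) \<Rightarrow> bool" where
  "unit_field X v \<longleftrightarrow> continuous_map X euclidean v \<and> (\<forall>x\<in>topspace X. norm (v x) = 1)"

lemma continuous_map_normalize:
  fixes u :: "'a \<Rightarrow> complex^'n"
  assumes "continuous_map X euclidean u" "\<And>x. x \<in> topspace X \<Longrightarrow> u x \<noteq> 0"
  shows "unit_field X (\<lambda>x. u x /\<^sub>R norm (u x))"
  using assms unfolding unit_field_def continuous_map_iff_tendsto
  by (auto intro!: tendsto_intros)

lemma rayleigh_scaleR: "inner (a *v (r *\<^sub>R v)) (r *\<^sub>R v) = r\<^sup>2 * inner (a *v v) v"
  for a :: "complex^'n^'n"
  by (simp add: scaleR_eq_smult vector_scalar_commute flip: Re_cdot)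
    (simp add: power2_eq_square mult.assoc)

lemma rayleigh_combination:
  fixes a :: "complex^'n^'n"
  assumes "cadjoint a = a"
  shows "inner (a *v (\<alpha> *s v + \<beta> *s w)) (\<alpha> *s v + \<beta> *s w) =
    (cmod \<alpha>)\<^sup>2 * inner (a *v v) v + (cmod \<beta>)\<^sup>2 * inner (a *v w) w
    + 2 * Re (cnj \<alpha> * \<beta> * cdot (a *v w) v)"
proof -
  have sym: "cdot (a *v v) w = cnj (cdot (a *v w) v)"
    using cdot_adjoint[of a v w] assms by (simp add: cdot_commute)
  have "cdot (a *v (\<alpha> *s v + \<beta> *s w)) (\<alpha> *s v + \<beta> *s w) =
    \<alpha> * cnj \<alpha> * cdot (a *v v) v + \<beta> * cnj \<beta> * cdot (a *v w) w
    + (cnj \<alpha> * \<beta> * cdot (a *v w) v + cnj (cnj \<alpha> * \<beta> * cdot (a *v w) v))"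
    by (simp add: matrix_vector_right_distrib vector_scalar_commute sym algebra_simps)
  then have "Re (cdot (a *v (\<alpha> *s v + \<beta> *s w)) (\<alpha> *s v + \<beta> *s w)) =
    Re (complex_of_real ((cmod \<alpha>)\<^sup>2) * cdot (a *v v) v
      + complex_of_real ((cmod \<beta>)\<^sup>2) * cdot (a *v w) w
    + (cnj \<alpha> * \<beta> * cdot (a *v w) v + cnj (cnj \<alpha> * \<beta> * cdot (a *v w) v)))"
    by (simp only: complex_norm_square)
  also have "\<dots> = (cmod \<alpha>)\<^sup>2 * Re (cdot (a *v v) v) + (cmod \<beta>)\<^sup>2 * Re (cdot (a *v w) w)
    + 2 * Re (cnj \<alpha> * \<beta> * cdot (a *v w) v)"
    by (simp only: plus_complex.sel Re_complex_of_real times_complex.sel(1) Im_complex_of_real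
        cnj.sel(1)) (simp add: algebra_simps)
  finally show ?thesis by (simp only: Re_cdot)
qed

text \<open>
  The values of the form \<open>b\<close> on combinations of \<open>v\<close> and \<open>w\<close> are given by a 2 by 2 Hermitian matrix.
  Its traceless part is a map to a 3-dimensional space, which dimension at most 2 allows to make
  nonvanishing, so that the top eigenvector is well defined up to a phase.
\<close>

lemma positive_combination:
  fixes b :: "'a \<Rightarrow> complex^'n^'n"
  assumes X: "compact_space X" "Hausdorff_space X" and H: "cech_cohomology 2 X = {cech_zero 2 X}"
    and dim: "covering_multiplicity_le X 3" and b: "hermitian_field X b"
    and v: "continuous_map X euclidean v" and w: "continuous_map X euclidean w" and e: "e > 0"
    and pos: "\<And>x. x \<in> topspace X \<Longrightarrow> e \<le> max (inner (b x *v v x) (v x)) (inner (b x *v w x) (w x))"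
  obtains u where "continuous_map X euclidean u"
    "\<And>x. x \<in> topspace X \<Longrightarrow> inner (b x *v u x) (u x) > 0"
proof -
  have lims: "(b \<longlongrightarrow> b x) (atin X x)" "(v \<longlongrightarrow> v x) (atin X x)" "(w \<longlongrightarrow> w x) (atin X x)"
    if "x \<in> topspace X" for x
    using b v w that unfolding hermitian_field_def continuous_map_iff_tendsto by blast+
  define k1 k2 where "k1 x = inner (b x *v v x) (v x)" and "k2 x = inner (b x *v w x) (w x)" for x
  define m where "m x = cdot (b x *v w x) (v x)" for x
  \<comment> \<open>The traceless part of the matrix of the form on \<open>v\<close> and
    \<open>w\<close>. On a combination whose coefficients lie over the direction \<open>s\<close>
    under the Hopf map, the form equals half the trace plus \<open>inner s h\<close>.\<close>
  define h where "h x = ((k1 x - k2 x) / 2, m x)" for x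
  have "continuous_map X euclidean h"
    unfolding continuous_map_iff_tendsto h_def k1_def k2_def m_def
    by (intro ballI tendsto_intros lims) simp_all
  moreover have "covering_multiplicity_le X DIM(real \<times> complex)" using dim
    by (simp add: numeral_3_eq_3)
  ultimately obtain h' where h': "continuous_map X euclidean h'"
    "\<And>x. x \<in> topspace X \<Longrightarrow> h' x \<noteq> 0" "\<And>x. x \<in> topspace X \<Longrightarrow> dist (h' x) (h x) < e/4"
    using perturb_nonvanishing[OF X, of h "e/4"] e by auto
  define s where "s x = h' x /\<^sub>R norm (h' x)" for x
  have norm_s: "norm (s x) = 1" if "x \<in> topspace X" for x using h'(2)[OF that] by (simp add: s_def)
  have s_lim: "(s \<longlongrightarrow> s x) (atin X x)" if "x \<in> topspace X" for x
    unfolding s_def using h' that unfolding continuous_map_iff_tendsto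
    by (intro tendsto_intros) auto
  have "continuous_map X euclideanreal (\<lambda>x. fst (s x))" "continuous_map X euclidean (\<lambda>x. snd (s x))"
    unfolding continuous_map_iff_tendsto using s_lim by (auto intro!: tendsto_intros)
  moreover have "(fst (s x))\<^sup>2 + (cmod (snd (s x)))\<^sup>2 = 1" if "x \<in> topspace X" for x
    using norm_s[OF that] by (simp add: norm_prod_def real_sqrt_eq_1_iff)
  ultimately obtain \<alpha> \<beta> where \<alpha>\<beta>: "continuous_map X euclidean \<alpha>" "continuous_map X euclidean \<beta>"
    "\<And>x. x \<in> topspace X \<Longrightarrow> (cmod (\<alpha> x))\<^sup>2 = (1 + fst (s x)) / 2"
    "\<And>x. x \<in> topspace X \<Longrightarrow> (cmod (\<beta> x))\<^sup>2 = (1 - fst (s x)) / 2"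
    "\<And>x. x \<in> topspace X \<Longrightarrow> 2 * \<alpha> x * cnj (\<beta> x) = snd (s x)"
    using hopf_lift[OF X H, of "\<lambda>x. fst (s x)" "\<lambda>x. snd (s x)"] by blast
  show ?thesis
  proof (rule that[of "\<lambda>x. \<alpha> x *s v x + \<beta> x *s w x"])
    show "continuous_map X euclidean (\<lambda>x. \<alpha> x *s v x + \<beta> x *s w x)"
      using \<alpha>\<beta>(1,2) lims unfolding continuous_map_iff_tendsto by (auto intro!: tendsto_intros)
    fix x assume x: "x \<in> topspace X"
    have "2 * Re (cnj (\<alpha> x) * \<beta> x * m x) = Re (cnj (2 * \<alpha> x * cnj (\<beta> x)) * m x)"
      by (simp add: algebra_simps)
    also have "\<dots> = inner (snd (s x)) (m x)"
      unfolding \<alpha>\<beta>(5)[OF x] by (simp add: inner_complex_def)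
    finally have "inner (b x *v (\<alpha> x *s v x + \<beta> x *s w x)) (\<alpha> x *s v x + \<beta> x *s w x)
        = (1 + fst (s x)) / 2 * k1 x + (1 - fst (s x)) / 2 * k2 x + inner (snd (s x)) (m x)"
      using rayleigh_combination[of "b x" "\<alpha> x" "v x" "\<beta> x" "w x"] b x
      by (simp add: hermitian_field_def \<alpha>\<beta>(3,4)[OF x] k1_def k2_def m_def)
    also have "\<dots> = (k1 x + k2 x) / 2 + inner (s x) (h x)"
      by (simp add: h_def inner_prod_def field_simps)
    finally have eq: "inner (b x *v (\<alpha> x *s v x + \<beta> x *s w x)) (\<alpha> x *s v x + \<beta> x *s w x)
        = (k1 x + k2 x) / 2 + inner (s x) (h x)" .
    \<comment> \<open>The perturbation by \<open>e/4\<close> is paid twice, in the norm of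
      \<open>h\<close> and in its component along \<open>s\<close>. Half the trace plus
      \<open>|k1 - k2| / 2\<close> is the maximum of \<open>k1\<close> and \<open>k2\<close>, hence
      at least \<open>e\<close>, and at least \<open>e/2\<close> is left.\<close>
    have "inner (s x) (h x) \<ge> \<bar>k1 x - k2 x\<bar> / 2 - e/2"
    proof -
      have "inner (s x) (h' x) = norm (h' x)"
        using h'(2)[OF x] by (simp add: s_def dot_square_norm power2_eq_square)
      moreover have "\<bar>inner (s x) (h x - h' x)\<bar> \<le> e/4"
        using Cauchy_Schwarz_ineq2[of "s x" "h x - h' x"] h'(3)[OF x] norm_s[OF x]
        by (simp add: dist_norm norm_minus_commute)
      moreover have "norm (h x) \<le> norm (h' x) + e/4"
        using h'(3)[OF x] norm_triangle_ineq2[of "h x" "h' x"]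
          by (simp add: dist_norm norm_minus_commute)
      moreover have "\<bar>k1 x - k2 x\<bar> / 2 \<le> norm (h x)"
        using norm_fst_le[of "(k1 x - k2 x) / 2" "m x"] by (simp add: h_def)
      moreover have "inner (s x) (h x) = inner (s x) (h' x) + inner (s x) (h x - h' x)"
        by (simp add: inner_diff_right)
      ultimately show ?thesis by linarith
    qed
    moreover have "0 < (k1 x + k2 x) / 2 + (\<bar>k1 x - k2 x\<bar> / 2 - e/2)"
      using pos[OF x] e unfolding k1_def[symmetric] k2_def[symmetric]
      by (auto simp: max_def abs_if field_simps split: if_splits)
    ultimately show "0 < inner (b x *v (\<alpha> x *s v x + \<beta> x *s w x)) (\<alpha> x *s v x + \<beta> x *s w x)"
      unfolding eq by linarith
  qed
qed

text \<open>Subtracting the desired value \<open>\<mu>\<close> turns the claim into positivity of a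
  form. Positivity is invariant under scaling and forces \<open>u\<close> to be nonzero even where
  \<open>v\<close> and \<open>w\<close> are linearly dependent, so \<open>u\<close> can be
  normalized afterwards.\<close>

lemma improve_unit_field:
  fixes a :: "'a \<Rightarrow> complex^'n^'n"
  assumes X: "compact_space X" "Hausdorff_space X" and H: "cech_cohomology 2 X = {cech_zero 2 X}"
    and dim: "covering_multiplicity_le X 3" and a: "hermitian_field X a"
    and v: "unit_field X v" and w: "unit_field X w" and e: "e > 0"
  obtains u where "unit_field X u"
    "\<And>x. x \<in> topspace X \<Longrightarrow>
      max (inner (a x *v v x) (v x)) (inner (a x *v w x) (w x)) - e \<le> inner (a x *v u x) (u x)"
proof -
  have lims: "(a \<longlongrightarrow> a x) (atin X x)" "(v \<longlongrightarrow> v x) (atin X x)" "(w \<longlongrightarrow> w x) (atin X x)"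
    if "x \<in> topspace X" for x
    using a v w that unfolding hermitian_field_def unit_field_def continuous_map_iff_tendsto
      by blast+
  define \<mu> where "\<mu> x = max (inner (a x *v v x) (v x)) (inner (a x *v w x) (w x)) - e" for x
  define b where "b x = a x - mat (complex_of_real (\<mu> x))" for x
  have b_rayleigh: "inner (b x *v y) y = inner (a x *v y) y - \<mu> x * (norm y)\<^sup>2" for x y
    by (simp add: b_def matrix_vector_mult_diff_rdistrib mat_vector_mult inner_diff_left
      dot_square_norm
        flip: scaleR_eq_smult)
  have "hermitian_field X b"
    using a lims unfolding hermitian_field_def b_def \<mu>_def continuous_map_iff_tendsto
    by (auto intro!: tendsto_intros)
  moreover have "e \<le> max (inner (b x *v v x) (v x)) (inner (b x *v w x) (w x))"
    if "x \<in> topspace X" for x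
    using v w that unfolding b_rayleigh unit_field_def by (simp add: \<mu>_def)
  ultimately obtain u where u: "continuous_map X euclidean u"
    "\<And>x. x \<in> topspace X \<Longrightarrow> inner (b x *v u x) (u x) > 0"
    using positive_combination[OF X H dim, of b v w e] v w e unfolding unit_field_def by blast
  have u0: "u x \<noteq> 0" if "x \<in> topspace X" for x using u(2)[OF that] by auto
  show ?thesis
  proof (rule that[OF continuous_map_normalize[OF u(1) u0]])
    fix x assume x: "x \<in> topspace X"
    have "\<mu> x * (norm (u x))\<^sup>2 < inner (a x *v u x) (u x)"
      using u(2)[OF x] unfolding b_rayleigh by simp
    then have "\<mu> x \<le> inner (a x *v u x) (u x) / (norm (u x))\<^sup>2"
      using u0[OF x] by (simp add: pos_le_divide_eq)
    also have "\<dots> = inner (a x *v (u x /\<^sub>R norm (u x))) (u x /\<^sub>R norm (u x))"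
      unfolding rayleigh_scaleR by (simp add: divide_inverse power_inverse mult.commute)
    finally show "max (inner (a x *v v x) (v x)) (inner (a x *v w x) (w x)) - e
        \<le> inner (a x *v (u x /\<^sub>R norm (u x))) (u x /\<^sub>R norm (u x))"
      by (simp only: \<mu>_def)
  qed
qed

lemma continuous_matrix_field_bounded:
  fixes a :: "'a \<Rightarrow> complex^'n^'n"
  assumes "compact_space X" "continuous_map X euclidean a"
  obtains C where "C \<ge> 0" "\<And>x. x \<in> topspace X \<Longrightarrow> cmatrix_norm (a x) \<le> C"
proof -
  have "compactin euclidean (a ` topspace X)"
    using assms unfolding compact_space_def by (blast intro: image_compactin)
  then obtain B where B: "\<And>x. x \<in> topspace X \<Longrightarrow> norm (a x) \<le> B"
    by (fastforce dest: compact_imp_bounded simp: bounded_iff)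
  have "cmatrix_norm (a x) \<le> \<bar>real CARD('n) * B\<bar>" if "x \<in> topspace X" for x
    using cmatrix_norm_le_frobenius[of "a x"] mult_left_mono[OF B[OF that], of "real CARD('n)"]
      by linarith
  then show ?thesis by (intro that[of "\<bar>real CARD('n) * B\<bar>"]) auto
qed

text \<open>The interface between the topology and the linear algebra; the \<open>itself\<close>
  argument fixes the size of the matrices. It is instantiated with the whole space in part (ii) and
  with a single point in part (i).\<close>

definition has_top_fields :: "'a topology \<Rightarrow> 'n::finite itself \<Rightarrow> bool" where
  "has_top_fields X T \<longleftrightarrow> (\<forall>(a :: 'a \<Rightarrow> complex^'n^'n) e. hermitian_field X a \<longrightarrow> e > 0 \<longrightarrow>
    (\<exists>v. unit_field X v \<and> (\<forall>x\<in>topspace X. rayleigh_max (a x) - e \<le> inner (a x *v v x) (v x))))"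

text \<open>Improving a unit field successively against all the vectors of a fine net of the unit sphere.\<close>

lemma has_top_fields_if_cech_trivial:
  assumes X: "compact_space X" "Hausdorff_space X" and H: "cech_cohomology 2 X = {cech_zero 2 X}"
    and dim: "covering_multiplicity_le X 3"
  shows "has_top_fields X TYPE('n::finite)"
  unfolding has_top_fields_def
proof (intro allI impI)
  fix a :: "'a \<Rightarrow> complex^'n^'n" and e :: real
  assume a: "hermitian_field X a" and e: "e > 0"
  obtain C where C: "C \<ge> 0" "\<And>x. x \<in> topspace X \<Longrightarrow> cmatrix_norm (a x) \<le> C"
    using continuous_matrix_field_bounded[OF X(1)] a unfolding hermitian_field_def by blast
  have const: "unit_field X (\<lambda>x. w)" if "norm w = 1" for w :: "complex^'n"
    using that by (simp add: unit_field_def)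
  \<comment> \<open>Between a maximizer and a net point at distance \<open>d\<close> the form
    changes by at most \<open>2 * (C + 1) * d = e/2\<close>. The other half of \<open>e\<close> is
    for the successive improvements; \<open>C + 1\<close> avoids division by 0.\<close>
  define d where "d = e / (4 * (C + 1))"
  have d: "d > 0" using e C by (simp add: d_def)
  obtain N where N: "finite N" "N \<subseteq> sphere (0::complex^'n) 1" "sphere 0 1 \<subseteq> (\<Union>w\<in>N. ball w d)"
  proof (rule compactE_image[OF compact_sphere, of "sphere (0::complex^'n) 1" "\<lambda>w. ball w d" 0 1])
    show "sphere (0::complex^'n) 1 \<subseteq> (\<Union>w\<in>sphere 0 1. ball w d)" using d by auto
  qed auto
  \<comment> \<open>The error \<open>e'\<close> is generalized: half of it goes to the vectors
    treated earlier and half to the improvement by the new one.\<close>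
  have "\<exists>v. unit_field X v \<and> (\<forall>x\<in>topspace X. \<forall>w\<in>N. inner (a x *v w) w - e'
    \<le> inner (a x *v v x) (v x))"
    if "e' > 0" for e'
    using N(1,2) that
  proof (induction arbitrary: e')
    case empty
    show ?case using unit_vector_exists[where 'n='n] const by blast
  next
    case (insert w N)
    then obtain v where v: "unit_field X v"
      "\<forall>x\<in>topspace X. \<forall>w\<in>N. inner (a x *v w) w - e'/2 \<le> inner (a x *v v x) (v x)"
      by (metis half_gt_zero insert_subset)
    have w: "unit_field X (\<lambda>x. w)" using insert.prems by (intro const) auto
    obtain u where u: "unit_field X u"
      "\<And>x. x \<in> topspace X \<Longrightarrow>
        max (inner (a x *v v x) (v x)) (inner (a x *v w) w) - e'/2 \<le> inner (a x *v u x) (u x)"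
      using improve_unit_field[OF X H dim a v(1) w, of "e'/2"] insert.prems by auto
    have "inner (a x *v w') w' - e' \<le> inner (a x *v u x) (u x)"
      if "x \<in> topspace X" "w' \<in> insert w N" for x w'
      using u(2)[OF that(1)] v(2) that insert.prems(2) by fastforce
    then show ?case using u(1) by blast
  qed
  from this[of "e/2"] e obtain v where v: "unit_field X v"
    "\<And>x w. x \<in> topspace X \<Longrightarrow> w \<in> N \<Longrightarrow> inner (a x *v w) w - e/2 \<le> inner (a x *v v x) (v x)"
    by auto
  have "rayleigh_max (a x) - e \<le> inner (a x *v v x) (v x)" if x: "x \<in> topspace X" for x
  proof -
    obtain y where y: "norm y = 1" "inner (a x *v y) y = rayleigh_max (a x)"
      using rayleigh_max_attained by blast
    then obtain w where w: "w \<in> N" "norm (w - y) < d"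
      using N(3) by (auto simp: dist_norm subset_iff)
    have nw: "norm w = 1" using w N(2) by auto
    have "inner (a x *v y) y - inner (a x *v w) w
      = inner (a x *v (y - w)) y + inner (a x *v w) (y - w)"
      by (simp add: matrix_vector_mult_diff_distrib inner_diff_left inner_diff_right)
    also have "\<dots> \<le> cmatrix_norm (a x) * norm (y - w) * norm y
      + cmatrix_norm (a x) * norm w * norm (y - w)"
      using rayleigh_le_norm[of "a x" "y - w" y] rayleigh_le_norm[of "a x" w "y - w"] by linarith
    also have "\<dots> = 2 * (cmatrix_norm (a x) * norm (y - w))" by (simp add: y nw)
    also have "cmatrix_norm (a x) * norm (y - w) \<le> (C + 1) * d"
      using C(2)[OF x] w(2) C(1) by (intro mult_mono) (auto simp: norm_minus_commute)
    also have "2 * ((C + 1) * d) = e/2" using C(1) by (simp add: d_def field_simps)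
    finally show ?thesis using v(2)[OF x w(1)] y by simp
  qed
  then show "\<exists>v. unit_field X v \<and> (\<forall>x\<in>topspace X. rayleigh_max (a x) - e
    \<le> inner (a x *v v x) (v x))"
    using v(1) by blast
qed

text \<open>Lets the pointwise reflections of part (i) be obtained from the same
  \<open>reflection_field\<close> that serves part (ii).\<close>

lemma has_top_fields_point: "has_top_fields (discrete_topology {p}) TYPE('n::finite)"
  unfolding has_top_fields_def
proof (intro allI impI)
  fix a :: "'a \<Rightarrow> complex^'n^'n" and e :: real
  assume "e > 0"
  moreover obtain v where "norm v = 1" "inner (a p *v v) v = rayleigh_max (a p)"
    using rayleigh_max_attained by blast
  ultimately show "\<exists>v. unit_field (discrete_topology {p}) v \<and>
      (\<forall>x\<in>topspace (discrete_topology {p}). rayleigh_max (a x) - e \<le> inner (a x *v v x) (v x))"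
    by (intro exI[of _ "\<lambda>x. v"]) (simp add: unit_field_def)
qed

section \<open>Approximate diagonalization and reflections\<close>

text \<open>Complex orthogonality to \<open>v i\<close> is real orthogonality to \<open>v i\<close>
  and to \<open>\<i> *s v i\<close>. These are at most \<open>2 k\<close> real conditions in real
  dimension \<open>2 * CARD('n)\<close>.\<close>

lemma orthogonal_unit_exists:
  fixes v :: "nat \<Rightarrow> complex^'n"
  assumes "k < CARD('n)"
  obtains w where "norm w = 1" "\<And>i. i < k \<Longrightarrow> cdot w (v i) = 0"
proof -
  define S where "S = v ` {..<k} \<union> (\<lambda>i. \<i> *s v i) ` {..<k}"
  have "card S \<le> card (v ` {..<k}) + card ((\<lambda>i. \<i> *s v i) ` {..<k})"
    unfolding S_def by (rule card_Un_le)
  also have "\<dots> \<le> k + k" by (intro add_mono order_trans[OF card_image_le]) auto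
  finally have "card S \<le> k + k" .
  moreover have "dim S \<le> card S" by (rule dim_le_card') (simp add: S_def)
  ultimately have "dim S < DIM(complex^'n)" using assms by simp
  then obtain x where x: "x \<noteq> 0" "\<And>y. y \<in> span S \<Longrightarrow> orthogonal x y"
    using orthogonal_to_subspace_exists by blast
  have "cdot x (v i) = 0" if "i < k" for i
  proof (rule complex_eqI)
    have "inner x (v i) = 0" "inner x (\<i> *s v i) = 0"
      using x(2) that by (auto simp: S_def orthogonal_def intro!: span_base)
    then show "Re (cdot x (v i)) = Re 0" "Im (cdot x (v i)) = Im 0"
      by (simp_all flip: Re_cdot)
  qed
  then show ?thesis using x(1) by (intro that[of "x /\<^sub>R norm x"]) auto
qed

text \<open>The successive maximum principle with an error. For Hermitian \<open>a\<close>,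
  \<open>e = 0\<close> and full length it would describe an eigenbasis in order of decreasing
  eigenvalues.\<close>

definition eigenframe :: "real \<Rightarrow> nat \<Rightarrow> complex^'n^'n \<Rightarrow> (nat \<Rightarrow> complex^'n) \<Rightarrow> bool" where
  "eigenframe e k a v \<longleftrightarrow>
    (\<forall>i<k. \<forall>j<k. cdot (v i) (v j) = (if i = j then 1 else 0)) \<and>
    (\<forall>i<k. \<forall>w. (\<forall>j<i. cdot w (v j) = 0) \<longrightarrow>
      inner (a *v w) w \<le> (inner (a *v v i) (v i) + e) * (norm w)\<^sup>2)"

text \<open>The next vector is an approximate top field of the compression of \<open>a\<close> to
  the complement of the previous ones, projected to that complement. By \<open>pos\<close> the
  compression has its top value at least 1 and hence above \<open>e\<close>, so the projected vector
  cannot vanish.\<close>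

lemma approximate_eigenframe:
  fixes a :: "'a \<Rightarrow> complex^'n^'n"
  assumes top: "has_top_fields X TYPE('n)" and a: "hermitian_field X a"
    and pos: "\<And>x w. x \<in> topspace X \<Longrightarrow> norm w = 1 \<Longrightarrow> 1 \<le> inner (a x *v w) w"
    and e: "0 < e" "e < 1" and k: "k \<le> CARD('n)"
  shows "\<exists>v. (\<forall>i<k. continuous_map X euclidean (v i)) \<and>
    (\<forall>x\<in>topspace X. eigenframe e k (a x) (\<lambda>i. v i x))"
  using k
proof (induction k)
  case 0
  then show ?case by (simp add: eigenframe_def)
next
  case (Suc k)
  obtain v where IH: "(\<forall>i<k. continuous_map X euclidean (v i)) \<and>
      (\<forall>x\<in>topspace X. eigenframe e k (a x) (\<lambda>i. v i x))"
    using Suc.IH[OF Suc_leD[OF Suc.prems]] by (rule exE)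
  from IH have v_cont: "\<And>i. i < k \<Longrightarrow> continuous_map X euclidean (v i)"
    and orth: "\<And>x i j. x \<in> topspace X \<Longrightarrow> i < k \<Longrightarrow> j < k \<Longrightarrow>
      cdot (v i x) (v j x) = (if i = j then 1 else 0)"
    and max: "\<And>x i w. x \<in> topspace X \<Longrightarrow> i < k \<Longrightarrow> (\<And>j. j < i \<Longrightarrow> cdot w (v j x) = 0) \<Longrightarrow>
        inner (a x *v w) w \<le> (inner (a x *v v i x) (v i x) + e) * (norm w)\<^sup>2"
    by (simp_all add: eigenframe_def)
  define P where "P x = mat 1 - (\<Sum>i<k. rank_one (v i x))" for x
  have sum_mv: "(\<Sum>i<m. f i) *v w = (\<Sum>i<m. f i *v w)" for f :: "nat \<Rightarrow> complex^'n^'n" and m w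
    by (induction m) (simp_all add: matrix_vector_mult_add_rdistrib)
  have P_apply: "P x *v w = w - (\<Sum>i<k. cdot w (v i x) *s v i x)" for x w
    by (simp add: P_def matrix_vector_mult_diff_rdistrib sum_mv rank_one_mult_vector)
  have P_adj: "cadjoint (P x) = P x" for x
  proof -
    have "cadjoint (rank_one y) = rank_one y" for y :: "complex^'n"
      by (simp add: cadjoint_def rank_one_def vec_eq_iff)
    moreover have "cadjoint (\<Sum>i<m. f i) = (\<Sum>i<m. cadjoint (f i))" for f :: "nat \<Rightarrow> complex^'n^'n"
      and m
      by (induction m) simp_all
    ultimately show ?thesis by (simp add: P_def)
  qed
  have P_orth: "cdot (P x *v w) (v j x) = 0" if "x \<in> topspace X" "j < k" for x w j
  proof -
    have "(\<Sum>i<k. cdot w (v i x) * cdot (v i x) (v j x)) = (\<Sum>i<k.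
      if i = j then cdot w (v i x) else 0)"
      using that by (intro sum.cong) (auto simp: orth)
    then show ?thesis using that by (simp add: P_apply cdot_sum_left)
  qed
  have P_fix: "P x *v w = w" if "\<And>i. i < k \<Longrightarrow> cdot w (v i x) = 0" for x w
    using that by (simp add: P_apply)
  have P_idem: "P x *v (P x *v w) = P x *v w" if "x \<in> topspace X" for x w
    using P_orth[OF that] by (intro P_fix) auto
  have P_lim: "(P \<longlongrightarrow> P x) (atin X x)" if "x \<in> topspace X" for x
    unfolding P_def using v_cont that unfolding continuous_map_iff_tendsto
    by (intro tendsto_intros) auto
  define a' where "a' x = P x ** a x ** P x" for x
  have a'_form: "inner (a' x *v w) w = inner (a x *v (P x *v w)) (P x *v w)" for x w
    using inner_cadjoint[of "P x" "a x *v (P x *v w)" w] P_adj[of x]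
    by (simp add: a'_def matrix_vector_mul_assoc[symmetric])
  have "hermitian_field X a'"
    using a P_lim unfolding hermitian_field_def a'_def continuous_map_iff_tendsto
    by (auto intro!: tendsto_intros simp: cadjoint_mult P_adj matrix_mul_assoc)
  then obtain y where y: "unit_field X y"
    "\<And>x. x \<in> topspace X \<Longrightarrow> rayleigh_max (a' x) - e \<le> inner (a' x *v y x) (y x)"
    using top e(1) unfolding has_top_fields_def by blast
  define z where "z x = P x *v y x" for x
  have big: "rayleigh_max (a' x) \<ge> 1" if x: "x \<in> topspace X" for x
  proof -
    obtain w where w: "norm w = 1" "\<And>i. i < k \<Longrightarrow> cdot w (v i x) = 0"
      using orthogonal_unit_exists[of k "\<lambda>i. v i x"] Suc.prems by auto
    have "P x *v w = w" by (rule P_fix) (rule w(2))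
    then have "inner (a' x *v w) w = inner (a x *v w) w" by (simp add: a'_form)
    then show ?thesis using pos[OF x w(1)] rayleigh_le_max_unit[OF w(1), of "a' x"] by simp
  qed
  have z_val: "rayleigh_max (a' x) - e \<le> inner (a x *v z x) (z x)" if "x \<in> topspace X" for x
    using y(2)[OF that] by (simp add: a'_form z_def)
  have z0: "z x \<noteq> 0" if "x \<in> topspace X" for x
    using z_val[OF that] big[OF that] e by auto
  have z_le: "norm (z x) \<le> 1" if x: "x \<in> topspace X" for x
  proof -
    have "(norm (z x))\<^sup>2 = inner (z x) (y x)"
      unfolding z_def power2_norm_eq_inner
      using inner_cadjoint[of "P x" "P x *v y x" "y x"] P_adj[of x] P_idem[OF x, of "y x"] by simp
    also have "\<dots> \<le> norm (z x) * norm (y x)" by (rule norm_cauchy_schwarz)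
    also have "\<dots> = norm (z x)" using y(1) x by (simp add: unit_field_def)
    finally show ?thesis using z0[OF x] by (simp add: power2_eq_square)
  qed
  have z_cont: "continuous_map X euclidean z"
    using y(1) P_lim unfolding z_def unit_field_def continuous_map_iff_tendsto
    by (auto intro!: tendsto_intros)
  define v' where "v' = v(k := (\<lambda>x. z x /\<^sub>R norm (z x)))"
  have v'_k: "v' k x = z x /\<^sub>R norm (z x)" and v'_less: "i < k \<Longrightarrow> v' i = v i" for x i
    by (simp_all add: v'_def)
  have unit: "unit_field X (v' k)"
    using continuous_map_normalize[OF z_cont z0] by (simp add: v'_def)
  have perp: "cdot (v' k x) (v j x) = 0" "cdot (v j x) (v' k x) = 0"
    if "x \<in> topspace X" "j < k" for x j
  proof -
    show *: "cdot (v' k x) (v j x) = 0" using P_orth[OF that, of "y x"] by (simp add: v'_k z_def)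
    show "cdot (v j x) (v' k x) = 0" using cdot_commute[of "v' k x" "v j x"] * by simp
  qed
  have cont': "continuous_map X euclidean (v' i)" if "i < Suc k" for i
    using that unit v_cont v'_less unfolding unit_field_def by (cases "i = k") auto
  have orth': "cdot (v' i x) (v' j x) = (if i = j then 1 else 0)"
    if "x \<in> topspace X" "i < Suc k" "j < Suc k" for x i j
    using that unit orth perp unfolding unit_field_def
    by (cases "i = k"; cases "j = k") (auto simp: v'_less cdot_self less_Suc_eq)
  have max': "inner (a x *v w) w \<le> (inner (a x *v v' i x) (v' i x) + e) * (norm w)\<^sup>2"
    if x: "x \<in> topspace X" and i: "i < Suc k" and w: "\<And>j. j < i \<Longrightarrow> cdot w (v' j x) = 0" for x i w
  proof (cases "i = k")
    case False
    then show ?thesis using max[OF x, of i w] i w by (simp add: v'_less)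
  next
    case True
    \<comment> \<open>The numerator is positive because \<open>rayleigh_max (a' x)\<close> is at
      least 1 and \<open>e < 1\<close>. So normalizing \<open>z x\<close>, whose norm is at most 1,
      does not decrease the value of the form.\<close>
    have "rayleigh_max (a' x) - e \<le> (rayleigh_max (a' x) - e) / (norm (z x))\<^sup>2"
      using big[OF x] e z_le[OF x] z0[OF x] by (simp add: pos_le_divide_eq mult_left_le
        power_le_one)
    also have "\<dots> \<le> inner (a x *v z x) (z x) / (norm (z x))\<^sup>2"
      using z_val[OF x] by (simp add: divide_right_mono)
    also have "\<dots> = inner (a x *v v' k x) (v' k x)"
      unfolding v'_k rayleigh_scaleR by (simp add: divide_inverse power_inverse mult.commute)
    finally have le: "rayleigh_max (a' x) \<le> inner (a x *v v' k x) (v' k x) + e" by simp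
    have "P x *v w = w" using w True by (intro P_fix) (simp add: v'_less)
    then have "inner (a x *v w) w = inner (a' x *v w) w" by (simp add: a'_form)
    also have "\<dots> \<le> rayleigh_max (a' x) * (norm w)\<^sup>2" by (rule rayleigh_le_max)
    also have "\<dots> \<le> (inner (a x *v v' k x) (v' k x) + e) * (norm w)\<^sup>2"
      using le by (intro mult_right_mono) auto
    finally show ?thesis using True by simp
  qed
  show ?case
    by (rule exI[of _ v']) (use cont' orth' max' in \<open>simp add: eigenframe_def\<close>)
qed

section \<open>From a near eigenframe to a reflection reversing the spectrum\<close>

lemma rayleigh_max_le_diagonal:
  fixes b :: "complex^'n^'n"
  assumes diag: "\<And>i. Re (b $ i $ i) \<le> m" and off: "\<And>i j. i \<noteq> j \<Longrightarrow>
    cmod (b $ i $ j) \<le> \<eta>" and \<eta>: "\<eta> \<ge> 0"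
  shows "rayleigh_max b \<le> m + (real CARD('n))\<^sup>2 * \<eta>"
proof (rule rayleigh_max_leI)
  fix w :: "complex^'n" assume w: "norm w = 1"
  have w_le: "cmod (w $ i) \<le> 1" for i
    using Finite_Cartesian_Product.norm_nth_le[of w i] w by simp
  have "inner (b *v w) w = (\<Sum>i\<in>UNIV. \<Sum>j\<in>UNIV. Re (b $ i $ j * w $ j * cnj (w $ i)))"
    by (simp add: cdot_def matrix_vector_mult_def sum_distrib_right flip: Re_cdot)
  also have "\<dots> \<le> (\<Sum>i\<in>UNIV. \<Sum>j\<in>UNIV. (if j = i then m * (cmod (w $ i))\<^sup>2 else 0) + \<eta>)"
  proof (intro sum_mono)
    fix i j
    show "Re (b $ i $ j * w $ j * cnj (w $ i)) \<le> (if j = i then m * (cmod (w $ i))\<^sup>2 else 0) + \<eta>"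
    proof (cases "j = i")
      case True
      have "Re (b $ i $ i * w $ i * cnj (w $ i))
        = Re (b $ i $ i * complex_of_real ((cmod (w $ i))\<^sup>2))"
        by (simp only: complex_norm_square mult.assoc)
      also have "\<dots> = Re (b $ i $ i) * (cmod (w $ i))\<^sup>2"
        by simp
      finally have "Re (b $ i $ i * w $ i * cnj (w $ i)) \<le> m * (cmod (w $ i))\<^sup>2"
        using mult_right_mono[OF diag[of i], of "(cmod (w $ i))\<^sup>2"] by simp
      then show ?thesis using True \<eta> by simp
    next
      case False
      have "Re (b $ i $ j * w $ j * cnj (w $ i)) \<le> cmod (b $ i $ j * w $ j * cnj (w $ i))"
        by (rule complex_Re_le_cmod)
      also have "\<dots> = cmod (b $ i $ j) * (cmod (w $ j) * cmod (w $ i))"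
        by (simp add: norm_mult)
      also have "\<dots> \<le> \<eta> * (1 * 1)"
        using False off[of i j] \<eta> w_le by (intro mult_mono) auto
      finally show ?thesis using False by simp
    qed
  qed
  also have "\<dots> = m * (\<Sum>i\<in>UNIV. (cmod (w $ i))\<^sup>2) + (real CARD('n))\<^sup>2 * \<eta>"
    by (simp add: sum.distrib sum_distrib_left power2_eq_square)
  also have "(\<Sum>i\<in>UNIV. (cmod (w $ i))\<^sup>2) = 1"
    using w by (simp add: norm_vec_def L2_set_def)
  finally show "inner (b *v w) w \<le> m + (real CARD('n))\<^sup>2 * \<eta>" by simp
qed

text \<open>First-order optimality with an error. A step of length \<open>sqrt e\<close> from
  \<open>v\<close> towards \<open>w\<close> gains
  \<open>2 * sqrt e * cmod (cdot (a *v w) v)\<close>, while near maximality leaves room only for a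
  multiple of \<open>e\<close>.\<close>

lemma eigenframe_off_diagonal:
  fixes a :: "complex^'n^'n"
  assumes herm: "cadjoint a = a" and v: "norm v = 1" and w: "norm w = 1" and orth: "cdot v w = 0"
    and e: "0 < e" "e < 1" and C: "cmatrix_norm a \<le> C"
    and max: "\<And>s. inner (a *v (v + s *s w)) (v + s *s w)
      \<le> (inner (a *v v) v + e) * (norm (v + s *s w))\<^sup>2"
  shows "cmod (cdot (a *v w) v) \<le> sqrt e * (1 + C)"
proof (cases "cdot (a *v w) v = 0")
  case True
  have "C \<ge> 0" using C cmatrix_norm_nonneg[of a] by linarith
  then show ?thesis using True e by simp
next
  case False
  define \<gamma> where "\<gamma> = cdot (a *v w) v"
  \<comment> \<open>The phase makes the cross term real and nonnegative; the modulus
    \<open>sqrt e\<close> balances the gain against the permitted error.\<close>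
  define s where "s = complex_of_real (sqrt e) * cnj \<gamma> / cmod \<gamma>"
  have g: "cmod \<gamma> > 0" using False by (simp add: \<gamma>_def)
  have s2: "(cmod s)\<^sup>2 = e" using g e by (simp add: s_def norm_mult norm_divide)
  have "s * \<gamma> = complex_of_real (sqrt e) * (\<gamma> * cnj \<gamma>) / cmod \<gamma>"
    by (simp add: s_def mult_ac)
  then have "s * \<gamma> = complex_of_real (sqrt e * cmod \<gamma>)"
    using g unfolding complex_norm_square[symmetric] by (simp add: power2_eq_square)
  then have s\<gamma>: "Re (s * \<gamma>) = sqrt e * cmod \<gamma>" by simp
  have "(norm (v + s *s w))\<^sup>2 = (norm v)\<^sup>2 + (norm (s *s w))\<^sup>2 + 2 * Re (cdot v (s *s w))"
    unfolding Re_cdot power2_norm_eq_inner by (simp add: inner_add_left inner_add_right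
      inner_commute)
  then have norm2: "(norm (v + s *s w))\<^sup>2 = 1 + e"
    using orth by (simp add: v w norm_smult s2 power_mult_distrib)
  have "inner (a *v v) v + e * inner (a *v w) w + 2 * (sqrt e * cmod \<gamma>)
    \<le> (inner (a *v v) v + e) * (1 + e)"
    using max[of s] rayleigh_combination[OF herm, of 1 v s w] unfolding norm2
    by (simp add: s2 s\<gamma> del: times_complex.sel flip: \<gamma>_def)
  moreover have "\<bar>inner (a *v v) v\<bar> \<le> C" "\<bar>inner (a *v w) w\<bar> \<le> C"
    using rayleigh_le_norm[of a v v] rayleigh_le_norm[of a w w] v w C by auto
  moreover have "(inner (a *v v) v + e) * (1 + e)
    = inner (a *v v) v + e * (inner (a *v v) v + e + 1)"
    by (simp add: algebra_simps)
  ultimately have "2 * (sqrt e * cmod \<gamma>) \<le> e * (inner (a *v v) v + e + 1 - inner (a *v w) w)"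
    by (simp add: algebra_simps)
  also have "\<dots> \<le> e * (2 * (1 + C))"
    using e \<open>\<bar>inner (a *v v) v\<bar> \<le> C\<close> \<open>\<bar>inner (a *v w) w\<bar> \<le> C\<close> by (intro mult_left_mono) auto
  finally have "sqrt e * cmod \<gamma> \<le> e * (1 + C)" by (simp add: algebra_simps)
  also have "\<dots> = sqrt e * (sqrt e * (1 + C))" using e by (simp flip: mult.assoc)
  finally have "sqrt e * cmod \<gamma> \<le> sqrt e * (sqrt e * (1 + C))" .
  then show ?thesis using e unfolding \<gamma>_def by (simp add: mult_le_cancel_left_pos)
qed

lemma matrix_mult_add_left: "(A + B) ** C = A ** C + B ** C" for A :: "complex^'n^'m"
  by (simp add: vec_eq_iff matrix_matrix_mult_def sum.distrib distrib_right)

text \<open>In the frame, \<open>a\<close> is nearly diagonal with nearly decreasing entries, and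
  \<open>u\<close> reverses their order. So the diagonal of \<open>a + u ** a ** u\<close> adds to
  each entry its mirror image. Off-diagonal entries are at most \<open>2 * \<eta>\<close>, which
  costs \<open>2 n^2 \<eta>\<close> at each end of the spectrum. \<open>idx\<close> supplies the
  order that the index type lacks.\<close>

lemma frame_reflection:
  fixes a :: "complex^'n^'n" and v :: "nat \<Rightarrow> complex^'n" and idx :: "'n \<Rightarrow> nat"
  assumes herm: "cadjoint a = a" and C: "cmatrix_norm a \<le> C" and e: "0 < e" "e < 1"
    and idx: "bij_betw idx UNIV {..<CARD('n)}"
    and frame: "eigenframe e CARD('n) a v"
  defines "V \<equiv> (\<chi> i j. v (idx j) $ i) :: complex^'n^'n"
    and "R \<equiv> (\<chi> i j. if idx i + idx j = CARD('n) - 1 then 1 else 0) :: complex^'n^'n"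
  defines "u \<equiv> V ** R ** cadjoint V"
  shows "cadjoint u = u" "u ** u = mat 1"
    "spread (a + u ** a ** u) \<le> spread a + e + 4 * (real CARD('n))\<^sup>2 * (sqrt e * (1 + C))"
proof -
  define n where "n = CARD('n)"
  have orth: "cdot (v i) (v j) = (if i = j then 1 else 0)" if "i < CARD('n)" "j < CARD('n)" for i j
    using frame that by (simp add: eigenframe_def)
  have max: "inner (a *v w) w \<le> (inner (a *v v i) (v i) + e) * (norm w)\<^sup>2"
    if "i < CARD('n)" "\<And>j. j < i \<Longrightarrow> cdot w (v j) = 0" for i w
    using frame that by (simp add: eigenframe_def)
  have idx_less: "idx i < n" for i using idx by (auto simp: bij_betw_def n_def)
  have idx_inj: "idx i = idx j \<longleftrightarrow> i = j" for i j using idx by (auto simp: bij_betw_def dest: injD)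
  define \<rho> where "\<rho> i = inv_into UNIV idx (n - 1 - idx i)" for i
  have idx_\<rho>: "idx (\<rho> i) = n - 1 - idx i" for i
  proof -
    have "n - 1 - idx i \<in> range idx"
      using idx idx_less[of i] unfolding bij_betw_def n_def[symmetric] by auto
    then show ?thesis unfolding \<rho>_def by (rule f_inv_into_f)
  qed
  have \<rho>\<rho>: "\<rho> (\<rho> i) = i" for i
    using idx_\<rho>[of i] idx_\<rho>[of "\<rho> i"] idx_less[of i] by (simp flip: idx_inj)
  have R_nth: "R $ i $ j = (if j = \<rho> i then 1 else 0)" for i j
    using idx_\<rho>[of i] idx_less[of i] idx_less[of j] idx_inj[of j "\<rho> i"]
    by (auto simp: R_def n_def[symmetric])
  have RM: "(R ** M) $ i $ j = M $ \<rho> i $ j" for M :: "complex^'n^'n" and i j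
    by (simp add: matrix_matrix_mult_def R_nth if_distrib[of "\<lambda>z. z * _"] cong: if_cong)
  have MR: "(M ** R) $ i $ j = M $ i $ \<rho> j" for M :: "complex^'n^'n" and i j
  proof -
    have "j = \<rho> k \<longleftrightarrow> k = \<rho> j" for k using \<rho>\<rho> by metis
    then show ?thesis
      by (simp add: matrix_matrix_mult_def R_nth if_distrib[of "\<lambda>z. _ * z"] cong: if_cong)
  qed
  have RR: "R ** R = mat 1"
    by (simp add: vec_eq_iff RM R_nth \<rho>\<rho> mat_def)
  have R_adj: "cadjoint R = R"
    by (simp add: vec_eq_iff cadjoint_def R_def add.commute)
  have VV: "cadjoint V ** V = mat 1"
  proof -
    have "(cadjoint V ** V) $ i $ j = cdot (v (idx j)) (v (idx i))" for i j
      by (simp add: matrix_matrix_mult_def cadjoint_def V_def cdot_def mult.commute)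
    then show ?thesis
      using idx_less by (simp add: vec_eq_iff mat_def orth n_def idx_inj eq_commute)
  qed
  have VV': "V ** cadjoint V = mat 1" using VV unitary_other_side by blast
  show "cadjoint u = u" by (simp add: u_def cadjoint_mult R_adj matrix_mul_assoc)
  have uV: "u ** V = V ** R"
    by (simp add: u_def VV flip: matrix_mul_assoc)
  have Vu: "cadjoint V ** u = R ** cadjoint V"
    by (simp add: u_def VV matrix_mul_assoc)
  have "u ** u = (u ** V) ** (R ** cadjoint V)"
    by (simp add: u_def matrix_mul_assoc)
  also have "\<dots> = V ** (R ** R) ** cadjoint V" by (simp add: uV matrix_mul_assoc)
  finally show "u ** u = mat 1" by (simp add: RR VV')
  define M where "M = cadjoint V ** a ** V"
  have M_nth: "M $ i $ j = cdot (a *v v (idx j)) (v (idx i))" for i j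
  proof -
    have "M $ i $ j = (\<Sum>k\<in>UNIV. cnj (v (idx i) $ k) * (\<Sum>l\<in>UNIV. a $ k $ l * v (idx j) $ l))"
      unfolding M_def matrix_mul_assoc[symmetric]
      by (simp add: matrix_matrix_mult_def cadjoint_def V_def)
    then show ?thesis by (simp add: cdot_def matrix_vector_mult_def mult.commute)
  qed
  define b where "b = M + R ** M ** R"
  have "cadjoint V ** (a + u ** a ** u) ** V = M + (cadjoint V ** u) ** a ** (u ** V)"
    by (simp add: M_def matrix_add_ldistrib matrix_mult_add_left matrix_mul_assoc)
  also have "\<dots> = b" by (simp add: b_def uV Vu M_def matrix_mul_assoc)
  finally have spread_b: "spread (a + u ** a ** u) = spread b"
    using spread_conj[of "cadjoint V" "a + u ** a ** u"] VV by simp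
  define \<mu> where "\<mu> i = inner (a *v v i) (v i)" for i
  have norm_v: "norm (v i) = 1" if "i < n" for i
  proof -
    have "complex_of_real ((norm (v i))\<^sup>2) = 1"
      unfolding cdot_self[symmetric] using orth that by (simp add: n_def)
    then have "(norm (v i))\<^sup>2 = 1\<^sup>2" by (simp only: of_real_eq_1_iff) simp
    then show ?thesis by (rule power2_eq_imp_eq) auto
  qed
  have \<mu>_le: "\<mu> q \<le> \<mu> p + e" if "p \<le> q" "q < n" for p q
  proof -
    have "inner (a *v v q) (v q) \<le> (inner (a *v v p) (v p) + e) * (norm (v q))\<^sup>2"
      using that by (intro max) (auto simp: orth n_def)
    then show ?thesis using norm_v[OF that(2)] by (simp add: \<mu>_def)
  qed
  have \<mu>_spread: "\<mu> p - \<mu> q \<le> spread a" if "p < n" "q < n" for p q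
    using rayleigh_le_max_unit[OF norm_v[OF that(1)], of a]
      rayleigh_le_max_unit[OF norm_v[OF that(2)], of "- a"]
    by (simp add: \<mu>_def spread_def minus_matrix_vector_mult)
  define \<eta> where "\<eta> = sqrt e * (1 + C)"
  have C0: "C \<ge> 0" using C cmatrix_norm_nonneg[of a] by linarith
  then have \<eta>: "\<eta> \<ge> 0" using e by (simp add: \<eta>_def)
  have off: "cmod (cdot (a *v v q) (v p)) \<le> \<eta>" if "p < q" "q < n" for p q
    unfolding \<eta>_def
  proof (rule eigenframe_off_diagonal[OF herm _ _ _ e C])
    show "norm (v p) = 1" "norm (v q) = 1" using norm_v that by auto
    show "cdot (v p) (v q) = 0" using orth that by (simp add: n_def)
    show "inner (a *v (v p + s *s v q)) (v p + s *s v q)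
      \<le> (inner (a *v v p) (v p) + e) * (norm (v p + s *s v q))\<^sup>2" for s
      using that by (intro max) (auto simp: n_def orth)
  qed
  have sym: "cdot (a *v v p) (v q) = cnj (cdot (a *v v q) (v p))" for p q
    using cdot_adjoint[of a "v p" "v q"] herm by (simp add: cdot_commute)
  have M_off: "cmod (M $ i $ j) \<le> \<eta>" if "i \<noteq> j" for i j
  proof (cases "idx i < idx j")
    case True
    then show ?thesis using off[of "idx i" "idx j"] idx_less by (simp add: M_nth)
  next
    case False
    then have "idx j < idx i" using that idx_inj[of i j] by auto
    then show ?thesis
      using off[of "idx j" "idx i"] idx_less sym[of "idx j" "idx i"] by (simp add: M_nth)
  qed
  define d where "d i = \<mu> (idx i) + \<mu> (n - 1 - idx i)" for i
  have b_nth: "b $ i $ j = M $ i $ j + M $ \<rho> i $ \<rho> j" for i j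
    by (simp add: b_def RM MR)
  have b_diag: "Re (b $ i $ i) = d i" for i
    by (simp add: b_nth M_nth d_def \<mu>_def idx_\<rho> Re_cdot)
  have b_off: "cmod (b $ i $ j) \<le> 2 * \<eta>" if "i \<noteq> j" for i j
  proof -
    have "\<rho> i \<noteq> \<rho> j" using that \<rho>\<rho> by metis
    then show ?thesis
      using norm_triangle_ineq[of "M $ i $ j" "M $ \<rho> i $ \<rho> j"] M_off[OF that] M_off[of "\<rho> i" "\<rho> j"]
      by (simp add: b_nth)
  qed
  \<comment> \<open>When \<open>i\<close> comes before \<open>j\<close> in the frame, their mirror
    images come in the opposite order. So of the two differences of diagonal entries one is at most
    \<open>e\<close>, and the other is bounded by the spread.\<close>
  have d_diff: "d i - d j \<le> spread a + e" for i j
  proof (cases "idx i \<le> idx j")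
    case True
    then have "\<mu> (n - 1 - idx i) \<le> \<mu> (n - 1 - idx j) + e"
      using idx_less[of i] by (intro \<mu>_le) auto
    then show ?thesis using \<mu>_spread[of "idx i" "idx j"] idx_less by (simp add: d_def)
  next
    case False
    then have "\<mu> (idx i) \<le> \<mu> (idx j) + e" using idx_less by (intro \<mu>_le) auto
    then show ?thesis
      using \<mu>_spread[of "n - 1 - idx i" "n - 1 - idx j"] idx_less[of i] by (simp add: d_def)
  qed
  obtain i where i: "\<And>k. d k \<le> d i"
    using Max_ge[of "range d"] Max_in[of "range d"]
      by (metis UNIV_I UNIV_not_empty empty_is_image finite_imageI finite imageE rangeI)
  obtain j where j: "\<And>k. d j \<le> d k"
    using Min_le[of "range d"] Min_in[of "range d"]
      by (metis UNIV_I UNIV_not_empty empty_is_image finite_imageI finite imageE rangeI)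
  have "rayleigh_max b \<le> d i + (real CARD('n))\<^sup>2 * (2 * \<eta>)"
    using \<eta> by (intro rayleigh_max_le_diagonal) (auto simp: b_diag i b_off)
  moreover have "rayleigh_max (- b) \<le> - d j + (real CARD('n))\<^sup>2 * (2 * \<eta>)"
    using \<eta> by (intro rayleigh_max_le_diagonal) (auto simp: b_diag j b_off)
  ultimately have "spread b \<le> spread a + e + 4 * (real CARD('n))\<^sup>2 * \<eta>"
    using d_diff[of i j] unfolding spread_def[of b] by linarith
  then show "spread (a + u ** a ** u) \<le> spread a + e + 4 * (real CARD('n))\<^sup>2 * (sqrt e * (1 + C))"
    by (simp only: spread_b \<eta>_def)
qed

text \<open>Adding the scalar \<open>C0 + 1\<close> makes the form at least 1, as
  \<open>approximate_eigenframe\<close> requires. Conjugation by a reflection fixes scalars and the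
  spread ignores them, so the estimate passes back to \<open>a\<close>.\<close>

lemma reflection_field:
  fixes a :: "'a \<Rightarrow> complex^'n^'n"
  assumes X: "compact_space X" and top: "has_top_fields X TYPE('n)" and a: "hermitian_field X a"
    and \<epsilon>: "\<epsilon> > 0"
  obtains u where "continuous_map X euclidean u"
    "\<And>x. x \<in> topspace X \<Longrightarrow> cadjoint (u x) = u x"
    "\<And>x. x \<in> topspace X \<Longrightarrow> u x ** u x = mat 1"
    "\<And>x. x \<in> topspace X \<Longrightarrow> spread (a x + u x ** a x ** u x) \<le> spread (a x) + \<epsilon>"
proof -
  obtain C0 where C0: "C0 \<ge> 0" "\<And>x. x \<in> topspace X \<Longrightarrow> cmatrix_norm (a x) \<le> C0"
    using continuous_matrix_field_bounded[OF X] a unfolding hermitian_field_def by blast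
  define c where "c = complex_of_real (C0 + 1)"
  define b where "b x = a x + mat c" for x
  have b: "hermitian_field X b"
    using a unfolding hermitian_field_def b_def c_def continuous_map_iff_tendsto
    by (auto intro!: tendsto_intros)
  obtain C where C: "C \<ge> 0" "\<And>x. x \<in> topspace X \<Longrightarrow> cmatrix_norm (b x) \<le> C"
    using continuous_matrix_field_bounded[OF X] b unfolding hermitian_field_def by blast
  have pos: "1 \<le> inner (b x *v w) w" if "x \<in> topspace X" "norm w = 1" for x w
  proof -
    have "inner (b x *v w) w = inner (a x *v w) w + (C0 + 1)"
      unfolding b_def c_def using that(2)
      by (simp only: matrix_vector_mult_add_rdistrib mat_vector_mult inner_add_left
          scaleR_eq_smult[symmetric] inner_scaleR_left dot_square_norm) simp
    moreover have "\<bar>inner (a x *v w) w\<bar> \<le> C0"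
      using rayleigh_le_norm[of "a x" w w] that C0(2)[of x] by simp
    ultimately show ?thesis by linarith
  qed
  \<comment> \<open>The error of the frame is \<open>e + 4 n^2 sqrt e (1 + C)\<close> with
    \<open>n = CARD('n)\<close>. For \<open>e = s^2\<close> with \<open>s < 1\<close> it is at most
    \<open>s * K\<close>, and \<open>s\<close> is chosen to make this at most
    \<open>\<epsilon>\<close>.\<close>
  define K where "K = 2 + 4 * (real CARD('n))\<^sup>2 * (1 + C)"
  have K: "K \<ge> 2" using C(1) by (simp add: K_def)
  define s where "s = min (1/2) (\<epsilon> / K)"
  have s: "0 < s" "s < 1" "s * K \<le> \<epsilon>"
    using \<epsilon> K by (auto simp: s_def min_def field_simps)
  define e where "e = s\<^sup>2"
  have e: "0 < e" "e < 1" "sqrt e = s"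
    using s by (auto simp: e_def power_less_one_iff)
  have "e \<le> s" using s by (simp add: e_def power2_eq_square mult_left_le)
  obtain v where v_cont: "\<forall>i<CARD('n). continuous_map X euclidean (v i)"
    and v: "\<forall>x\<in>topspace X. eigenframe e CARD('n) (b x) (\<lambda>i. v i x)"
    using approximate_eigenframe[OF top b pos e(1,2) order_refl] by auto
  obtain idx :: "'n \<Rightarrow> nat" where idx: "bij_betw idx UNIV {..<CARD('n)}"
    using ex_bij_betw_finite_nat[of "UNIV :: 'n set"] by (auto simp: atLeast0LessThan)
  define V where "V x = ((\<chi> i j. v (idx j) x $ i) :: complex^'n^'n)" for x
  define R where "R = ((\<chi> i j. if idx i + idx j = CARD('n) - 1 then 1 else 0) :: complex^'n^'n)"
  define u where "u x = V x ** R ** cadjoint (V x)" for x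
  have u: "cadjoint (u x) = u x" "u x ** u x = mat 1"
    "spread (b x + u x ** b x ** u x) \<le> spread (b x) + e + 4 * (real CARD('n))\<^sup>2 * (sqrt e * (1
      + C))"
    if x: "x \<in> topspace X" for x
    using frame_reflection[of "b x" C e idx "\<lambda>i. v i x"] b C(2)[OF x] e(1,2) idx v x
    unfolding hermitian_field_def u_def V_def R_def by blast+
  show ?thesis
  proof (rule that[of u])
    have "idx j < CARD('n)" for j using idx by (auto simp: bij_betw_def)
    then have "(V \<longlongrightarrow> V x) (atin X x)" if "x \<in> topspace X" for x
      using v_cont that unfolding V_def continuous_map_iff_tendsto
      by (intro vec_tendstoI) (auto intro!: tendsto_intros)
    then show "continuous_map X euclidean u"
      unfolding continuous_map_iff_tendsto u_def by (auto intro!: tendsto_intros)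
    fix x assume x: "x \<in> topspace X"
    show "cadjoint (u x) = u x" "u x ** u x = mat 1" using u[OF x] by auto
    have mat_comm: "mat c ** u x = u x ** mat c"
      by (simp add: matrix_matrix_mult_def mat_def vec_eq_iff if_distrib if_distribR cong: if_cong)
    have "u x ** mat c ** u x = mat c ** (u x ** u x)"
      by (simp only: mat_comm[symmetric] matrix_mul_assoc)
    then have uc: "u x ** mat c ** u x = mat c" using u(2)[OF x] by simp
    have "mat c + mat c = (mat (complex_of_real (2 * (C0 + 1))) :: complex^'n^'n)"
      by (simp add: c_def vec_eq_iff mat_def)
    then have "b x + u x ** b x ** u x = (a x + u x ** a x ** u x) + mat (complex_of_real (2 * (C0
      + 1)))"
      by (simp add: b_def matrix_add_ldistrib matrix_mult_add_left uc)
    then have "spread (a x + u x ** a x ** u x) = spread (b x + u x ** b x ** u x)"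
      by (simp only: spread_add_mat)
    also have "\<dots> \<le> spread (b x) + (e + 4 * (real CARD('n))\<^sup>2 * (sqrt e * (1 + C)))"
      using u(3)[OF x] by simp
    also have "spread (b x) = spread (a x)" unfolding b_def c_def by (rule spread_add_mat)
    also have "e + 4 * (real CARD('n))\<^sup>2 * (sqrt e * (1 + C)) \<le> s * K"
      using e(3) s(1) \<open>e \<le> s\<close> by (simp add: K_def algebra_simps)
    finally show "spread (a x + u x ** a x ** u x) \<le> spread (a x) + \<epsilon>" using s(3) by simp
  qed
qed

section \<open>Mixing by few unitary fields\<close>

definition unitary_field :: "'a topology \<Rightarrow> ('a \<Rightarrow> complex^'n^'n) \<Rightarrow> bool" where
  "unitary_field X u \<longleftrightarrow> continuous_map X euclidean u \<and>
    (\<forall>x\<in>topspace X. cadjoint (u x) ** u x = mat 1)"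

text \<open>
  Averaging with the conjugate by \<open>u\<close> halves the spread, and averaging the result with its
  conjugate by \<open>w\<close> halves it once more.
\<close>

definition good_pair :: "real \<Rightarrow> complex^'n^'n \<Rightarrow> complex^'n^'n \<Rightarrow> complex^'n^'n \<Rightarrow> bool" where
  "good_pair e a u w \<longleftrightarrow> (let b = a + u ** a ** cadjoint u
    in spread b \<le> spread a + e \<and> spread (b + w ** b ** cadjoint w) \<le> spread a + e)"

text \<open>Parts (i) and (ii) differ only in the value of \<open>k\<close>. The pair that is good
  may change with the point; the other pairs are only unitary, which keeps their cost under control.
  The colours that count are numbered from 1.\<close>

definition mixing :: "'a topology \<Rightarrow> nat \<Rightarrow> 'n::finite itself \<Rightarrow> bool" where
  "mixing X k T \<longleftrightarrow> (\<forall>(a :: 'a \<Rightarrow> complex^'n^'n) e. hermitian_field X a \<longrightarrow> e > 0 \<longrightarrow>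
    (\<exists>u w. (\<forall>i. unitary_field X (u i) \<and> unitary_field X (w i)) \<and>
      (\<forall>x\<in>topspace X. \<exists>i\<in>{1..k}. good_pair e (a x) (u i x) (w i x))))"

lemma mixing_1_if_top_fields:
  assumes X: "compact_space X" and top: "has_top_fields X TYPE('n::finite)"
  shows "mixing X 1 TYPE('n)"
  unfolding mixing_def
proof (intro allI impI)
  fix a :: "'a \<Rightarrow> complex^'n^'n" and e :: real
  assume a: "hermitian_field X a" and "e > 0"
  then have e: "e/2 > 0" by simp
  obtain u where u: "continuous_map X euclidean u" "\<And>x. x \<in> topspace X \<Longrightarrow> cadjoint (u x) = u x"
    "\<And>x. x \<in> topspace X \<Longrightarrow> u x ** u x = mat 1"
    "\<And>x. x \<in> topspace X \<Longrightarrow> spread (a x + u x ** a x ** u x) \<le> spread (a x) + e/2"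
    using reflection_field[OF X top a e] by blast
  define b where "b x = a x + u x ** a x ** u x" for x
  have "hermitian_field X b"
    using a u(1,2) unfolding hermitian_field_def b_def continuous_map_iff_tendsto
    by (auto intro!: tendsto_intros simp: cadjoint_mult matrix_mul_assoc)
  then obtain w where w: "continuous_map X euclidean w" "\<And>x. x \<in> topspace X \<Longrightarrow> cadjoint (w x) = w x"
    "\<And>x. x \<in> topspace X \<Longrightarrow> w x ** w x = mat 1"
    "\<And>x. x \<in> topspace X \<Longrightarrow> spread (b x + w x ** b x ** w x) \<le> spread (b x) + e/2"
    using reflection_field[OF X top _ e] by blast
  have "spread (b x) \<le> spread (a x) + e" "spread (b x + w x ** b x ** w x) \<le> spread (a x) + e"
    if "x \<in> topspace X" for x
    using u(4)[OF that] w(4)[OF that] \<open>e > 0\<close> unfolding b_def[symmetric] by linarith+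
  moreover have "unitary_field X u" "unitary_field X w"
    using u w by (simp_all add: unitary_field_def)
  ultimately show "\<exists>u w. (\<forall>i::nat. unitary_field X (u i) \<and> unitary_field X (w i)) \<and>
      (\<forall>x\<in>topspace X. \<exists>i\<in>{1..1}. good_pair e (a x) (u i x) (w i x))"
    using u(2) w(2) by (intro exI[of _ "\<lambda>i. u"] exI[of _ "\<lambda>i. w"]) (simp add: good_pair_def
      Let_def b_def)
qed

text \<open>
  The sets of the \<open>i\<close>-th colour are indexed by the \<open>i\<close>-element subsets \<open>F\<close> of a finite refinement:
  those points where the functions of \<open>F\<close> are positive and exceed all the others.
\<close>

lemma colored_bumps:
  fixes U :: "'i \<Rightarrow> 'a set"
  assumes X: "compact_space X" "Hausdorff_space X" and dim: "covering_multiplicity_le X k"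
    and U: "\<And>p. p \<in> I \<Longrightarrow> openin X (U p)" "topspace X \<subseteq> (\<Union>p\<in>I. U p)"
  obtains \<F> :: "nat \<Rightarrow> 'a set set set" and \<theta> :: "'a set set \<Rightarrow> 'a \<Rightarrow> real" and p :: "'a set set \<Rightarrow> 'i"
  where "\<And>i. finite (\<F> i)" "\<And>F. continuous_map X euclideanreal (\<theta> F)"
    "\<And>i F x. 1 \<le> i \<Longrightarrow> F \<in> \<F> i \<Longrightarrow> x \<in> topspace X \<Longrightarrow> \<theta> F x \<noteq> 0 \<Longrightarrow> p F \<in> I \<and> x \<in> U (p F)"
    "\<And>i F G x. F \<in> \<F> i \<Longrightarrow> G \<in> \<F> i \<Longrightarrow> F \<noteq> G \<Longrightarrow> \<theta> F x = 0 \<or> \<theta> G x = 0"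
    "\<And>x. x \<in> topspace X \<Longrightarrow> \<exists>i\<in>{1..k}. \<exists>F\<in>\<F> i. \<theta> F x = 1"
proof -
  obtain \<V> where \<V>: "finite \<V>" "open_cover X \<V>" "\<And>V. V \<in> \<V> \<Longrightarrow> \<exists>q\<in>I. V \<subseteq> U q"
    and mult: "\<And>x. x \<in> topspace X \<Longrightarrow> card {V\<in>\<V>. x \<in> V} \<le> k"
    using covering_multiplicity_refine[OF X(1) dim U] by blast
  then obtain q where q: "\<And>V. V \<in> \<V> \<Longrightarrow> q V \<in> I \<and> V \<subseteq> U (q V)" by metis
  obtain \<V>' f where f: "finite \<V>'" "\<V>' \<subseteq> \<V>" "\<And>V. continuous_map X euclideanreal (f V)"
      "\<And>V x. x \<in> topspace X \<Longrightarrow> 0 \<le> f V x"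
      "\<And>V x. x \<in> topspace X \<Longrightarrow> x \<notin> V \<Longrightarrow> f V x = 0"
      "\<And>x. x \<in> topspace X \<Longrightarrow> (\<Sum>V\<in>\<V>'. f V x) = 1"
    using partition_of_unity[OF X \<V>(2)] by metis
  define \<F> where "\<F> i = {F. F \<subseteq> \<V>' \<and> card F = i}" for i :: nat
  \<comment> \<open>A continuous function whose support condition is exactly that every weight in
    \<open>F\<close> is positive and exceeds every weight outside \<open>F\<close>.\<close>
  define \<rho> where "\<rho> F x = (\<Prod>V\<in>F. max 0 (f V x)) * (\<Prod>V\<in>F. \<Prod>W\<in>\<V>' - F. max 0 (f V x - f W x))" for F x
  define \<F>\<^sub>k where "\<F>\<^sub>k = {F. F \<subseteq> \<V>' \<and> card F \<in> {1..k}}"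
  have fin: "finite (\<F> i)" "finite \<F>\<^sub>k" for i using f(1) by (simp_all add: \<F>_def \<F>\<^sub>k_def)
  have fin': "finite F" if "F \<in> \<F> i" for F i
    using that f(1) finite_subset by (auto simp: \<F>_def)
  have \<rho>_nonneg: "\<rho> F x \<ge> 0" for F x
    unfolding \<rho>_def by (intro mult_nonneg_nonneg prod_nonneg) auto
  have \<rho>_iff: "\<rho> F x \<noteq> 0 \<longleftrightarrow> (\<forall>V\<in>F. f V x > 0 \<and> (\<forall>W\<in>\<V>'-F. f W x < f V x))" if "F \<in> \<F> i" for F i x
  proof -
    have *: "max 0 y = 0 \<longleftrightarrow> \<not> y > 0" for y :: real by (simp add: max_def)
    have "finite F" "finite (\<V>' - F)" using fin'[OF that] f(1) by auto
    then show ?thesis unfolding \<rho>_def mult_eq_0_iff de_Morgan_disj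
      by (simp only: prod_zero_iff *) auto
  qed
  define \<sigma> where "\<sigma> x = (\<Sum>F\<in>\<F>\<^sub>k. \<rho> F x)" for x
  have \<sigma>_pos: "\<sigma> x > 0" if x: "x \<in> topspace X" for x
  proof -
    \<comment> \<open>The set of all positive weights qualifies: the weights outside it are 0, and
      the multiplicity bounds its size by \<open>k\<close>.\<close>
    define F where "F = {V \<in> \<V>'. f V x > 0}"
    have "F \<subseteq> {V\<in>\<V>. x \<in> V}" using f(2,5) x by (force simp: F_def)
    then have "card F \<le> k" using mult[OF x] card_mono[of "{V\<in>\<V>. x \<in> V}" F] \<V>(1) by simp
    moreover have "F \<noteq> {}"
    proof
      assume "F = {}"
      then have "f V x = 0" if "V \<in> \<V>'" for V using f(4)[OF x, of V] that by (auto simp: F_def)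
      then show False using f(6)[OF x] by simp
    qed
    moreover have "finite F" using f(1) by (simp add: F_def)
    ultimately have F: "F \<in> \<F>\<^sub>k" "F \<in> \<F> (card F)"
      using card_gt_0_iff[of F] by (auto simp: \<F>\<^sub>k_def \<F>_def F_def)
    have "\<rho> F x \<noteq> 0"
      unfolding \<rho>_iff[OF F(2)] using f(4)[OF x] by (force simp: F_def)
    then have "\<rho> F x > 0" using \<rho>_nonneg[of F x] by simp
    then show ?thesis unfolding \<sigma>_def using fin(2) F(1) \<rho>_nonneg by (intro sum_pos2) auto
  qed
  \<comment> \<open>The largest of the \<open>N\<close> summands of \<open>\<sigma>\<close> is at
    least their mean, so \<open>N * \<rho> F x / \<sigma> x\<close> reaches 1 for some
    \<open>F\<close>. Truncating at 1 then makes \<open>\<theta> F x\<close> exactly 1, where the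
    rotation arrives at its end point.\<close>
  define N where "N = real (card \<F>\<^sub>k)"
  define \<theta> where "\<theta> F x = min 1 (N * \<rho> F x / \<sigma> x)" for F x
  have \<rho>_cont: "(\<rho> F \<longlongrightarrow> \<rho> F x) (atin X x)" if "x \<in> topspace X" for F x
    unfolding \<rho>_def using f(3) that unfolding continuous_map_iff_tendsto
    by (intro tendsto_intros) auto
  have \<theta>_zero: "\<rho> F x \<noteq> 0" if "\<theta> F x \<noteq> 0" for F x
    using that by (auto simp: \<theta>_def)
  show ?thesis
  proof (rule that[of \<F> \<theta> "\<lambda>F. q (SOME V. V \<in> F)"])
    show "finite (\<F> i)" for i by (rule fin)
    show "continuous_map X euclideanreal (\<theta> F)" for F
      unfolding continuous_map_iff_tendsto
    proof
      fix x assume x: "x \<in> topspace X"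
      have "(\<sigma> \<longlongrightarrow> \<sigma> x) (atin X x)" unfolding \<sigma>_def by (intro tendsto_intros \<rho>_cont x)
      then show "(\<theta> F \<longlongrightarrow> \<theta> F x) (atin X x)"
        unfolding \<theta>_def using \<sigma>_pos[OF x] by (intro tendsto_intros \<rho>_cont x) auto
    qed
    show "q (SOME V. V \<in> F) \<in> I \<and> x \<in> U (q (SOME V. V \<in> F))"
      if "1 \<le> i" "F \<in> \<F> i" "x \<in> topspace X" "\<theta> F x \<noteq> 0" for i F x
    proof -
      define V where "V = (SOME V. V \<in> F)"
      have "F \<noteq> {}" using that(1,2) by (auto simp: \<F>_def)
      then have V: "V \<in> F" unfolding V_def by (simp add: some_in_eq)
      then have "f V x > 0" using \<rho>_iff[OF that(2), of x] \<theta>_zero[OF that(4)] by blast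
      then have "x \<in> V" using f(5)[OF that(3), of V] by auto
      moreover have "V \<in> \<V>" using V that(2) f(2) by (auto simp: \<F>_def)
      ultimately show ?thesis using q[of V] unfolding V_def by blast
    qed
    show "\<theta> F x = 0 \<or> \<theta> G x = 0" if FG: "F \<in> \<F> i" "G \<in> \<F> i" "F \<noteq> G" for i F G x
    proof (rule ccontr)
      assume "\<not> (\<theta> F x = 0 \<or> \<theta> G x = 0)"
      then have *: "\<forall>V\<in>F. \<forall>W\<in>\<V>'-F. f W x < f V x" "\<forall>V\<in>G. \<forall>W\<in>\<V>'-G. f W x < f V x"
        using \<rho>_iff[OF FG(1), of x] \<rho>_iff[OF FG(2), of x] \<theta>_zero[of F x] \<theta>_zero[of G x] by blast+
      have "card F = card G" using FG by (simp add: \<F>_def)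
      \<comment> \<open>Different sets of equal size each contain an element missing in the other,
        and each of the two weights would have to exceed the other.\<close>
      then have "\<not> F \<subseteq> G" "\<not> G \<subseteq> F"
        using card_subset_eq[OF fin'[OF FG(2)], of F] card_subset_eq[OF fin'[OF FG(1)], of G]
          FG(3) by auto
      then obtain V W where "V \<in> F" "V \<notin> G" "W \<in> G" "W \<notin> F" by blast
      moreover have "V \<in> \<V>'" "W \<in> \<V>'" using FG calculation by (auto simp: \<F>_def)
      ultimately have "f W x < f V x" "f V x < f W x" using * by blast+
      then show False by simp
    qed
    show "\<exists>i\<in>{1..k}. \<exists>F\<in>\<F> i. \<theta> F x = 1" if x: "x \<in> topspace X" for x
    proof -
      have "\<exists>F\<in>\<F>\<^sub>k. \<sigma> x \<le> N * \<rho> F x"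
      proof (rule ccontr)
        assume "\<not> ?thesis"
        then have less: "\<And>F. F \<in> \<F>\<^sub>k \<Longrightarrow> N * \<rho> F x < \<sigma> x" by (simp add: not_le)
        have "\<F>\<^sub>k \<noteq> {}" using \<sigma>_pos[OF x] by (auto simp: \<sigma>_def)
        then have "(\<Sum>F\<in>\<F>\<^sub>k. N * \<rho> F x) < (\<Sum>F\<in>\<F>\<^sub>k. \<sigma> x)"
          using fin(2) less by (intro sum_strict_mono) auto
        then show False by (simp add: N_def flip: sum_distrib_left \<sigma>_def)
      qed
      then obtain F where F: "F \<in> \<F>\<^sub>k" "\<sigma> x \<le> N * \<rho> F x" by blast
      then have "\<theta> F x = 1" using \<sigma>_pos[OF x] by (simp add: \<theta>_def min_def divide_le_eq)
      then show ?thesis using F(1)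
        by (intro bexI[of _ "card F"] bexI[of _ F]) (auto simp: \<F>\<^sub>k_def \<F>_def)
    qed
  qed
qed

section \<open>Paths of unitaries and gluing within one colour\<close>

lemma mat_mult_left: "mat c ** A = (\<chi> i j. c * A $ i $ j)" for A :: "complex^'m^'n"
  by (simp add: matrix_matrix_mult_def mat_def vec_eq_iff if_distrib[of "\<lambda>z. z * _"] cong: if_cong)

lemma mat_mult_right: "A ** mat c = (\<chi> i j. A $ i $ j * c)" for A :: "complex^'n^'m"
  by (simp add: matrix_matrix_mult_def mat_def vec_eq_iff if_distrib[of "\<lambda>z. _ * z"] cong: if_cong)

text \<open>
  A path of unitaries from 1 to \<open>J\<close>. It is used for \<open>J = \<i> u\<close> with a reflection \<open>u\<close>;
  conjugation by \<open>J\<close> is the same as conjugation by \<open>u\<close>.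
\<close>

definition rotation :: "complex^'n^'n \<Rightarrow> real \<Rightarrow> complex^'n^'n" where
  "rotation J t = cos (pi / 2 * t) *\<^sub>R mat 1 + sin (pi / 2 * t) *\<^sub>R J"

lemma rotation_0 [simp]: "rotation J 0 = mat 1" and rotation_1 [simp]: "rotation J 1 = J"
  by (simp_all add: rotation_def)

lemma matrix_mult_diff_left: "(A - B) ** C = A ** C - B ** C" for A :: "complex^'n^'m"
  by (simp add: vec_eq_iff matrix_matrix_mult_def sum_subtractf left_diff_distrib)

lemma rotation_unitary:
  assumes "cadjoint J = - J" "J ** J = - mat 1"
  shows "cadjoint (rotation J t) ** rotation J t = mat 1"
proof -
  define c s where "c = cos (pi / 2 * t)" and "s = sin (pi / 2 * t)"
  have "cadjoint (rotation J t) ** rotation J t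
      = (c *\<^sub>R mat 1 + s *\<^sub>R (- J)) ** (c *\<^sub>R mat 1 + s *\<^sub>R J)"
    by (simp add: rotation_def assms(1) c_def s_def)
  also have "\<dots> = (c * c) *\<^sub>R mat 1 + (s * s) *\<^sub>R mat 1"
    by (simp add: matrix_add_ldistrib matrix_mult_diff_left scaleR_matrix_mult assms(2)
        scaleR_right_diff_distrib scaleR_right_distrib mult.commute[of s c])
  also have "\<dots> = (c * c + s * s) *\<^sub>R mat 1" by (simp only: scaleR_left_distrib)
  also have "c * c + s * s = 1" using sin_cos_squared_add2[of "pi / 2 * t"]
    by (simp add: c_def s_def power2_eq_square)
  finally show ?thesis by simp
qed

text \<open>Within one colour at most one \<open>\<theta> F\<close> is nonzero at a point, so at
  most one summand differs from 0 and \<open>u\<close> is a single rotation or the identity there.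
  The sum shows at once that \<open>u\<close> is continuous everywhere.\<close>

lemma glue_rotations:
  fixes \<theta> :: "'b \<Rightarrow> 'a \<Rightarrow> real" and J :: "'b \<Rightarrow> complex^'n^'n"
  assumes fin: "finite \<F>" and cont: "\<And>F. F \<in> \<F> \<Longrightarrow> continuous_map X euclideanreal (\<theta> F)"
    and disj: "\<And>F G x. F \<in> \<F> \<Longrightarrow> G \<in> \<F> \<Longrightarrow> F \<noteq> G \<Longrightarrow> \<theta> F x = 0 \<or> \<theta> G x = 0"
    and J: "\<And>F. F \<in> \<F> \<Longrightarrow> cadjoint (J F) = - J F \<and> J F ** J F = - mat 1"
  obtains u where "unitary_field X u" "\<And>F x. F \<in> \<F> \<Longrightarrow> \<theta> F x = 1 \<Longrightarrow> u x = J F"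
proof -
  define u where "u x = mat 1 + (\<Sum>F\<in>\<F>. rotation (J F) (\<theta> F x) - mat 1)" for x
  have u_eq: "u x = rotation (J F) (\<theta> F x)" if F: "F \<in> \<F>" "\<theta> F x \<noteq> 0" for F x
  proof -
    have "(\<Sum>G\<in>\<F> - {F}. rotation (J G) (\<theta> G x) - mat 1) = 0"
      using disj[OF F(1), of _ x] F(2) by (intro sum.neutral) fastforce
    then show ?thesis by (simp add: u_def sum.remove[OF fin F(1)])
  qed
  have "cadjoint (u x) ** u x = mat 1" for x
  proof (cases "\<exists>F\<in>\<F>. \<theta> F x \<noteq> 0")
    case True
    then obtain F where F: "F \<in> \<F>" "\<theta> F x \<noteq> 0" by blast
    show ?thesis unfolding u_eq[OF F] using J[OF F(1)] by (intro rotation_unitary) auto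
  next
    case False
    then have "u x = mat 1" by (simp add: u_def)
    then show ?thesis by simp
  qed
  moreover have "continuous_map X euclidean u"
  proof -
    have "(\<theta> F \<longlongrightarrow> \<theta> F x) (atin X x)" if "F \<in> \<F>" "x \<in> topspace X" for F x
      using cont that unfolding continuous_map_iff_tendsto by blast
    then show ?thesis
      unfolding continuous_map_iff_tendsto u_def rotation_def
      by (intro ballI tendsto_intros isCont_tendsto_compose[OF DERIV_isCont[OF DERIV_cos]]
          isCont_tendsto_compose[OF DERIV_isCont[OF DERIV_sin]])
  qed
  ultimately show ?thesis
    using u_eq by (intro that[of u]) (auto simp: unitary_field_def)
qed

text \<open>The field version applied to a one-point space. Multiplying a reflection by
  \<open>\<i>\<close> gives a skew-adjoint square root of -1, from which a path to the identity
  starts. Two errors of \<open>e/4\<close> leave strict inequalities, which persist on a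
  neighbourhood.\<close>

lemma local_reflections:
  fixes a :: "complex^'n^'n"
  assumes a: "cadjoint a = a" and e: "e > 0"
  obtains J K :: "complex^'n^'n" where "cadjoint J = - J" "J ** J = - mat 1" "cadjoint K = - K"
    "K ** K = - mat 1"
    "spread (a + J ** a ** cadjoint J) < spread a + e"
    "spread ((a + J ** a ** cadjoint J) + K ** (a
      + J ** a ** cadjoint J) ** cadjoint K) < spread a + e"
proof -
  have refl: "\<exists>J::complex^'n^'n. cadjoint J = - J \<and> J ** J = - mat 1 \<and>
    spread (b + J ** b ** cadjoint J) \<le> spread b + e/4"
    if "cadjoint b = b" for b :: "complex^'n^'n"
  proof -
    have "hermitian_field (discrete_topology {0::nat}) (\<lambda>x. b)"
      using that by (simp add: hermitian_field_def)
    moreover have "compact_space (discrete_topology {0::nat})"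
      by (simp add: compact_space_discrete_topology)
    moreover have "e/4 > 0" using e by simp
    ultimately obtain u where u: "cadjoint (u 0) = u 0" "u 0 ** u 0 = mat 1"
      "spread (b + u 0 ** b ** u 0) \<le> spread b + e/4"
      using reflection_field[OF _ has_top_fields_point, of "0::nat" "\<lambda>x. b" "e/4"]
      by (metis singletonI topspace_discrete_topology)
    define J where "J = mat \<i> ** u 0"
    have comm: "mat c ** A = A ** mat c" for c and A :: "complex^'n^'n"
      by (simp add: mat_mult_left mat_mult_right mult.commute)
    have ii: "mat \<i> ** mat \<i> = (- mat 1 :: complex^'n^'n)" "mat (- \<i>) = (- mat \<i> :: complex^'n^'n)"
      by (simp_all add: mat_mult_left) (simp_all add: mat_def vec_eq_iff)
    have adj: "cadjoint J = - J"
      using u(1) by (simp add: J_def cadjoint_mult ii(2) matrix_mult_minus comm)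
    have "J ** A ** J = - (u 0 ** A ** u 0)" for A
    proof -
      have "J ** A ** J = mat \<i> ** (u 0 ** A ** mat \<i>) ** u 0"
        by (simp only: J_def matrix_mul_assoc)
      also have "u 0 ** A ** mat \<i> = mat \<i> ** (u 0 ** A)" by (rule comm[symmetric])
      also have "mat \<i> ** (mat \<i> ** (u 0 ** A)) ** u 0 = (mat \<i> ** mat \<i>) ** (u 0 ** A ** u 0)"
        by (simp only: matrix_mul_assoc)
      finally have "J ** A ** J = (mat \<i> ** mat \<i>) ** (u 0 ** A ** u 0)" .
      then show ?thesis by (simp add: ii(1) matrix_mult_minus)
    qed
    from this[of "mat 1"] this[of b] u(2,3) adj show ?thesis
      by (intro exI[of _ J]) (simp add: matrix_mult_minus)
  qed
  obtain J :: "complex^'n^'n" where J: "cadjoint J = - J" "J ** J = - mat 1"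
    "spread (a + J ** a ** cadjoint J) \<le> spread a + e/4"
    using refl[OF a] by blast
  have "cadjoint (a + J ** a ** cadjoint J) = a + J ** a ** cadjoint J"
    by (simp add: cadjoint_mult a matrix_mul_assoc)
  from refl[OF this] obtain K where K: "cadjoint K = - K" "K ** K = - mat 1"
    "spread ((a + J ** a ** cadjoint J) + K ** (a + J ** a ** cadjoint J) ** cadjoint K)
      \<le> spread (a + J ** a ** cadjoint J) + e/4" by blast
  show ?thesis by (rule that[OF J(1,2) K(1,2)]) (use J(3) K(3) e in linarith)+
qed

text \<open>A pair \<open>J\<close>, \<open>K\<close> good at one point stays good, as constant
  matrices, on the open set \<open>U J K\<close>, by continuity of the spread. Coloured bumps
  subordinate to these sets switch the constants on, and \<open>\<theta> F = 1\<close> for some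
  \<open>F\<close> of some colour at every point.\<close>

lemma mixing_if_covering_multiplicity:
  assumes X: "compact_space X" "Hausdorff_space X" and dim: "covering_multiplicity_le X k"
  shows "mixing X k TYPE('n::finite)"
  unfolding mixing_def
proof (intro allI impI)
  fix a :: "'a \<Rightarrow> complex^'n^'n" and e :: real
  assume a: "hermitian_field X a" and e: "e > 0"
  define b where "b J x = a x + J ** a x ** cadjoint J" for J x
  define U where "U J K = {x \<in> topspace X. spread (a x) - spread (b J x) \<in> {-e<..} \<and>
    spread (a x) - spread (b J x + K ** b J x ** cadjoint K) \<in> {-e<..}}" for J K
  have "\<exists>JK. cadjoint (fst JK) = - fst JK \<and> fst JK ** fst JK = - mat 1 \<and>
      cadjoint (snd JK) = - snd JK \<and> snd JK ** snd JK = - mat 1 \<and> x \<in> U (fst JK) (snd JK)"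
    if x: "x \<in> topspace X" for x
  proof -
    have "cadjoint (a x) = a x" using a x by (simp add: hermitian_field_def)
    from local_reflections[OF this e] obtain J K where
      "cadjoint J = - J" "J ** J = - mat 1" "cadjoint K = - K" "K ** K = - mat 1"
      "spread (b J x) < spread (a x) + e" "spread (b J x
        + K ** b J x ** cadjoint K) < spread (a x) + e"
      unfolding b_def by metis
    then show ?thesis using x by (intro exI[of _ "(J, K)"]) (simp add: U_def)
  qed
  then obtain JK where JK: "\<And>x. x \<in> topspace X \<Longrightarrow> cadjoint (fst (JK x)) = - fst (JK x) \<and>
      fst (JK x) ** fst (JK x) = - mat 1 \<and> cadjoint (snd (JK x)) = - snd (JK x) \<and>
      snd (JK x) ** snd (JK x) = - mat 1 \<and> x \<in> U (fst (JK x)) (snd (JK x))"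
    by metis
  have op: "openin X (U J K)" for J K
  proof -
    have lim: "(a \<longlongrightarrow> a x) (atin X x)" if "x \<in> topspace X" for x
      using a that unfolding hermitian_field_def continuous_map_iff_tendsto by blast
    have "continuous_map X euclideanreal (\<lambda>x. spread (a x) - spread (b J x))"
      and "continuous_map X euclideanreal (\<lambda>x. spread (a x) - spread (b J x
        + K ** b J x ** cadjoint K))"
      unfolding continuous_map_iff_tendsto b_def by (auto intro!: tendsto_intros lim)
    from this[THEN openin_continuous_map_preimage, of "{-e<..}"] have "openin X {x \<in> topspace X.
      spread (a x) - spread (b J x) \<in> {-e<..}}"
      "openin X {x \<in> topspace X. spread (a x) - spread (b J x
        + K ** b J x ** cadjoint K) \<in> {-e<..}}"
      by (simp_all only: open_openin[symmetric] open_greaterThan True_implies_equals)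
    moreover have "U J K = {x \<in> topspace X. spread (a x) - spread (b J x) \<in> {-e<..}} \<inter>
        {x \<in> topspace X. spread (a x) - spread (b J x + K ** b J x ** cadjoint K) \<in> {-e<..}}"
      unfolding U_def by blast
    ultimately show ?thesis by (simp only: openin_Int)
  qed
  have cov: "topspace X \<subseteq> (\<Union>p\<in>topspace X. U (fst (JK p)) (snd (JK p)))"
    using JK by blast
  show "\<exists>u w. (\<forall>i. unitary_field X (u i) \<and> unitary_field X (w i)) \<and>
      (\<forall>x\<in>topspace X. \<exists>i\<in>{1..k}. good_pair e (a x) (u i x) (w i x))"
  proof (rule colored_bumps[OF X dim op cov])
    fix \<F> :: "nat \<Rightarrow> 'a set set set" and \<theta> :: "'a set set \<Rightarrow> 'a \<Rightarrow> real" and p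
    assume \<F>: "\<And>i. finite (\<F> i)" "\<And>F. continuous_map X euclideanreal (\<theta> F)"
      "\<And>i F x. 1 \<le> i \<Longrightarrow> F \<in> \<F> i \<Longrightarrow> x \<in> topspace X \<Longrightarrow> \<theta> F x \<noteq> 0 \<Longrightarrow>
        p F \<in> topspace X \<and> x \<in> U (fst (JK (p F))) (snd (JK (p F)))"
      "\<And>i F G x. F \<in> \<F> i \<Longrightarrow> G \<in> \<F> i \<Longrightarrow> F \<noteq> G \<Longrightarrow> \<theta> F x = 0 \<or> \<theta> G x = 0"
      "\<And>x. x \<in> topspace X \<Longrightarrow> \<exists>i\<in>{1..k}. \<exists>F\<in>\<F> i. \<theta> F x = 1"
    have "\<exists>u w. unitary_field X u \<and> unitary_field X w \<and>
        (\<forall>F\<in>\<F> i. \<forall>x\<in>topspace X. \<theta> F x = 1 \<longrightarrow> u x = fst (JK (p F)) \<and> w x = snd (JK (p F)))"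
      if i: "1 \<le> i" for i
    proof -
      \<comment> \<open>For the remaining \<open>F\<close> the matrices chosen at \<open>p F\<close>
        are arbitrary. They may be dropped, since their \<open>\<theta> F\<close> vanishes on the
        whole space.\<close>
      define \<G> where "\<G> = {F \<in> \<F> i. p F \<in> topspace X}"
      have \<G>1: "finite \<G>" using \<F>(1) by (simp add: \<G>_def)
      have \<G>2: "\<theta> F x = 0 \<or> \<theta> G x = 0" if "F \<in> \<G>" "G \<in> \<G>" "F \<noteq> G" for F G x
        using \<F>(4)[of F i G x] that by (simp add: \<G>_def)
      have J: "cadjoint (fst (JK (p F))) = - fst (JK (p F)) \<and>
        fst (JK (p F)) ** fst (JK (p F)) = - mat 1"
        and K: "cadjoint (snd (JK (p F))) = - snd (JK (p F)) \<and>
          snd (JK (p F)) ** snd (JK (p F)) = - mat 1"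
        if "F \<in> \<G>" for F
        using JK[of "p F"] that by (auto simp: \<G>_def)
      obtain u where u: "unitary_field X u" "\<And>F x. F \<in> \<G> \<Longrightarrow> \<theta> F x = 1 \<Longrightarrow> u x = fst (JK (p F))"
        using glue_rotations[of \<G> X \<theta> "\<lambda>F. fst (JK (p F))", OF \<G>1 \<F>(2) \<G>2 J] by blast
      obtain w where w: "unitary_field X w" "\<And>F x. F \<in> \<G> \<Longrightarrow> \<theta> F x = 1 \<Longrightarrow> w x = snd (JK (p F))"
        using glue_rotations[of \<G> X \<theta> "\<lambda>F. snd (JK (p F))", OF \<G>1 \<F>(2) \<G>2 K] by blast
      have "F \<in> \<G>" if "F \<in> \<F> i" "x \<in> topspace X" "\<theta> F x = 1" for F x
        using \<F>(3)[OF i that(1,2)] that by (simp add: \<G>_def)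
      then show ?thesis using u w by blast
    qed
    then obtain u w where uw: "\<And>i. 1 \<le> i \<Longrightarrow> unitary_field X (u i) \<and> unitary_field X (w i) \<and>
        (\<forall>F\<in>\<F> i. \<forall>x\<in>topspace X. \<theta> F x = 1 \<longrightarrow> u i x = fst (JK (p F)) \<and> w i x = snd (JK (p F)))"
      by metis
    have "\<exists>i\<in>{1..k}. good_pair e (a x) (u i x) (w i x)"
      if x: "x \<in> topspace X" for x
    proof -
      obtain i F where iF: "i \<in> {1..k}" "F \<in> \<F> i" "\<theta> F x = 1" using \<F>(5)[OF x] by blast
      then have eq: "u i x = fst (JK (p F))" "w i x = snd (JK (p F))" using uw[of i] x by auto
      have "x \<in> U (fst (JK (p F))) (snd (JK (p F)))" using \<F>(3)[of i F x] iF x by auto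
      then show ?thesis
        using iF(1) by (intro bexI[of _ i]) (auto simp: U_def good_pair_def Let_def eq b_def)
    qed
    \<comment> \<open>\<open>mixing\<close> wants unitary fields for all indices; index 0 is no
      colour and receives the identity.\<close>
    moreover have "unitary_field X (\<lambda>x. mat 1 :: complex^'n^'n)" by (simp add: unitary_field_def)
    ultimately show "\<exists>u w. (\<forall>i. unitary_field X (u i) \<and> unitary_field X (w i)) \<and>
        (\<forall>x\<in>topspace X. \<exists>i\<in>{1..k}. good_pair e (a x) (u i x) (w i x))"
      using uw by (intro exI[of _ "\<lambda>i. if 1 \<le> i then u i else (\<lambda>x. mat 1)"]
          exI[of _ "\<lambda>i. if 1 \<le> i then w i else (\<lambda>x. mat 1)"]) (auto simp: Bex_def)
  qed
qed

section \<open>Averages over signed permutation matrices\<close>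

definition signed_permutation :: "('n \<Rightarrow> bool) \<Rightarrow> ('n \<Rightarrow> 'n) \<Rightarrow> complex^'n^'n" where
  "signed_permutation s \<pi> = (\<chi> i j. if j = \<pi> i then (if s i then 1 else -1) else 0)"

lemma signed_permutation_conj:
  "(signed_permutation s \<pi> ** M ** cadjoint (signed_permutation s \<pi>)) $ i $ j =
    (if s i then 1 else -1) * (if s j then 1 else -1) * M $ \<pi> i $ \<pi> j"
proof -
  have "(signed_permutation s \<pi> ** M) $ i $ k = (if s i then 1 else -1) * M $ \<pi> i $ k" for k
    by (simp add: matrix_matrix_mult_def signed_permutation_def if_distrib[of "\<lambda>z. z * _"] cong:
      if_cong)
  moreover have "cadjoint (signed_permutation s \<pi>) $ k $ j = (if k
    = \<pi> j then (if s j then 1 else -1) else 0)" for k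
    by (simp add: signed_permutation_def cadjoint_def)
  ultimately show ?thesis
    unfolding matrix_matrix_mult_def[of "signed_permutation s \<pi> ** M"]
    by (simp add: if_distrib[of "\<lambda>z. _ * z"] cong: if_cong)
qed

lemma signed_permutation_unitary:
  assumes "inj \<pi>"
  shows "cadjoint (signed_permutation s \<pi>) ** signed_permutation s \<pi> = mat 1"
proof -
  have "signed_permutation s \<pi> ** mat 1 ** cadjoint (signed_permutation s \<pi>) = mat 1"
    unfolding vec_eq_iff signed_permutation_conj using assms by (auto simp: mat_def inj_eq)
  then show ?thesis by (simp add: unitary_other_side)
qed

text \<open>Averaging over the signs removes the off-diagonal entries, averaging over the
  permutations makes the diagonal entries equal, and the trace is preserved.\<close>

lemma signed_permutation_sum:
  fixes M :: "complex^'n^'n"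
  defines "S \<equiv> (UNIV :: ('n \<Rightarrow> bool) set) \<times> {\<pi>. \<pi> permutes (UNIV :: 'n set)}"
  shows "(\<Sum>(s, \<pi>)\<in>S. signed_permutation s \<pi> ** M ** cadjoint (signed_permutation s \<pi>)) =
    real (card S) *\<^sub>R mat (trace M / of_nat CARD('n))"
proof -
  define \<epsilon> :: "('n \<Rightarrow> bool) \<Rightarrow> 'n \<Rightarrow> complex" where "\<epsilon> s i = (if s i then 1 else -1)" for s i
  define Perms where "Perms = {\<pi>. \<pi> permutes (UNIV :: 'n set)}"
  define h where "h i j = (\<Sum>\<pi>\<in>Perms. M $ \<pi> i $ \<pi> j)" for i j
  have sum_eq: "(\<Sum>(s, \<pi>)\<in>S. signed_permutation s \<pi> ** M ** cadjoint (signed_permutation s \<pi>)) $ i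
    $ j =
      (\<Sum>s\<in>UNIV. \<epsilon> s i * \<epsilon> s j) * h i j" for i j
    by (simp add: S_def Perms_def[symmetric] sum.cartesian_product' signed_permutation_conj
        \<epsilon>_def h_def sum_product)
  have off: "(\<Sum>s\<in>UNIV. \<epsilon> s i * \<epsilon> s j) = 0" if "i \<noteq> j" for i j
  proof -
    \<comment> \<open>Flipping the sign at \<open>i\<close> alone is an involution of the sign
      choices that negates each term.\<close>
    have "(\<Sum>s\<in>UNIV. \<epsilon> s i * \<epsilon> s j) = (\<Sum>s\<in>UNIV. - (\<epsilon> s i * \<epsilon> s j))"
      by (rule sum.reindex_bij_witness[of _ "\<lambda>s. s(i := \<not> s i)" "\<lambda>s. s(i := \<not> s i)"])
        (use that in \<open>auto simp: \<epsilon>_def\<close>)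
    then show ?thesis by (simp add: sum_negf)
  qed
  have diag: "(\<Sum>s\<in>UNIV. \<epsilon> s i * \<epsilon> s i) = of_nat (card (UNIV :: ('n \<Rightarrow> bool) set))" for i
  proof -
    have "\<epsilon> s i * \<epsilon> s i = 1" for s by (simp add: \<epsilon>_def)
    then show ?thesis by simp
  qed
  have h_const: "h i i = h j j" for i j
  proof -
    have "h i i = (\<Sum>\<pi>\<in>Perms. M $ (\<pi> \<circ> Transposition.transpose i j) i $ (\<pi> \<circ>
      Transposition.transpose i j) i)"
      unfolding h_def Perms_def
      by (rule sum_permutations_compose_right[OF permutes_swap_id]) auto
    then show ?thesis by (simp add: h_def)
  qed
  have "(\<Sum>i\<in>UNIV. h i i) = (\<Sum>\<pi>\<in>Perms. \<Sum>i\<in>UNIV. M $ \<pi> i $ \<pi> i)"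
    unfolding h_def by (rule sum.swap)
  also have "\<dots> = (\<Sum>\<pi>\<in>Perms. trace M)"
    unfolding trace_def
  proof (rule sum.cong[OF refl])
    fix \<pi> assume "\<pi> \<in> Perms"
    then have "bij \<pi>" by (simp add: Perms_def permutes_bij)
    then show "(\<Sum>i\<in>UNIV. M $ \<pi> i $ \<pi> i) = (\<Sum>i\<in>UNIV. M $ i $ i)"
      by (rule sum.reindex_bij_betw)
  qed
  finally have "(\<Sum>i\<in>UNIV. h i i) = of_nat (card Perms) * trace M" by simp
  moreover have "(\<Sum>i\<in>UNIV. h i i) = of_nat CARD('n) * h j j" for j
  proof -
    have "(\<Sum>i\<in>UNIV. h i i) = (\<Sum>i\<in>(UNIV::'n set). h j j)" by (intro sum.cong refl h_const)
    then show ?thesis by simp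
  qed
  ultimately have h: "h j j = of_nat (card Perms) * trace M / of_nat CARD('n)" for j
    by (simp add: field_simps)
  have card: "card S = card (UNIV :: ('n \<Rightarrow> bool) set) * card Perms"
    by (simp add: S_def Perms_def card_cartesian_product)
  show ?thesis
    unfolding vec_eq_iff
  proof (intro allI)
    fix i j
    show "(\<Sum>(s, \<pi>)\<in>S. signed_permutation s \<pi> ** M ** cadjoint (signed_permutation s \<pi>)) $ i $ j =
        (real (card S) *\<^sub>R mat (trace M / of_nat CARD('n))) $ i $ j"
    proof (cases "i = j")
      case True
      have "(real (card S) *\<^sub>R mat (trace M / of_nat CARD('n)) :: complex^'n^'n) $ i $ i =
          of_nat (card S) * (trace M / of_nat CARD('n))"
        by (simp only: vector_scaleR_component scaleR_conv_of_real[of _ "_ :: complex"]) (simp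
          add: mat_def)
      then show ?thesis
        unfolding sum_eq True[symmetric] diag h card
          by (simp only: of_nat_mult mult.assoc times_divide_eq_right)
    next
      case False
      then show ?thesis unfolding sum_eq by (simp add: off mat_def)
    qed
  qed
qed

text \<open>Row \<open>p\<close> of the commutation relation with the matrix unit at position
  \<open>(p, q)\<close> already determines row \<open>q\<close> of \<open>Z\<close>.\<close>

lemma commutes_all_imp_scalar:
  fixes Z :: "complex^'n^'n"
  assumes "\<And>E. E ** Z = Z ** E"
  shows "\<exists>c. Z = mat c"
proof -
  fix p :: 'n
  have entry: "Z $ q $ j = (if q = j then Z $ p $ p else 0)" for q j
  proof -
    define E :: "complex^'n^'n" where "E = (\<chi> i j. if i = p \<and> j = q then 1 else 0)"
    have "(E ** Z) $ p $ j = Z $ q $ j"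
      by (simp add: matrix_matrix_mult_def E_def if_distrib[of "\<lambda>z. z * _"] cong: if_cong)
    moreover have "(Z ** E) $ p $ j = (if q = j then Z $ p $ p else 0)"
      by (auto simp: matrix_matrix_mult_def E_def if_distrib[of "\<lambda>z. _ * z"] cong: if_cong)
    ultimately show ?thesis using assms[of E] by simp
  qed
  have "Z $ q $ j = mat (Z $ p $ p) $ q $ j" for q j
    using entry[of q j] unfolding mat_def vec_lambda_beta .
  then have "Z = mat (Z $ p $ p)" unfolding vec_eq_iff by blast
  then show ?thesis ..
qed

section \<open>Traces, and the spread and norm of sums of conjugates\<close>

lemma cmod_trace_le: "cmod (trace M) \<le> real CARD('n) * cmatrix_norm M" for M :: "complex^'n^'n"
proof -
  have "cmod (trace M) \<le> (\<Sum>i\<in>(UNIV::'n set). cmatrix_norm M)"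
    unfolding trace_def by (intro sum_norm_le matrix_entry_bound)
  then show ?thesis by simp
qed

lemma trace_conj: "cadjoint u ** u = mat 1 \<Longrightarrow> trace (u ** M ** cadjoint u) = trace M"
  for u :: "complex^'n^'n"
  using trace_mul_sym[of "u ** M" "cadjoint u"] by (simp add: matrix_mul_assoc)

lemma trace_scaleR: "trace (r *\<^sub>R M) = r *\<^sub>R trace M" for M :: "complex^'n^'n"
  by (simp add: trace_def scaleR_sum_right)

lemma trace_sum: "trace (\<Sum>i\<in>I. f i) = (\<Sum>i\<in>I. trace (f i))" for f :: "'b \<Rightarrow> complex^'n^'n"
  by (induction I rule: infinite_finite_induct) (simp_all add: trace_add trace_def[of 0])

lemma trace_mat: "trace (mat c :: complex^'n^'n) = of_nat CARD('n) * c"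
  by (simp add: trace_def mat_def)

lemma map_matrix_of_real: "map_matrix ((*) (complex_of_real r)) M = r *\<^sub>R M"
  by (simp add: vec_eq_iff scaleR_conv_of_real[of _ "_ :: complex"])


lemma spread_zero [simp]: "spread 0 = 0"
  using spread_scaleR[of 0 0] by simp

lemma spread_sum: "spread (\<Sum>i\<in>I. f i) \<le> (\<Sum>i\<in>I. spread (f i))"
  by (induction I rule: infinite_finite_induct) (auto intro: order_trans[OF spread_add])

lemma cmatrix_norm_zero [simp]: "cmatrix_norm 0 = 0"
  by (simp add: cmatrix_norm_eq_0)

lemma cmatrix_norm_sum: "cmatrix_norm (\<Sum>i\<in>I. f i) \<le> (\<Sum>i\<in>I. cmatrix_norm (f i))"
  by (induction I rule: infinite_finite_induct) (auto intro: order_trans[OF cmatrix_norm_triangle])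

lemma cadjoint_sum: "cadjoint (\<Sum>i\<in>I. f i) = (\<Sum>i\<in>I. cadjoint (f i))"
  by (induction I rule: infinite_finite_induct) auto

lemma trace_cadjoint: "trace (cadjoint M) = cnj (trace M)" for M :: "complex^'n^'n"
  by (simp add: trace_def cadjoint_def)

text \<open>The term \<open>a\<close> is paired with the conjugate of the good colour
  \<open>i\<close>; each of the other \<open>k - 1\<close> conjugates adds the spread of
  \<open>a\<close>.\<close>

lemma spread_average_le:
  fixes a :: "complex^'n^'n" and u :: "nat \<Rightarrow> complex^'n^'n"
  assumes u: "\<And>j. cadjoint (u j) ** u j = mat 1" and i: "i \<in> {1..k}"
    and le: "spread (a + u i ** a ** cadjoint (u i)) \<le> spread a + e"
  shows "spread (a + (\<Sum>j=1..k. u j ** a ** cadjoint (u j))) \<le> real k * spread a + e"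
proof -
  define f where "f j = u j ** a ** cadjoint (u j)" for j
  have f: "spread (f j) = spread a" for j
    unfolding f_def using u unitary_other_side by (intro spread_conj) blast
  have split: "a + (\<Sum>j=1..k. f j) = (a + f i) + (\<Sum>j\<in>{1..k} - {i}. f j)"
    by (simp only: sum.remove[OF finite_atLeastAtMost i] add.assoc)
  have "spread (a + (\<Sum>j=1..k. f j)) \<le> spread (a + f i) + (\<Sum>j\<in>{1..k} - {i}. spread (f j))"
    unfolding split
    using spread_add[of "a + f i" "\<Sum>j\<in>{1..k} - {i}. f j"] spread_sum[of f "{1..k} - {i}"]
      by linarith
  also have "\<dots> \<le> (spread a + e) + (real k - 1) * spread a"
    using le i by (simp add: f f_def[symmetric] of_nat_diff)
  finally show ?thesis by (simp add: f_def algebra_simps)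
qed

text \<open>The term \<open>a\<close> and the three conjugates of the good colour form the traceless
  Hermitian matrix \<open>b + w i ** b ** cadjoint (w i)\<close>, whose norm its spread bounds by
  \<open>2 * cmatrix_norm a + e\<close>. Each other colour costs three norms of
  \<open>a\<close>.\<close>

lemma norm_average_le:
  fixes a :: "complex^'n^'n" and u w :: "nat \<Rightarrow> complex^'n^'n"
  assumes a: "cadjoint a = a" "trace a = 0"
    and u: "\<And>j. cadjoint (u j) ** u j = mat 1" and w: "\<And>j. cadjoint (w j) ** w j = mat 1"
    and i: "i \<in> {1..k}" and b: "b = a + u i ** a ** cadjoint (u i)"
    and le: "spread (b + w i ** b ** cadjoint (w i)) \<le> spread a + e"
  shows "cmatrix_norm (a + (\<Sum>j=1..k. u j ** a ** cadjoint (u j) + w j ** a ** cadjoint (w j)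
      + (w j ** u j) ** a ** cadjoint (w j ** u j))) \<le> (3 * real k - 1) * cmatrix_norm a + e"
proof -
  define f where "f j = u j ** a ** cadjoint (u j) + w j ** a ** cadjoint (w j)
      + (w j ** u j) ** a ** cadjoint (w j ** u j)" for j
  have wu: "cadjoint (w j ** u j) ** (w j ** u j) = mat 1" for j
  proof -
    have "cadjoint (w j ** u j) ** (w j ** u j) = cadjoint (u j) ** (cadjoint (w j) ** w j) ** u j"
      by (simp only: cadjoint_mult matrix_mul_assoc)
    then show ?thesis by (simp add: u w)
  qed
  have conj_le: "cmatrix_norm (v ** a ** cadjoint v) \<le> cmatrix_norm a"
    if "cadjoint v ** v = mat 1" for v
    using cmatrix_norm_conj_le[of v a] that unitary_other_side by blast
  have f_le: "cmatrix_norm (f j) \<le> 3 * cmatrix_norm a" for j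
  proof -
    have "cmatrix_norm (f j) \<le> cmatrix_norm (u j ** a ** cadjoint (u j))
      + cmatrix_norm (w j ** a ** cadjoint (w j))
        + cmatrix_norm ((w j ** u j) ** a ** cadjoint (w j ** u j))"
      unfolding f_def by (intro order_trans[OF cmatrix_norm_triangle] add_right_mono
        cmatrix_norm_triangle)
    then show ?thesis using conj_le[OF u[of j]] conj_le[OF w[of j]] conj_le[OF wu[of j]] by linarith
  qed
  have bf: "b + w i ** b ** cadjoint (w i) = a + f i"
    by (simp add: b f_def matrix_add_ldistrib matrix_mult_add_left cadjoint_mult matrix_mul_assoc)
  have "cadjoint (b + w i ** b ** cadjoint (w i)) = b + w i ** b ** cadjoint (w i)"
    by (simp add: b a cadjoint_mult matrix_mul_assoc)
  moreover have "trace (b + w i ** b ** cadjoint (w i)) = 0"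
    by (simp add: trace_add trace_conj u w b a)
  ultimately have "cmatrix_norm (a + f i) \<le> spread a + e"
    using trace_zero_norm_le_spread[of "b + w i ** b ** cadjoint (w i)"] le unfolding bf by linarith
  then have good: "cmatrix_norm (a + f i) \<le> 2 * cmatrix_norm a + e"
    using spread_le_norm[of a] by linarith
  have split: "a + (\<Sum>j=1..k. f j) = (a + f i) + (\<Sum>j\<in>{1..k} - {i}. f j)"
    by (simp only: sum.remove[OF finite_atLeastAtMost i] add.assoc)
  have "cmatrix_norm (a + (\<Sum>j=1..k. f j)) \<le> cmatrix_norm (a + f i)
    + (\<Sum>j\<in>{1..k} - {i}. cmatrix_norm (f j))"
    unfolding split
    using cmatrix_norm_triangle[of "a + f i" "\<Sum>j\<in>{1..k} - {i}. f j"] cmatrix_norm_sum[of f "{1..k}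
      - {i}"]
    by linarith
  also have "(\<Sum>j\<in>{1..k} - {i}. cmatrix_norm (f j)) \<le> (\<Sum>j\<in>{1..k} - {i}. 3 * cmatrix_norm a)"
    by (intro sum_mono f_le)
  also have "\<dots> = (real k - 1) * (3 * cmatrix_norm a)" using i by (simp add: of_nat_diff)
  also have "cmatrix_norm (a + f i) + (real k - 1) * (3 * cmatrix_norm a)
      \<le> (2 * cmatrix_norm a + e) + (real k - 1) * (3 * cmatrix_norm a)" using good by simp
  finally show ?thesis by (simp add: f_def algebra_simps)
qed

lemma sum_triples: "(\<Sum>j=1..3 * k + 1. F j) = F 1 + (\<Sum>i=1..k. F (3 * i - 1) + F (3 * i) + F (3 * i
  + 1))"
  for F :: "nat \<Rightarrow> 'b::comm_monoid_add"
proof (induction k)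
  case (Suc k)
  define G where "G i = F (3 * i - 1) + F (3 * i) + F (3 * i + 1)" for i
  have "{1..3 * Suc k + 1} = insert (3 * Suc k
    + 1) (insert (3 * Suc k) (insert (3 * Suc k - 1) {1..3 * k + 1}))"
    by auto
  then have "(\<Sum>j=1..3 * Suc k + 1. F j) = (\<Sum>j=1..3 * k + 1. F j) + G (Suc k)"
    by (simp add: G_def add_ac)
  also have "\<dots> = F 1 + ((\<Sum>i=1..k. G i) + G (Suc k))"
    unfolding Suc by (simp add: G_def add.assoc)
  also have "(\<Sum>i=1..k. G i) + G (Suc k) = (\<Sum>i=1..Suc k. G i)" by simp
  finally show ?case by (simp only: G_def)
qed simp


section \<open>The Dixmier properties of the algebra of matrix fields\<close>

context
  fixes X :: "'a topology"
  assumes X: "compact_space X"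
begin

abbreviation (input) CM :: "('a \<Rightarrow> complex^'n^'n) star_algebra" where
  "CM \<equiv> cont_matrix_algebra X"

section \<open>Operations of the algebra, evaluated pointwise\<close>

lemma cont_matrix_finsum:
  assumes "finite I" "\<And>i. i \<in> I \<Longrightarrow> f i \<in> carrier (CM :: ('a \<Rightarrow> complex^'n^'n) star_algebra)"
  shows "finsum CM f I \<in> carrier CM \<and> (\<forall>x\<in>topspace X. finsum CM f I x = (\<Sum>i\<in>I. f i x))"
  using assms
proof (induction I)
  case empty
  interpret ring "CM :: ('a \<Rightarrow> complex^'n^'n) star_algebra" by (rule cont_matrix_ring)
  show ?case by (simp add: cont_matrix_apply)
next
  case (insert i I)
  interpret ring "CM :: ('a \<Rightarrow> complex^'n^'n) star_algebra" by (rule cont_matrix_ring)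
  have "finsum CM f (insert i I) = f i \<oplus>\<^bsub>CM\<^esub> finsum CM f I"
    using insert by (intro finsum_insert) auto
  then show ?case using insert by (simp add: cont_matrix_apply)
qed

lemma cont_matrix_restrict:
  "continuous_map X euclidean f \<Longrightarrow> restrict f (topspace X) \<in> carrier (CM :: ('a \<Rightarrow> complex^'n^'n)
    star_algebra)"
  by (rule cont_matrix_restrict_closed)

lemma cont_matrix_carrier_tendsto:
  "f \<in> carrier (CM :: ('a \<Rightarrow> complex^'n^'n) star_algebra) \<Longrightarrow> x \<in> topspace X \<Longrightarrow> (f \<longlongrightarrow> f x) (atin X x)"
  unfolding cont_matrix_carrier continuous_map_iff_tendsto by blast

lemma cont_matrix_unitariesI:
  assumes "unitary_field X u"
  shows "restrict u (topspace X) \<in> unitaries (CM :: ('a \<Rightarrow> complex^'n^'n) star_algebra)"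
proof -
  have u: "restrict u (topspace X) \<in> carrier (CM :: ('a \<Rightarrow> complex^'n^'n) star_algebra)"
    using assms by (intro cont_matrix_restrict) (simp add: unitary_field_def)
  have "cadjoint (u x) ** u x = mat 1" "u x ** cadjoint (u x) = mat 1" if "x \<in> topspace X" for x
    using assms that unitary_other_side[of "u x"] by (auto simp: unitary_field_def)
  then show ?thesis
    unfolding unitaries_def using u
    by (auto intro!: cont_matrix_eqI[where X = X] simp: cont_matrix_closed cont_matrix_apply)
qed

lemma cont_matrix_unitariesD:
  assumes "u \<in> unitaries (CM :: ('a \<Rightarrow> complex^'n^'n) star_algebra)"
  shows "u \<in> carrier CM" "x \<in> topspace X \<Longrightarrow> cadjoint (u x) ** u x = mat 1"
proof -
  show "u \<in> carrier CM" using assms by (simp add: unitaries_def)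
  assume x: "x \<in> topspace X"
  have "(star CM u \<otimes>\<^bsub>CM\<^esub> u) x = (\<one>\<^bsub>CM\<^esub> :: 'a \<Rightarrow> complex^'n^'n) x"
    using assms by (simp add: unitaries_def)
  then show "cadjoint (u x) ** u x = mat 1" using x by (simp add: cont_matrix_apply)
qed

lemma cont_matrix_conj:
  assumes "u \<in> carrier (CM :: ('a \<Rightarrow> complex^'n^'n) star_algebra)" "a \<in> carrier CM"
  shows "unitary_conj CM u a \<in> carrier CM"
    "x \<in> topspace X \<Longrightarrow> unitary_conj CM u a x = u x ** a x ** cadjoint (u x)"
  unfolding unitary_conj_def using assms by (simp_all add: cont_matrix_closed cont_matrix_apply)

lemma cont_matrix_combination:
  fixes k :: nat
  assumes "\<And>i. i \<in> {1..k} \<Longrightarrow> s i \<in> carrier (CM :: ('a \<Rightarrow> complex^'n^'n) star_algebra)"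
  shows "finsum CM (\<lambda>i. cscale CM (of_real (t i)) (s i)) {1..k} \<in> carrier CM"
    "x \<in> topspace X \<Longrightarrow>
      finsum CM (\<lambda>i. cscale CM (of_real (t i)) (s i)) {1..k} x = (\<Sum>i=1..k. t i *\<^sub>R s i x)"
  using cont_matrix_finsum[of "{1..k}" "\<lambda>i. cscale CM (of_real (t i)) (s i)"] assms
  by (simp_all add: cont_matrix_closed cont_matrix_apply map_matrix_of_real)

lemma cont_matrix_average:
  fixes m :: nat
  assumes "\<And>i. i \<in> {1..m} \<Longrightarrow> u i \<in> carrier (CM :: ('a \<Rightarrow> complex^'n^'n) star_algebra)"
    "a \<in> carrier CM"
  shows "unitary_average CM m u a \<in> carrier CM"
    "x \<in> topspace X \<Longrightarrow>
      unitary_average CM m u a x = (1 / real m) *\<^sub>R (\<Sum>i=1..m. u i x ** a x ** cadjoint (u i x))"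
  unfolding unitary_average_def
  using cont_matrix_combination[where k = m and s = "\<lambda>i. unitary_conj CM (u i) a" and t
    = "\<lambda>i. 1 / real m"] assms
  by (simp_all add: cont_matrix_conj scaleR_sum_right)

lemma cont_matrix_centerI:
  assumes "continuous_map X euclidean c"
  shows "(\<lambda>x\<in>topspace X. mat (c x)) \<in> cstar_center (CM :: ('a \<Rightarrow> complex^'n^'n) star_algebra)"
proof -
  have "continuous_map X euclidean (\<lambda>x. mat (c x) :: complex^'n^'n)"
    using assms unfolding continuous_map_iff_tendsto by (auto intro!: tendsto_intros)
  then have "(\<lambda>x\<in>topspace X. mat (c x)) \<in> carrier (CM :: ('a \<Rightarrow> complex^'n^'n) star_algebra)"
    by (rule cont_matrix_restrict)
  then show ?thesis
    unfolding cstar_center_def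
    by (auto intro!: cont_matrix_eqI[where X = X]
        simp: cont_matrix_closed cont_matrix_apply mat_mult_left mat_mult_right mult.commute)
qed

text \<open>Testing against constant fields shows that a central field is scalar at each point, and
  a scalar matrix is recovered from its trace.\<close>

lemma cont_matrix_centerD:
  assumes z: "z \<in> cstar_center (CM :: ('a \<Rightarrow> complex^'n^'n) star_algebra)" and x: "x \<in> topspace X"
  shows "z x = mat (trace (z x) / of_nat CARD('n))"
proof -
  have "E ** z x = z x ** E" for E :: "complex^'n^'n"
  proof -
    have "(\<lambda>x\<in>topspace X. E) \<in> carrier (CM :: ('a \<Rightarrow> complex^'n^'n) star_algebra)"
      by (rule cont_matrix_restrict) simp
    then have "((\<lambda>x\<in>topspace X. E) \<otimes>\<^bsub>CM\<^esub> z) x = (z \<otimes>\<^bsub>CM\<^esub> (\<lambda>x\<in>topspace X. E)) x"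
      using z by (simp add: cstar_center_def)
    then show ?thesis using x by (simp add: cont_matrix_apply)
  qed
  then obtain c where "z x = mat c" using commutes_all_imp_scalar by blast
  then show ?thesis by (simp add: trace_mat)
qed

definition trace_field :: "('a \<Rightarrow> complex^'n^'n) \<Rightarrow> 'a \<Rightarrow> complex^'n^'n" where
  "trace_field a = (\<lambda>x\<in>topspace X. mat (trace (a x) / of_nat CARD('n)))"

lemma trace_field_center:
  assumes "a \<in> carrier (CM :: ('a \<Rightarrow> complex^'n^'n) star_algebra)"
  shows "trace_field a \<in> cstar_center CM"
  unfolding trace_field_def trace_def
  using cont_matrix_carrier_tendsto[OF assms] unfolding continuous_map_iff_tendsto
  by (intro cont_matrix_centerI) (auto simp: continuous_map_iff_tendsto intro!: tendsto_intros)

text \<open>The pointwise trace is constant on the convex hull and, being continuous for the norm,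
  on its closure; it determines a central element. Conversely \<open>trace_field a\<close> is
  already in the convex hull, as the mean of the conjugates by constant signed permutation
  matrices.\<close>

lemma dixmier_set_center:
  assumes a: "a \<in> carrier (CM :: ('a \<Rightarrow> complex^'n^'n) star_algebra)"
  shows "dixmier_set CM a \<inter> cstar_center CM = {trace_field a}"
proof (intro equalityI subsetI)
  interpret ring "CM :: ('a \<Rightarrow> complex^'n^'n) star_algebra" by (rule cont_matrix_ring)
  let ?hull = "cstar_convex_hull CM ((\<lambda>u. unitary_conj CM u a) ` unitaries CM)"
  fix z assume "z \<in> dixmier_set CM a \<inter> cstar_center CM"
  then have zc: "z \<in> cstar_center CM" and z: "z \<in> carrier CM"
    and approx: "\<And>e. e > 0 \<Longrightarrow> \<exists>b\<in>?hull. cnorm CM (z \<ominus>\<^bsub>CM\<^esub> b) < e"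
    by (auto simp: dixmier_set_def cstar_closure_def)
  have hull: "b \<in> carrier CM" "x \<in> topspace X \<Longrightarrow> trace (b x) = trace (a x)" if "b \<in> ?hull" for b x
  proof -
    from that obtain k :: nat and t s where b: "b
      = finsum CM (\<lambda>i. cscale CM (of_real (t i)) (s i)) {1..k}"
      and s: "\<And>i. i \<in> {1..k} \<Longrightarrow> s i \<in> (\<lambda>u. unitary_conj CM u a) ` unitaries CM"
      and t: "(\<Sum>i=1..k. t i) = (1::real)"
      unfolding cstar_convex_hull_def by blast
    have s': "s i \<in> carrier CM" "x \<in> topspace X \<Longrightarrow> trace (s i x) = trace (a x)"
      if i: "i \<in> {1..k}" for i x
    proof -
      obtain u where u: "u \<in> unitaries CM" "s i = unitary_conj CM u a" using s[OF i] by blast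
      show "s i \<in> carrier CM" "x \<in> topspace X \<Longrightarrow> trace (s i x) = trace (a x)"
        using cont_matrix_conj[OF cont_matrix_unitariesD(1)[OF u(1)] a]
          cont_matrix_unitariesD(2)[OF u(1)]
        by (simp_all add: u(2) trace_conj)
    qed
    show "b \<in> carrier CM" unfolding b using s' by (intro cont_matrix_combination) auto
    assume x: "x \<in> topspace X"
    have "trace (b x) = (\<Sum>i=1..k. t i *\<^sub>R trace (s i x))"
      unfolding b using cont_matrix_combination(2)[where k = k and s = s and x = x and t = t] s' x
        by (simp add: trace_sum trace_scaleR)
    also have "\<dots> = (\<Sum>i=1..k. t i) *\<^sub>R trace (a x)"
      using s' x by (simp add: scaleR_left.sum)
    finally show "trace (b x) = trace (a x)" using t by simp
  qed
  have "trace (z x) = trace (a x)" if x: "x \<in> topspace X" for x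
  proof -
    have "cmod (trace (z x) - trace (a x)) \<le> 0 + e" if e: "e > 0" for e
    proof -
      have "e / real CARD('n) > 0" using e by simp
      then obtain b where b: "b \<in> ?hull" "cnorm CM (z \<ominus>\<^bsub>CM\<^esub> b) < e / real CARD('n)"
        using approx by blast
      have "trace (z x) - trace (a x) = trace (z x - b x)" using hull(2)[OF b(1) x]
        by (simp add: trace_sub)
      then have "cmod (trace (z x) - trace (a x)) \<le> real CARD('n) * cmatrix_norm ((z \<ominus>\<^bsub>CM\<^esub> b) x)"
        using cmod_trace_le[of "z x - b x"] cont_matrix_minus_apply[OF z hull(1)[OF b(1)] x] by simp
      also have "\<dots> \<le> real CARD('n) * cnorm CM (z \<ominus>\<^bsub>CM\<^esub> b)"
        using cont_matrix_cnorm_bound(2)[OF X _ x, of "z \<ominus>\<^bsub>CM\<^esub> b"] z hull(1)[OF b(1)]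
        by (intro mult_left_mono) auto
      also have "\<dots> \<le> e" using b(2) by (simp add: field_simps)
      finally show ?thesis by simp
    qed
    then have "cmod (trace (z x) - trace (a x)) \<le> 0" by (rule field_le_epsilon)
    then show ?thesis by simp
  qed
  then have "z = trace_field a"
    using z trace_field_center[OF a] cont_matrix_centerD[OF zc]
    by (intro cont_matrix_eqI[where X = X]) (auto simp: cstar_center_def trace_field_def)
  then show "z \<in> {trace_field a}" by simp
next
  interpret ring "CM :: ('a \<Rightarrow> complex^'n^'n) star_algebra" by (rule cont_matrix_ring)
  fix z assume "z \<in> {trace_field a}"
  then have z_eq: "z = trace_field a" by simp
  have zc: "z \<in> cstar_center CM" and z: "z \<in> carrier CM"
    using trace_field_center[OF a] by (auto simp: z_eq cstar_center_def)
  define S where "S = (UNIV :: ('n \<Rightarrow> bool) set) \<times> {\<pi>. \<pi> permutes (UNIV :: 'n set)}"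
  have "(\<lambda>_. True, id) \<in> S" by (simp add: S_def permutes_id)
  then have S_ne: "S \<noteq> {}" by blast
  have S: "finite S" by (auto simp: S_def finite_permutations)
  obtain h where h: "bij_betw h {1..card S} S"
    using ex_bij_betw_nat_finite_1[OF S] by blast
  define g where "g i = (\<lambda>x\<in>topspace X. signed_permutation (fst (h i)) (snd (h i)))" for i
  have g: "g i \<in> unitaries CM" if "i \<in> {1..card S}" for i
  proof -
    have "h i \<in> S" using h that by (auto simp: bij_betw_def)
    then have "inj (snd (h i))" by (auto simp: S_def permutes_inj)
    then show ?thesis unfolding g_def
      by (intro cont_matrix_unitariesI) (simp add: unitary_field_def signed_permutation_unitary)
  qed
  \<comment> \<open>\<open>h\<close> enumerates the signs and permutations by
    \<open>1..card S\<close>, the index form used in \<open>cstar_convex_hull\<close>.\<close>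
  have comb: "z = finsum CM (\<lambda>i. cscale CM (of_real (1 / real (card S))) (unitary_conj CM (g i)
    a)) {1..card S}"
  proof (rule cont_matrix_eqI[where X = X, OF z])
    show "finsum CM (\<lambda>i. cscale CM (of_real (1 / real (card S))) (unitary_conj CM (g i) a))
      {1..card S} \<in> carrier CM"
      using g cont_matrix_unitariesD(1) a by (intro cont_matrix_combination cont_matrix_conj) auto
    fix x assume x: "x \<in> topspace X"
    have "finsum CM (\<lambda>i. cscale CM (of_real (1 / real (card S))) (unitary_conj CM (g i) a))
      {1..card S} x
        = (\<Sum>i=1..card S. (1 / real (card S)) *\<^sub>R unitary_conj CM (g i) a x)"
      using g cont_matrix_unitariesD(1) a x by (intro cont_matrix_combination cont_matrix_conj) auto
    also have "\<dots> = (1 / real (card S)) *\<^sub>R (\<Sum>i=1..card S. unitary_conj CM (g i) a x)"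
      by (simp only: scaleR_sum_right)
    also have "(\<Sum>i=1..card S. unitary_conj CM (g i) a x) =
        (\<Sum>i=1..card S. (\<lambda>(s, \<pi>). signed_permutation s \<pi> ** a x ** cadjoint (signed_permutation s
        \<pi>)) (h i))"
    proof (rule sum.cong[OF refl])
      fix i assume i: "i \<in> {1..card S}"
      show "unitary_conj CM (g i) a x =
          (\<lambda>(s, \<pi>). signed_permutation s \<pi> ** a x ** cadjoint (signed_permutation s \<pi>)) (h i)"
        using cont_matrix_conj(2)[OF cont_matrix_unitariesD(1)[OF g[OF i]] a x] x
          by (simp add: g_def case_prod_beta)
    qed
    also have "\<dots> = (\<Sum>(s, \<pi>)\<in>S. signed_permutation s \<pi> ** a x ** cadjoint (signed_permutation s \<pi>))"
      by (rule sum.reindex_bij_betw[OF h])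
    also have "\<dots> = real (card S) *\<^sub>R mat (trace (a x) / of_nat CARD('n))"
      unfolding S_def by (rule signed_permutation_sum)
    also have "(1 / real (card S)) *\<^sub>R \<dots> = mat (trace (a x) / of_nat CARD('n))"
    proof -
      have "1 / real (card S) * real (card S) = 1" using S S_ne by simp
      then show ?thesis by (simp only: scaleR_scaleR scaleR_one)
    qed
    finally show "z x = finsum CM (\<lambda>i. cscale CM (of_real (1 / real (card S))) (unitary_conj CM (g
      i) a)) {1..card S} x"
      using x by (simp add: z_eq trace_field_def)
  qed
  have z_hull: "z \<in> cstar_convex_hull CM ((\<lambda>u. unitary_conj CM u a) ` unitaries CM)"
  proof -
    have "\<forall>i\<in>{1..card S}. 0 \<le> 1 / real (card S) \<and>
        unitary_conj CM (g i) a \<in> (\<lambda>u. unitary_conj CM u a) ` unitaries CM"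
      by (intro ballI conjI) (simp, rule image_eqI[OF refl g], assumption)
    moreover have "(\<Sum>i=1..card S. 1 / real (card S)) = 1" using S S_ne by simp
    ultimately show ?thesis
      unfolding cstar_convex_hull_def mem_Collect_eq
      by (intro exI[of _ "card S"] exI[of _ "\<lambda>i. 1 / real (card S)"]
          exI[of _ "\<lambda>i. unitary_conj CM (g i) a"] conjI) (rule comb | assumption)+
  qed
  have "z \<ominus>\<^bsub>CM\<^esub> z = \<zero>\<^bsub>CM\<^esub>" using z by (simp add: r_neg minus_eq)
  moreover have "cnorm CM (\<zero>\<^bsub>CM\<^esub> :: 'a \<Rightarrow> complex^'n^'n) \<le> 0"
    by (simp add: cont_matrix_cnorm_le_iff[OF X] cont_matrix_apply cmatrix_norm_eq_0[THEN iffD2])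
  ultimately have "cnorm CM (z \<ominus>\<^bsub>CM\<^esub> z) \<le> 0" by simp
  then have "\<exists>b\<in>cstar_convex_hull CM ((\<lambda>u. unitary_conj CM u a) ` unitaries CM). cnorm CM (z \<ominus>\<^bsub>CM\<^esub>
    b) < e"
    if "e > 0" for e using that by (intro bexI[OF _ z_hull]) linarith
  then show "z \<in> dixmier_set CM a \<inter> cstar_center CM"
    unfolding dixmier_set_def cstar_closure_def
    by (intro IntI CollectI conjI allI impI z zc)
qed

lemma cont_matrix_singleton_dixmier: "singleton_dixmier_property (CM :: ('a \<Rightarrow> complex^'n^'n)
  star_algebra)"
  unfolding singleton_dixmier_property_def by (intro ballI exI) (rule dixmier_set_center)

lemma cont_matrix_center_valued_trace:
  "a \<in> carrier (CM :: ('a \<Rightarrow> complex^'n^'n) star_algebra) \<Longrightarrow> center_valued_trace CM a = trace_field a"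
  unfolding center_valued_trace_def by (simp add: dixmier_set_center)

text \<open>One conjugate per colour, together with the identity, reduces the spread pointwise. The
  midpoint of the spectrum of the average depends continuously on the point, and as a scalar field
  it is the required central element.\<close>

lemma uniform_dixmier_if_mixing:
  assumes mix: "mixing X k TYPE('n::finite)" and \<gamma>: "real k / (real k + 1) < \<gamma>" "\<gamma> < 1"
  shows "uniform_dixmier_property (CM :: ('a \<Rightarrow> complex^'n^'n) star_algebra) (k + 1) \<gamma>"
  unfolding uniform_dixmier_property_def
proof (intro conjI ballI)
  show "0 < k + 1" "\<gamma> < 1" using \<gamma> by auto
  have "0 \<le> real k / (real k + 1)" by simp
  then show "0 < \<gamma>" using \<gamma>(1) by linarith
  fix a assume "a \<in> self_adjoints (CM :: ('a \<Rightarrow> complex^'n^'n) star_algebra)"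
  then have a: "a \<in> carrier CM" "star CM a = a" by (auto simp: self_adjoints_def)
  have herm: "cadjoint (a x) = a x" if "x \<in> topspace X" for x
    using fun_cong[OF a(2), of x] that by (simp add: cont_matrix_apply)
  then have field: "hermitian_field X a"
    using a(1) by (simp add: hermitian_field_def cont_matrix_carrier)
  define N where "N = cnorm CM a"
  have N: "N \<ge> 0" "\<And>x. x \<in> topspace X \<Longrightarrow> cmatrix_norm (a x) \<le> N"
    using cont_matrix_cnorm_bound[OF X a(1)] by (auto simp: N_def)
  \<comment> \<open>\<open>\<delta>\<close> is the slack in \<open>\<gamma>\<close>: with
    \<open>e = 2 * \<delta> * N\<close> the estimate \<open>(k * 2 N + e) / (2 (k + 1))\<close> is
    exactly \<open>\<gamma> * N\<close>. For \<open>N = 0\<close> this \<open>e\<close> would not be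
    positive, but then \<open>a\<close> vanishes and any \<open>e\<close> will do.\<close>
  define \<delta> where "\<delta> = \<gamma> * (real k + 1) - real k"
  have \<delta>: "\<delta> > 0" using \<gamma>(1) by (simp add: \<delta>_def field_simps)
  define e where "e = (if N = 0 then 1 else 2 * \<delta> * N)"
  have "e > 0" using N(1) \<delta> by (simp add: e_def)
  with mix field obtain u w where u: "\<And>i. unitary_field X (u i)"
    and good: "\<And>x. x \<in> topspace X \<Longrightarrow> \<exists>i\<in>{1..k}. spread (a x + u i x ** a x ** cadjoint (u i x))
      \<le> spread (a x) + e"
    unfolding mixing_def good_pair_def Let_def by metis
  \<comment> \<open>The identity takes the last place \<open>k + 1\<close>, so that the colours keep
    their numbers.\<close>
  define U where "U j = restrict (if j \<le> k then u j else (\<lambda>x. mat 1)) (topspace X)" for j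
  have "unitary_field X (\<lambda>x. mat 1 :: complex^'n^'n)" by (simp add: unitary_field_def)
  then have U: "U j \<in> unitaries CM" for j
    unfolding U_def using u by (intro cont_matrix_unitariesI) auto
  define b where "b = unitary_average CM (k + 1) U a"
  have b: "b \<in> carrier CM" unfolding b_def using U cont_matrix_unitariesD(1) a(1)
    by (intro cont_matrix_average) auto
  define S where "S x = a x + (\<Sum>j=1..k. u j x ** a x ** cadjoint (u j x))" for x
  have b_eq: "b x = (1 / (real k + 1)) *\<^sub>R S x" if x: "x \<in> topspace X" for x
  proof -
    have "b x = (1 / real (k + 1)) *\<^sub>R (\<Sum>j=1..k + 1. U j x ** a x ** cadjoint (U j x))"
      unfolding b_def using U cont_matrix_unitariesD(1) a(1) x by (intro cont_matrix_average) auto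
    also have "(\<Sum>j=1..k + 1. U j x ** a x ** cadjoint (U j x)) = S x"
      using x by (simp add: S_def U_def add.commute)
    finally show ?thesis by (simp add: add.commute)
  qed
  have spread_S: "spread (S x) \<le> real k * spread (a x) + 2 * \<delta> * N" if x: "x \<in> topspace X" for x
  proof (cases "N = 0")
    case True
    then have "a x = 0"
      using N(2)[OF x] cmatrix_norm_nonneg[of "a x"] by (simp flip: cmatrix_norm_eq_0)
    then show ?thesis using True by (simp add: S_def)
  next
    case False
    then have e: "e = 2 * \<delta> * N" by (simp add: e_def)
    obtain i where "i \<in> {1..k}" "spread (a x + u i x ** a x ** cadjoint (u i x)) \<le> spread (a x) + e"
      using good[OF x] by blast
    then show ?thesis
      unfolding S_def e using u x by (intro spread_average_le) (auto simp: unitary_field_def)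
  qed
  define c where "c x = complex_of_real ((rayleigh_max (b x) - rayleigh_max (- b x)) / 2)" for x
  have "continuous_map X euclidean c"
    unfolding c_def continuous_map_iff_tendsto
    by (intro ballI tendsto_intros cont_matrix_carrier_tendsto[OF b]) simp_all
  then have z: "(\<lambda>x\<in>topspace X. mat (c x)) \<in> cstar_center (CM :: ('a \<Rightarrow> complex^'n^'n) star_algebra)"
    by (rule cont_matrix_centerI)
  then have z': "(\<lambda>x\<in>topspace X. mat (c x)) \<in> carrier (CM :: ('a \<Rightarrow> complex^'n^'n) star_algebra)"
    by (simp add: cstar_center_def)
  interpret ring "CM :: ('a \<Rightarrow> complex^'n^'n) star_algebra" by (rule cont_matrix_ring)
  have "cnorm CM (b \<ominus>\<^bsub>CM\<^esub> (\<lambda>x\<in>topspace X. mat (c x))) \<le> \<gamma> * N"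
  proof (subst cont_matrix_cnorm_le_iff[OF X], goal_cases)
    case 1
    show ?case using b z' by simp
  next
    case 2
    have "cmatrix_norm ((b \<ominus>\<^bsub>CM\<^esub> (\<lambda>x\<in>topspace X. mat (c x))) x) \<le> \<gamma> * N"
      if x: "x \<in> topspace X" for x
    proof -
      have "cadjoint (b x) = b x"
        by (simp add: b_eq[OF x] S_def cadjoint_sum cadjoint_mult herm[OF x] matrix_mul_assoc)
      then have "cmatrix_norm (b x - mat (c x)) \<le> spread (b x) / 2"
        unfolding c_def by (rule hermitian_norm_midpoint)
      also have "\<dots> = (1 / (real k + 1)) * spread (S x) / 2"
        by (simp add: b_eq[OF x] spread_scaleR)
      also have "\<dots> \<le> (1 / (real k + 1)) * (real k * (2 * N) + 2 * \<delta> * N) / 2"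
      proof -
        have "real k * spread (a x) \<le> real k * (2 * N)"
          using spread_le_norm[of "a x"] N(2)[OF x] by (intro mult_left_mono) auto
        then show ?thesis using spread_S[OF x] by (intro divide_right_mono mult_left_mono) auto
      qed
      also have "\<dots> = \<gamma> * N" by (simp add: \<delta>_def field_simps)
      finally show ?thesis using x b z' by (simp add: cont_matrix_minus_apply)
    qed
    moreover have "0 \<le> \<gamma> * N" using \<open>0 < \<gamma>\<close> N(1) by simp
    ultimately show ?case by blast
  qed
  then show "\<exists>z\<in>cstar_center CM. \<exists>u. (\<forall>i\<in>{1..k + 1}. u i \<in> unitaries CM) \<and>
      cnorm CM (unitary_average CM (k + 1) u a \<ominus>\<^bsub>CM\<^esub> z) \<le> \<gamma> * cnorm CM a"
    using z U unfolding b_def N_def by blast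
qed

text \<open>Conjugation fixes the scalar field \<open>R\<close>, so averaging \<open>a\<close> and
  subtracting \<open>R\<close> is the same as averaging the traceless field \<open>a0\<close>. The
  mixing unitaries are therefore chosen for \<open>a0\<close>.\<close>

lemma uniform_singleton_dixmier_if_mixing:
  assumes mix: "mixing X k TYPE('n::finite)" and k: "k \<ge> 1"
    and \<Upsilon>: "(3 * real k - 1) / (3 * real k + 1) < \<Upsilon>" "\<Upsilon> < 1"
  shows "uniform_singleton_dixmier_property (CM :: ('a \<Rightarrow> complex^'n^'n) star_algebra) (3 * k + 1) \<Upsilon>"
  unfolding uniform_singleton_dixmier_property_def
proof (intro conjI ballI)
  show "0 < 3 * k + 1" "\<Upsilon> < 1" using \<Upsilon> by auto
  have "0 \<le> (3 * real k - 1) / (3 * real k + 1)" using k by simp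
  then show "0 < \<Upsilon>" using \<Upsilon>(1) by linarith
  show "singleton_dixmier_property (CM :: ('a \<Rightarrow> complex^'n^'n) star_algebra)"
    by (rule cont_matrix_singleton_dixmier)
  interpret ring "CM :: ('a \<Rightarrow> complex^'n^'n) star_algebra" by (rule cont_matrix_ring)
  fix a assume "a \<in> self_adjoints (CM :: ('a \<Rightarrow> complex^'n^'n) star_algebra)"
  then have a: "a \<in> carrier CM" "star CM a = a" by (auto simp: self_adjoints_def)
  have herm: "cadjoint (a x) = a x" if "x \<in> topspace X" for x
    using fun_cong[OF a(2), of x] that by (simp add: cont_matrix_apply)
  define R where "R = trace_field a"
  have R: "R \<in> carrier CM" using trace_field_center[OF a(1)] by (simp add: R_def cstar_center_def)
  define a0 where "a0 = a \<ominus>\<^bsub>CM\<^esub> R"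
  have a0: "a0 \<in> carrier CM" using a(1) R by (simp add: a0_def)
  define r where "r x = trace (a x) / of_nat CARD('n)" for x
  have R_x: "R x = mat (r x)" if "x \<in> topspace X" for x
    using that by (simp add: R_def trace_field_def r_def)
  have a0_x: "a0 x = a x - mat (r x)" if "x \<in> topspace X" for x
    using cont_matrix_minus_apply[OF a(1) R that] R_x[OF that] by (simp add: a0_def)
  have herm0: "cadjoint (a0 x) = a0 x" if x: "x \<in> topspace X" for x
    using trace_cadjoint[of "a x"] herm[OF x] by (simp add: a0_x[OF x] r_def)
  have trace0: "trace (a0 x) = 0" if x: "x \<in> topspace X" for x
    by (simp add: a0_x[OF x] trace_sub trace_mat r_def)
  have field: "hermitian_field X a0"
    using a0 herm0 by (simp add: hermitian_field_def cont_matrix_carrier)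
  define N where "N = cnorm CM a0"
  have N: "N \<ge> 0" "\<And>x. x \<in> topspace X \<Longrightarrow> cmatrix_norm (a0 x) \<le> N"
    using cont_matrix_cnorm_bound[OF X a0] by (auto simp: N_def)
  \<comment> \<open>The slack in \<open>\<Upsilon>\<close>: with \<open>e = \<delta> * N\<close> the
    bound \<open>((3 k - 1) N + e) / (3 k + 1)\<close> is exactly \<open>\<Upsilon> * N\<close>.
    Again \<open>N = 0\<close> is set apart to keep \<open>e\<close> positive.\<close>
  define \<delta> where "\<delta> = \<Upsilon> * (3 * real k + 1) - (3 * real k - 1)"
  have \<delta>: "\<delta> > 0" using \<Upsilon>(1) by (simp add: \<delta>_def field_simps)
  define e where "e = (if N = 0 then 1 else \<delta> * N)"
  have "e > 0" using N(1) \<delta> by (simp add: e_def)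
  with mix field obtain u w where uw: "\<And>i. unitary_field X (u i)" "\<And>i. unitary_field X (w i)"
    and good: "\<And>x. x \<in> topspace X \<Longrightarrow> \<exists>i\<in>{1..k}.
      spread ((a0 x + u i x ** a0 x ** cadjoint (u i x))
        + w i x ** (a0 x + u i x ** a0 x ** cadjoint (u i x)) ** cadjoint (w i x))
          \<le> spread (a0 x) + e"
    unfolding mixing_def good_pair_def Let_def by metis
  \<comment> \<open>Position 1 holds the identity, and colour \<open>i\<close> occupies the
    positions \<open>3 i - 1\<close>, \<open>3 i\<close> and \<open>3 i + 1\<close> with
    \<open>u i\<close>, \<open>w i\<close> and their product. Shifting by one makes the quotient of
    \<open>j + 1\<close> by 3 the colour, and the remainder selects the unitary.\<close>
  define V where "V j = (let i = (j + 1) div 3; q = (j + 1) mod 3 in if i = 0 then (\<lambda>x. mat 1)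
    else if q = 0 then u i else if q = 1 then w i else (\<lambda>x. w i x ** u i x))" for j :: nat
  have V: "V 1 = (\<lambda>x. mat 1)" "\<And>i. i \<ge> 1 \<Longrightarrow> V (3 * i - 1) = u i" "\<And>i. i \<ge> 1 \<Longrightarrow> V (3 * i) = w i"
    "\<And>i. i \<ge> 1 \<Longrightarrow> V (3 * i + 1) = (\<lambda>x. w i x ** u i x)"
  proof -
    show "V 1 = (\<lambda>x. mat 1)" by (simp add: V_def)
    fix i :: nat assume i: "i \<ge> 1"
    have "(3 * i - 1 + 1) div 3 = i" "(3 * i - 1 + 1) mod 3 = 0" "(3 * i + 1) div 3 = i"
      "(3 * i + 1) mod 3 = 1"
      "(3 * i + 1 + 1) div 3 = i" "(3 * i + 1 + 1) mod 3 = 2" using i by presburger+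
    then show "V (3 * i - 1) = u i" "V (3 * i) = w i" "V (3 * i + 1) = (\<lambda>x. w i x ** u i x)"
      using i unfolding V_def Let_def by simp_all
  qed
  have wu: "unitary_field X (\<lambda>x. w i x ** u i x)" for i
    unfolding unitary_field_def
  proof (intro conjI ballI)
    show "continuous_map X euclidean (\<lambda>x. w i x ** u i x)"
      using uw[of i] unfolding unitary_field_def continuous_map_iff_tendsto
        by (auto intro!: tendsto_intros)
    fix x assume x: "x \<in> topspace X"
    have "cadjoint (w i x ** u i x) ** (w i x ** u i x)
      = cadjoint (u i x) ** (cadjoint (w i x) ** w i x) ** u i x"
      by (simp only: cadjoint_mult matrix_mul_assoc)
    then show "cadjoint (w i x ** u i x) ** (w i x ** u i x) = mat 1"
      using uw[of i] x by (simp add: unitary_field_def)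
  qed
  have V_unitary: "unitary_field X (V j)" for j
  proof -
    have "unitary_field X (\<lambda>x. mat 1 :: complex^'n^'n)" by (simp add: unitary_field_def)
    then show ?thesis unfolding V_def Let_def using uw wu by auto
  qed
  define U where "U j = restrict (V j) (topspace X)" for j
  have U: "U j \<in> unitaries CM" for j unfolding U_def by (intro cont_matrix_unitariesI V_unitary)
  define b where "b = unitary_average CM (3 * k + 1) U a"
  have b: "b \<in> carrier CM" unfolding b_def using U cont_matrix_unitariesD(1) a(1)
    by (intro cont_matrix_average) auto
  define S where "S x = a0 x + (\<Sum>i=1..k. u i x ** a0 x ** cadjoint (u i x)
    + w i x ** a0 x ** cadjoint (w i x)
      + (w i x ** u i x) ** a0 x ** cadjoint (w i x ** u i x))" for x
  have b_eq: "b x - R x = (1 / (3 * real k + 1)) *\<^sub>R S x" if x: "x \<in> topspace X" for x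
  proof -
    have conj: "V j x ** a x ** cadjoint (V j x)
      = V j x ** a0 x ** cadjoint (V j x) + mat (r x)" for j
    proof -
      have "V j x ** cadjoint (V j x) = mat 1"
        using V_unitary[of j] x unitary_other_side[of "V j x"] by (auto simp: unitary_field_def)
      moreover have "V j x ** mat (r x) ** cadjoint (V j x)
        = mat (r x) ** (V j x ** cadjoint (V j x))"
      proof -
        have "V j x ** mat (r x) = mat (r x) ** V j x"
          by (simp add: mat_mult_left mat_mult_right mult.commute)
        then show ?thesis by (simp only: matrix_mul_assoc)
      qed
      moreover have "a x = a0 x + mat (r x)" by (simp add: a0_x[OF x])
      ultimately show ?thesis by (simp add: matrix_add_ldistrib matrix_mult_add_left)
    qed
    have "b x = (1 / real (3 * k + 1)) *\<^sub>R (\<Sum>j=1..3 * k + 1. U j x ** a x ** cadjoint (U j x))"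
      unfolding b_def using U cont_matrix_unitariesD(1) a(1) x by (intro cont_matrix_average) auto
    also have "(\<Sum>j=1..3 * k + 1. U j x ** a x ** cadjoint (U j x)) =
        (\<Sum>j=1..3 * k + 1. V j x ** a0 x ** cadjoint (V j x)) + real (3 * k + 1) *\<^sub>R mat (r x)"
      using x by (simp only: U_def restrict_apply' conj sum.distrib sum_constant_scaleR) simp
    also have "(\<Sum>j=1..3 * k + 1. V j x ** a0 x ** cadjoint (V j x)) = S x"
      unfolding sum_triples S_def
    proof (intro arg_cong2[where f = "(+)"] sum.cong refl)
      show "V 1 x ** a0 x ** cadjoint (V 1 x) = a0 x" by (simp add: V(1)[simplified])
      fix i assume "i \<in> {1..k}"
      then have "i \<ge> 1" by simp
      then show "V (3 * i - 1) x ** a0 x ** cadjoint (V (3 * i - 1) x)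
        = u i x ** a0 x ** cadjoint (u i x)"
        "V (3 * i) x ** a0 x ** cadjoint (V (3 * i) x) = w i x ** a0 x ** cadjoint (w i x)"
        "V (3 * i + 1) x ** a0 x ** cadjoint (V (3 * i + 1) x) =
          (w i x ** u i x) ** a0 x ** cadjoint (w i x ** u i x)"
        by (simp_all only: V(2-4))
    qed
    also have "(1 / real (3 * k + 1)) *\<^sub>R (S x + real (3 * k + 1) *\<^sub>R mat (r x)) =
        (1 / (3 * real k + 1)) *\<^sub>R S x + mat (r x)"
    proof -
      have "1 / real (3 * k + 1) * real (3 * k + 1) = 1" by simp
      then have "(1 / real (3 * k + 1)) *\<^sub>R (S x + real (3 * k + 1) *\<^sub>R mat (r x)) =
          (1 / real (3 * k + 1)) *\<^sub>R S x + mat (r x)"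
        by (simp only: scaleR_right_distrib scaleR_scaleR scaleR_one)
      then show ?thesis by simp
    qed
    finally show ?thesis by (simp add: R_x[OF x])
  qed
  have norm_S: "cmatrix_norm (S x) \<le> (3 * real k - 1) * N + \<delta> * N" if x: "x \<in> topspace X" for x
  proof (cases "N = 0")
    case True
    then have "a0 x = 0"
      using N(2)[OF x] cmatrix_norm_nonneg[of "a0 x"] by (simp flip: cmatrix_norm_eq_0)
    then show ?thesis using True by (simp add: S_def)
  next
    case False
    then have e: "e = \<delta> * N" by (simp add: e_def)
    obtain i where "i \<in> {1..k}" "spread ((a0 x + u i x ** a0 x ** cadjoint (u i x))
        + w i x ** (a0 x + u i x ** a0 x ** cadjoint (u i x)) ** cadjoint (w i x))
          \<le> spread (a0 x) + e"
      using good[OF x] by blast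
    then have "cmatrix_norm (S x) \<le> (3 * real k - 1) * cmatrix_norm (a0 x) + e"
      unfolding S_def using uw x herm0[OF x] trace0[OF x]
      by (intro norm_average_le) (auto simp: unitary_field_def)
    also have "(3 * real k - 1) * cmatrix_norm (a0 x) \<le> (3 * real k - 1) * N"
      using N(2)[OF x] k by (intro mult_left_mono) auto
    finally show ?thesis by (simp add: e)
  qed
  have "cnorm CM (b \<ominus>\<^bsub>CM\<^esub> R) \<le> \<Upsilon> * N"
  proof (subst cont_matrix_cnorm_le_iff[OF X], goal_cases)
    case 1
    show ?case using b R by simp
  next
    case 2
    have "cmatrix_norm ((b \<ominus>\<^bsub>CM\<^esub> R) x) \<le> \<Upsilon> * N" if x: "x \<in> topspace X" for x
    proof -
      have "cmatrix_norm ((b \<ominus>\<^bsub>CM\<^esub> R) x) = (1 / (3 * real k + 1)) * cmatrix_norm (S x)"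
        using x b R by (simp add: cont_matrix_minus_apply b_eq cmatrix_norm_scaleR)
      also have "\<dots> \<le> (1 / (3 * real k + 1)) * ((3 * real k - 1) * N + \<delta> * N)"
        using norm_S[OF x] by (intro mult_left_mono) auto
      also have "\<dots> = \<Upsilon> * N" by (simp add: \<delta>_def field_simps)
      finally show ?thesis .
    qed
    moreover have "0 \<le> \<Upsilon> * N" using \<open>0 < \<Upsilon>\<close> N(1) by simp
    ultimately show ?case by blast
  qed
  then show "\<exists>u. (\<forall>i\<in>{1..3 * k + 1}. u i \<in> unitaries CM) \<and>
      cnorm CM (unitary_average CM (3 * k + 1) u a \<ominus>\<^bsub>CM\<^esub> center_valued_trace CM a)
        \<le> \<Upsilon> * cnorm CM (a \<ominus>\<^bsub>CM\<^esub> center_valued_trace CM a)"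
    using U unfolding b_def N_def a0_def R_def cont_matrix_center_valued_trace[OF a(1)] by blast
qed

end

theorem theorem3p30:
  fixes X :: "'a topology" and d :: nat
  assumes "compact_space X" and "Hausdorff_space X"
    and "has_covering_dimension X d"
  defines "A \<equiv> cont_matrix_algebra X :: ('a \<Rightarrow> complex^'n^'n) star_algebra"
  shows
    "(\<forall>\<gamma>. (real d + 1) / (real d + 2) < \<gamma> \<and> \<gamma> < 1 \<longrightarrow>
        uniform_dixmier_property A (d + 2) \<gamma>) \<and>
     (\<forall>\<Upsilon>. (3 * real d + 2) / (3 * real d + 4) < \<Upsilon> \<and> \<Upsilon> < 1 \<longrightarrow>
        uniform_singleton_dixmier_property A (3 * d + 4) \<Upsilon>) \<and>
     (d \<le> 2 \<and> cech_cohomology 2 X = {cech_zero 2 X} \<longrightarrow>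
        (\<forall>\<gamma>. 1 / 2 < \<gamma> \<and> \<gamma> < 1 \<longrightarrow> uniform_dixmier_property A 2 \<gamma>) \<and>
        (\<forall>\<Upsilon>. 1 / 2 < \<Upsilon> \<and> \<Upsilon> < 1 \<longrightarrow> uniform_singleton_dixmier_property A 4 \<Upsilon>))"
proof -
  have dim: "covering_multiplicity_le X (d + 1)"
    using assms(3) by (simp add: has_covering_dimension_def)
  \<comment> \<open>For \<open>k = d + 1\<close> the numbers of unitaries \<open>k + 1\<close> and
    \<open>3 * k + 1\<close> become \<open>d + 2\<close> and \<open>3 * d + 4\<close>, with the
    bounds for the constants changing accordingly.\<close>
  have mix: "mixing X (d + 1) TYPE('n)"
    by (rule mixing_if_covering_multiplicity[OF assms(1,2) dim])
  have i1: "uniform_dixmier_property A (d + 2) \<gamma>" if "(real d + 1) / (real d + 2) < \<gamma>" "\<gamma> < 1" for \<gamma>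
    using uniform_dixmier_if_mixing[OF assms(1) mix, of \<gamma>] that by (simp add: A_def add.commute)
  have i2: "uniform_singleton_dixmier_property A (3 * d + 4) \<Upsilon>"
    if "(3 * real d + 2) / (3 * real d + 4) < \<Upsilon>" "\<Upsilon> < 1" for \<Upsilon>
  proof -
    have "3 * real (d + 1) - 1 = 3 * real d + 2" "3 * real (d + 1) + 1 = 3 * real d + 4"
      "3 * (d + 1) + 1 = 3 * d + 4" by simp_all
    then show ?thesis
      using uniform_singleton_dixmier_if_mixing[OF assms(1) mix, of \<Upsilon>] that unfolding A_def
      by (metis le_add2)
  qed
  have ii: "uniform_dixmier_property A 2 \<gamma>" "uniform_singleton_dixmier_property A 4 \<gamma>"
    if "d \<le> 2" "cech_cohomology 2 X = {cech_zero 2 X}" "1 / 2 < \<gamma>" "\<gamma> < 1" for \<gamma>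
  proof -
    \<comment> \<open>Multiplicity 3 matches the real dimension 3 of the traceless Hermitian 2 by 2
      matrices. For \<open>k = 1\<close> both bounds for the constants are 1/2.\<close>
    have "covering_multiplicity_le X 3" by (rule covering_multiplicity_mono[OF dim]) (use that in
      simp)
    then have mix: "mixing X 1 TYPE('n)"
      by (intro mixing_1_if_top_fields has_top_fields_if_cech_trivial assms that)
    show "uniform_dixmier_property A 2 \<gamma>" "uniform_singleton_dixmier_property A 4 \<gamma>"
      using uniform_dixmier_if_mixing[OF assms(1) mix, of \<gamma>]
        uniform_singleton_dixmier_if_mixing[OF assms(1) mix, of \<gamma>] that
      by (simp_all add: A_def numeral_2_eq_2)
  qed
  show ?thesis using i1 i2 ii by blast
qed

end
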